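(* Let $x\in X_0$ be an isometry class of non-pinched configurations. There is a sequence $(\gamma_n)_{n\ge 0}$ in $\mathrm{Mod}(S_o)$ such that the sequence $([\gamma_n\cdot x])_{n\ge 0}$ converges to the isometry class of the singular configurations. The sequence is provided by a geometric algorithm.
   Context: For $x$ in the hyperbolic plane $\mathbb{H}^2$, let $s_x\in\mathrm{PSL}_2(\mathbb{R})$ be the rotation of angle $\pi$ around $x$. Let $$\mathrm{Sex}=\{(x_1,\ldots,x_6)\in(\mathbb{H}^2)^6 : s_{x_6}\cdots s_{x_1}=1\},$$ whose elements are called (sextuple) configurations, and let $X=\mathrm{Sex}/\mathrm{PSL}_2(\mathbb{R})$ be the quotient by the diagonal action, with the quotient topology; its elements are called isometry classes of configurations, and brackets $[\cdot]$ denote isometry classes. For $i\in\{1,\ldots,6\}$ (indices taken cyclically mod 6), the leapfrog move $L_i:\mathrm{Sex}\to\mathrm{Sex}$ replaces $x_i$ by $x_{i+1}$ and $x_{i+1}$ by $s_{x_{i+1}}(x_i)$, and leaves the other four points unchanged. It is a bijection commuting with the diagonal action of $\mathrm{PSL}_2(\mathbb{R})$. $\mathrm{Mod}(S_o)$ denotes the group generated by the leapfrog moves; it acts on $\mathrm{Sex}$ and on $X$. A configuration is pinched if it lies in the $\mathrm{Mod}(S_o)$-orbit of a configuration with $x_1=x_2$, $x_3=x_4$, $x_5=x_6$. A configuration is singular if $x_1=x_2=\cdots=x_6$; all singular configurations form a single isometry class. $X$ has three connected components, and $X_0$ denotes the one containing the isometry class of the singular configurations. "Geometric algorithm" (or "real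 number algorithm") means that the leapfrog moves are obtained by iterating an explicit geometric procedure, by compass and straightedge construction, applied to the six points; it is not called simply an algorithm only because the data of six points in the plane is not a finite information in terms of a finite alphabet. *)

theory Defs
  imports "HOL-Analysis.Analysis" "HOL-Algebra.Bij" "HOL-Algebra.Generated_Groups"
begin

section \<open>The hyperbolic plane and PSL(2,R)\<close>

typedef h2 = "{z :: complex. 0 < Im z}"
  morphisms of_h2 Abs_h2
  by (rule exI[of _ \<i>]) simp

setup_lifting type_definition_h2

lemma Im_of_h2 [simp]: "0 < Im (of_h2 z)"
  using of_h2 by auto

text \<open>The upper half-plane is open in the complex plane, so this is its subspace topology.\<close>

instantiation h2 :: topological_space
begin

definition open_h2 :: "h2 set \<Rightarrow> bool"
  where "open_h2 U \<longleftrightarrow> open (of_h2 ` U)"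

instance
proof
  have "range of_h2 = {z. 0 < Im z}"
    using type_definition.Rep_range[OF type_definition_h2] .
  then show "open (UNIV :: h2 set)"
    by (simp add: open_h2_def open_halfspace_Im_gt)
  show "open (S \<inter> T)" if "open S" "open T" for S T :: "h2 set"
    using that by (simp add: open_h2_def image_Int of_h2_inject inj_on_def open_Int)
  show "open (\<Union>K)" if "\<forall>S\<in>K. open S" for K :: "h2 set set"
    using that by (auto simp: open_h2_def image_Union intro!: open_Union)
qed

end

definition hdist :: "h2 \<Rightarrow> h2 \<Rightarrow> real"
  where "hdist z w =
    arcosh (1 + (cmod (of_h2 z - of_h2 w))\<^sup>2 / (2 * Im (of_h2 z) * Im (of_h2 w)))"

text \<open>In the coordinates \<open>(Re z, |z|\<^sup>2)\<close> (a Klein model, bounded by a parabola) the geodesics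
  \<open>Re z = a\<close> and \<open>|z - a| = r\<close> become straight lines, and the change of coordinates preserves
  the orientation since \<open>Im z > 0\<close>.  Hence this planar determinant is positive, zero or negative
  according to whether \<open>r\<close> lies to the left of, on, or to the right of the geodesic running from
  \<open>p\<close> to \<open>q\<close>.\<close>

definition orient :: "h2 \<Rightarrow> h2 \<Rightarrow> h2 \<Rightarrow> real"
  where "orient p q r =
    (Re (of_h2 q) - Re (of_h2 p)) * ((cmod (of_h2 r))\<^sup>2 - (cmod (of_h2 p))\<^sup>2) -
    ((cmod (of_h2 q))\<^sup>2 - (cmod (of_h2 p))\<^sup>2) * (Re (of_h2 r) - Re (of_h2 p))"

definition hline :: "h2 \<Rightarrow> h2 \<Rightarrow> h2 set"
  where "hline p q = {z. p \<noteq> q \<and> orient p q z = 0}"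

definition hcircle :: "h2 \<Rightarrow> real \<Rightarrow> h2 set"
  where "hcircle p r = {z. hdist p z = r}"

definition psl_rel :: "real^2^2 \<Rightarrow> real^2^2 \<Rightarrow> bool"
  where "psl_rel A B \<longleftrightarrow> det A = 1 \<and> det B = 1 \<and> (A = B \<or> A = - B)"

lemma det_uminus_2: "det (- A) = det A" for A :: "real^2^2"
  by (simp add: det_2)

lemma matrix_mult_uminus [simp]:
  "(- A) ** B = - (A ** B)" "A ** (- B) = - (A ** B)" for A B :: "real^2^2"
  by (simp_all add: matrix_matrix_mult_def vec_eq_iff sum_2)

quotient_type psl2r = "real^2^2" / partial: psl_rel
proof (rule part_equivpI)
  show "\<exists>A. psl_rel A A"
    by (rule exI[of _ "mat 1"]) (simp add: psl_rel_def)
  show "symp psl_rel"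
    by (auto simp: psl_rel_def symp_def)
  show "transp psl_rel"
    by (auto simp: psl_rel_def transp_def)
qed

instantiation psl2r :: monoid_mult
begin

lift_definition one_psl2r :: psl2r is "mat 1"
  by (simp add: psl_rel_def)

lift_definition times_psl2r :: "psl2r \<Rightarrow> psl2r \<Rightarrow> psl2r" is "(**)"
  by (auto simp: psl_rel_def det_mul)

instance
  by standard (transfer; auto simp: psl_rel_def det_mul matrix_mul_assoc)+

end

definition linfrac :: "real^2^2 \<Rightarrow> complex \<Rightarrow> complex"
  where "linfrac A z =
    (complex_of_real (A$1$1) * z + complex_of_real (A$1$2)) /
    (complex_of_real (A$2$1) * z + complex_of_real (A$2$2))"

lemma linfrac_denom_nz:
  fixes A :: "real^2^2"
  assumes "det A = 1" "0 < Im z"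
  shows "complex_of_real (A$2$1) * z + complex_of_real (A$2$2) \<noteq> 0"
  using assms by (auto simp: complex_eq_iff det_2)

lemma Im_linfrac:
  fixes A :: "real^2^2"
  assumes "det A = 1" "0 < Im z"
  shows "0 < Im (linfrac A z)"
proof -
  let ?d = "complex_of_real (A$2$1) * z + complex_of_real (A$2$2)"
  have nz: "?d \<noteq> 0"
    by (rule linfrac_denom_nz[OF assms])
  have "Im (linfrac A z) = (A$1$1 * A$2$2 - A$1$2 * A$2$1) * Im z / (cmod ?d)\<^sup>2"
    unfolding linfrac_def Im_divide' by (simp add: algebra_simps)
  then show ?thesis
    using assms nz by (simp add: det_2)
qed

lemma linfrac_uminus: "linfrac (- A) z = linfrac A z"
proof -
  have "linfrac (- A) z =
      (- (complex_of_real (A$1$1) * z + complex_of_real (A$1$2))) /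
      (- (complex_of_real (A$2$1) * z + complex_of_real (A$2$2)))"
    by (simp add: linfrac_def)
  then show ?thesis
    unfolding minus_divide_divide linfrac_def .
qed

lemma linfrac_mult:
  assumes "det B = 1" "0 < Im z"
  shows "linfrac (A ** B) z = linfrac A (linfrac B z)"
  using linfrac_denom_nz[OF assms]
  by (simp add: linfrac_def matrix_matrix_mult_def sum_2 divide_simps) (simp add: algebra_simps)

lift_definition psl_act :: "psl2r \<Rightarrow> h2 \<Rightarrow> h2"  (infixr "\<bullet>\<^sub>H" 75) is linfrac
  by (auto simp: psl_rel_def linfrac_uminus Im_linfrac)

lemma psl_act_one [simp]: "1 \<bullet>\<^sub>H z = z"
  by transfer (simp add: linfrac_def mat_def)

lemma psl_act_mult: "(g * h) \<bullet>\<^sub>H z = g \<bullet>\<^sub>H h \<bullet>\<^sub>H z"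
  by transfer (auto simp: psl_rel_def linfrac_mult linfrac_uminus)

text \<open>The matrix of \<open>s\<^bsub>a+ib\<^esub>\<close> is the conjugate by \<open>z \<mapsto> b z + a\<close> of the
  matrix \<open>((0,-1),(1,0))\<close> of \<open>z \<mapsto> -1/z\<close>.\<close>

definition half_turn_matrix :: "complex \<Rightarrow> real^2^2"
  where "half_turn_matrix x =
    vector [vector [Re x / Im x, - (((Re x)\<^sup>2 + (Im x)\<^sup>2) / Im x)],
            vector [1 / Im x, - (Re x / Im x)]]"

lemma det_half_turn_matrix: "0 < Im x \<Longrightarrow> det (half_turn_matrix x) = 1"
  by (simp add: half_turn_matrix_def det_2 field_simps power2_eq_square)

lift_definition half_turn :: "h2 \<Rightarrow> psl2r" is half_turn_matrix
  by (simp add: psl_rel_def det_half_turn_matrix)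

lemma linfrac_half_turn_matrix:
  assumes "0 < Im x" "0 < Im z"
  shows "linfrac (half_turn_matrix x) z =
    (complex_of_real (Re x) * z - complex_of_real ((Re x)\<^sup>2 + (Im x)\<^sup>2)) / (z - complex_of_real (Re x))"
proof -
  let ?b = "complex_of_real (Im x)"
  have "linfrac (half_turn_matrix x) z =
      ((complex_of_real (Re x) * z - complex_of_real ((Re x)\<^sup>2 + (Im x)\<^sup>2)) / ?b) /
      ((z - complex_of_real (Re x)) / ?b)"
    by (simp add: linfrac_def half_turn_matrix_def diff_divide_distrib)
  also have "\<dots> = (complex_of_real (Re x) * z - complex_of_real ((Re x)\<^sup>2 + (Im x)\<^sup>2)) /
      (z - complex_of_real (Re x))"
    using assms by simp
  finally show ?thesis .
qed

text \<open>The element \<open>half_turn x\<close> fixes \<open>x\<close> with derivative \<open>-1\<close> there: it is the rotation of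
  angle \<open>\<pi>\<close>.\<close>

lemma half_turn_fixes: "half_turn x \<bullet>\<^sub>H x = x"
proof transfer
  fix x :: complex
  assume x: "0 < Im x"
  then have "x - complex_of_real (Re x) \<noteq> 0"
    by (auto simp: complex_eq_iff)
  then show "linfrac (half_turn_matrix x) x = x"
    unfolding linfrac_half_turn_matrix[OF x x]
    by (simp add: divide_eq_eq) (simp add: complex_eq_iff power2_eq_square algebra_simps)
qed

lemma half_turn_derivative:
  assumes x: "0 < Im x"
  shows "(linfrac (half_turn_matrix x) has_field_derivative -1) (at x)"
proof -
  let ?a = "complex_of_real (Re x)" and ?n = "complex_of_real ((Re x)\<^sup>2 + (Im x)\<^sup>2)"
  have nz: "x - ?a \<noteq> 0"
    using x by (auto simp: complex_eq_iff)
  have sq: "?n - ?a * ?a = - ((x - ?a) * (x - ?a))"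
    by (simp add: complex_eq_iff power2_eq_square)
  have "((\<lambda>z. (?a * z - ?n) / (z - ?a)) has_field_derivative
      (?a * (x - ?a) - (?a * x - ?n)) / ((x - ?a) * (x - ?a))) (at x)"
    using nz by (auto intro!: derivative_eq_intros)
  also have "(?a * (x - ?a) - (?a * x - ?n)) = ?n - ?a * ?a"
    by (simp add: algebra_simps)
  also have "\<dots> / ((x - ?a) * (x - ?a)) = -1"
    unfolding sq using nz by simp
  finally have D: "((\<lambda>z. (?a * z - ?n) / (z - ?a)) has_field_derivative -1) (at x)" .
  show ?thesis
    by (rule has_field_derivative_transform_within_open[OF D open_halfspace_Im_gt[of 0]])
       (use x in \<open>simp_all add: linfrac_half_turn_matrix\<close>)
qed

lemma half_turn_square: "half_turn x * half_turn x = 1"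
proof transfer
  fix x :: complex
  assume x: "0 < Im x"
  have "half_turn_matrix x ** half_turn_matrix x = - mat 1"
    using x
    by (simp add: vec_eq_iff forall_2 matrix_matrix_mult_def sum_2 half_turn_matrix_def mat_def)
       (simp add: field_simps power2_eq_square)
  then show "psl_rel (half_turn_matrix x ** half_turn_matrix x) (mat 1)"
    by (simp add: psl_rel_def det_uminus_2)
qed

lemma half_turn_square_left: "half_turn x * (half_turn x * g) = g"
  by (simp add: half_turn_square flip: mult.assoc)

lemma half_turn_conj:
  "half_turn (half_turn y \<bullet>\<^sub>H x) = half_turn y * half_turn x * half_turn y"
proof transfer
  fix y x :: complex
  assume y: "0 < Im y" and x: "0 < Im x"
  define w where "w = linfrac (half_turn_matrix y) x"
  define N where "N = (Re x - Re y)\<^sup>2 + (Im x)\<^sup>2"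
  have N: "0 < N"
    using x by (simp add: N_def add_nonneg_pos)
  have w: "0 < Im w"
    using Im_linfrac det_half_turn_matrix x y w_def by blast
  have Imw: "Im w = Im x * (Im y)\<^sup>2 / N"
    unfolding w_def linfrac_half_turn_matrix[OF y x] N_def Im_divide
    by (simp add: power2_eq_square algebra_simps)
  have Rew: "Re w = ((Re y * Re x - (Re y)\<^sup>2 - (Im y)\<^sup>2) * (Re x - Re y) + Re y * (Im x)\<^sup>2) / N"
    unfolding w_def linfrac_half_turn_matrix[OF y x] N_def Re_divide
    by (simp add: power2_eq_square algebra_simps)
  have sq: "(Re w)\<^sup>2 + (Im w)\<^sup>2 =
      ((Re y * Re x - (Re y)\<^sup>2 - (Im y)\<^sup>2)\<^sup>2 + (Re y)\<^sup>2 * (Im x)\<^sup>2) / N"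
  proof -
    have "(cmod w)\<^sup>2 = ((Re y * Re x - (Re y)\<^sup>2 - (Im y)\<^sup>2)\<^sup>2 + (Re y)\<^sup>2 * (Im x)\<^sup>2) / N"
      unfolding w_def linfrac_half_turn_matrix[OF y x] N_def norm_divide power_divide cmod_power2
      by (simp add: power2_eq_square algebra_simps)
    then show ?thesis
      by (simp add: cmod_power2)
  qed
  have "half_turn_matrix w = - (half_turn_matrix y ** half_turn_matrix x ** half_turn_matrix y)"
    unfolding vec_eq_iff forall_2 half_turn_matrix_def
    apply (simp add: matrix_matrix_mult_def sum_2 sq)
    unfolding Imw Rew 
    using x y N
    apply (simp add: divide_simps)
    apply (simp add: N_def power2_eq_square algebra_simps)
    done
  then show "psl_rel (half_turn_matrix (linfrac (half_turn_matrix y) x))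
      (half_turn_matrix y ** half_turn_matrix x ** half_turn_matrix y)"
    using w x y by (simp add: w_def psl_rel_def det_half_turn_matrix det_mul det_uminus_2)
qed

section \<open>Configurations and leapfrog moves\<close>

text \<open>The index type \<open>6\<close> is the ring of integers modulo 6, so that indices are cyclic
  and \<open>6 = 0\<close>.\<close>

type_synonym config = "h2 ^ 6"

definition Sex :: "config set"
  where "Sex = {x. half_turn (x$6) * half_turn (x$5) * half_turn (x$4) *
                   half_turn (x$3) * half_turn (x$2) * half_turn (x$1) = 1}"

definition leapfrog :: "6 \<Rightarrow> config \<Rightarrow> config"
  where "leapfrog i x =
    (\<chi> j. if j = i then x$(i+1) else if j = i + 1 then half_turn (x$(i+1)) \<bullet>\<^sub>H x$i else x$j)"

text \<open>The library group \<open>BijGroup S\<close> consists of the bijections of \<open>S\<close>, normalised to be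
  \<open>undefined\<close> outside \<open>S\<close>.\<close>

definition leapfrog_elt :: "6 \<Rightarrow> config \<Rightarrow> config"
  where "leapfrog_elt i = restrict (leapfrog i) Sex"

definition Mod_So :: "(config \<Rightarrow> config) set"
  where "Mod_So = generate (BijGroup Sex) (range leapfrog_elt)"

lemma exhaust_6: "x = 1 \<or> x = 2 \<or> x = 3 \<or> x = 4 \<or> x = 5 \<or> x = 6" for x :: 6
proof (induct x)
  case (of_int z)
  then have "0 \<le> z" "z < 6"
    by simp_all
  then have "z = 0 \<or> z = 1 \<or> z = 2 \<or> z = 3 \<or> z = 4 \<or> z = 5"
    by arith
  then show ?case
    by auto
qed

lemma seven_eq: "(7 :: 6) = 1"
  by simp

lemma Sex_relations:
  assumes "x \<in> Sex"
  shows "half_turn (x$6) * (half_turn (x$5) * (half_turn (x$4) *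
           (half_turn (x$3) * (half_turn (x$2) * half_turn (x$1))))) = 1"
    and "half_turn (x$5) * (half_turn (x$4) * (half_turn (x$3) * (half_turn (x$2) * g))) =
           half_turn (x$6) * (half_turn (x$1) * g)"
proof -
  let ?s = "\<lambda>j. half_turn (x$j)"
  show eq: "?s 6 * (?s 5 * (?s 4 * (?s 3 * (?s 2 * ?s 1)))) = 1"
    using assms by (simp add: Sex_def mult.assoc)
  have "?s 5 * (?s 4 * (?s 3 * (?s 2 * ?s 1))) = ?s 6"
    by (metis eq half_turn_square_left mult.right_neutral)
  then have "?s 5 * (?s 4 * (?s 3 * (?s 2 * ?s 1))) * ?s 1 = ?s 6 * ?s 1"
    by simp
  then have "?s 5 * (?s 4 * (?s 3 * ?s 2)) = ?s 6 * ?s 1"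
    by (simp add: mult.assoc half_turn_square)
  from arg_cong[OF this, of "\<lambda>h. h * g"]
  show "?s 5 * (?s 4 * (?s 3 * (?s 2 * g))) = ?s 6 * (?s 1 * g)"
    by (simp add: mult.assoc)
qed

lemma leapfrog_in_Sex:
  assumes "x \<in> Sex"
  shows "leapfrog i x \<in> Sex"
proof (cases "i = 6")
  case True
  have c: "leapfrog 6 x $ 6 = x$1" "leapfrog 6 x $ 1 = half_turn (x$1) \<bullet>\<^sub>H x$6"
    "leapfrog 6 x $ 2 = x$2" "leapfrog 6 x $ 3 = x$3" "leapfrog 6 x $ 4 = x$4" "leapfrog 6 x $ 5 = x$5"
    by (simp_all add: leapfrog_def seven_eq)
  show ?thesis
    unfolding True Sex_def mem_Collect_eq c half_turn_conj mult.assoc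
    unfolding Sex_relations(2)[OF assms] half_turn_square_left half_turn_square ..
next
  case False
  then show ?thesis
    using exhaust_6[of i] Sex_relations(1)[OF assms]
    by (auto simp: Sex_def leapfrog_def half_turn_conj mult.assoc
        half_turn_square half_turn_square_left)
qed

lemma leapfrog_elt_Bij: "leapfrog_elt i \<in> carrier (BijGroup Sex)"
proof -
  define u :: "config \<Rightarrow> config" where
    "u x = (\<chi> j. if j = i then half_turn (x$i) \<bullet>\<^sub>H x$(i+1) else if j = i + 1 then x$i else x$j)" for x
  have u_Sex: "u x \<in> Sex" if x: "x \<in> Sex" for x
  proof (cases "i = 6")
    case True
    have c: "u x $ 6 = half_turn (x$6) \<bullet>\<^sub>H x$1" "u x $ 1 = x$6"
      "u x $ 2 = x$2" "u x $ 3 = x$3" "u x $ 4 = x$4" "u x $ 5 = x$5"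
      by (simp_all add: u_def seven_eq True)
    show ?thesis
      unfolding Sex_def mem_Collect_eq c half_turn_conj mult.assoc
      unfolding Sex_relations(2)[OF x] half_turn_square_left half_turn_square ..
  next
    case False
    then show ?thesis
      using exhaust_6[of i] Sex_relations(1)[OF x]
      by (auto simp: Sex_def u_def half_turn_conj mult.assoc
          half_turn_square half_turn_square_left)
  qed
  have 1: "u (leapfrog i x) = x" for x
    by (simp add: vec_eq_iff u_def leapfrog_def half_turn_square flip: psl_act_mult)
  have 2: "leapfrog i (u x) = x" for x
    by (simp add: vec_eq_iff u_def leapfrog_def half_turn_square flip: psl_act_mult)
  have "bij_betw (leapfrog i) Sex Sex"
    by (rule bij_betw_byWitness[where f' = u]) (auto simp: 1 2 u_Sex leapfrog_in_Sex)
  then show ?thesis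
    by (simp add: BijGroup_def Bij_def leapfrog_elt_def cong: bij_betw_cong)
qed

section \<open>The space of isometry classes\<close>

definition iso_class :: "config \<Rightarrow> config set"
  where "iso_class x = range (\<lambda>g. \<chi> i. g \<bullet>\<^sub>H x$i)"

text \<open>The quotient space \<open>X = Sex / PSL(2,R)\<close> with the quotient topology.\<close>

definition X_top :: "config set topology"
  where "X_top = topology (\<lambda>U. U \<subseteq> iso_class ` Sex \<and>
    openin (top_of_set Sex) {x \<in> Sex. iso_class x \<in> U})"

lemma openin_X_top: "openin X_top U \<longleftrightarrow>
    U \<subseteq> iso_class ` Sex \<and> openin (top_of_set Sex) {x \<in> Sex. iso_class x \<in> U}"
proof -
  let ?P = "\<lambda>U. U \<subseteq> iso_class ` Sex \<and> openin (top_of_set Sex) {x \<in> Sex. iso_class x \<in> U}"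
  have "istopology ?P"
    unfolding istopology_def
  proof (intro conjI allI impI; (elim conjE)?)
    fix S T
    assume "openin (top_of_set Sex) {x \<in> Sex. iso_class x \<in> S}"
      "openin (top_of_set Sex) {x \<in> Sex. iso_class x \<in> T}"
    then have "openin (top_of_set Sex)
        ({x \<in> Sex. iso_class x \<in> S} \<inter> {x \<in> Sex. iso_class x \<in> T})"
      by (rule openin_Int)
    moreover have "{x \<in> Sex. iso_class x \<in> S} \<inter> {x \<in> Sex. iso_class x \<in> T} =
        {x \<in> Sex. iso_class x \<in> S \<inter> T}"
      by auto
    ultimately show "openin (top_of_set Sex) {x \<in> Sex. iso_class x \<in> S \<inter> T}"
      by simp
  next
    fix K
    assume "\<forall>S\<in>K. ?P S"
    then have "openin (top_of_set Sex) (\<Union>S\<in>K. {x \<in> Sex. iso_class x \<in> S})"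
      by (intro openin_Union) auto
    moreover have "(\<Union>S\<in>K. {x \<in> Sex. iso_class x \<in> S}) = {x \<in> Sex. iso_class x \<in> \<Union>K}"
      by auto
    ultimately show "openin (top_of_set Sex) {x \<in> Sex. iso_class x \<in> \<Union>K}"
      by simp
  qed auto
  then show ?thesis
    unfolding X_top_def by (simp add: topology_inverse')
qed

lemma quotient_map_iso_class: "quotient_map (top_of_set Sex) X_top iso_class"
proof -
  have "openin X_top (iso_class ` Sex)"
  proof -
    have "{x \<in> Sex. iso_class x \<in> iso_class ` Sex} = topspace (top_of_set Sex)"
      by auto
    then show ?thesis
      unfolding openin_X_top by (metis openin_topspace order_refl)
  qed
  then have "topspace X_top = iso_class ` Sex"
    by (metis openin_X_top openin_subset openin_topspace subset_antisym)
  then show ?thesis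
    by (auto simp: quotient_map_def openin_X_top)
qed

definition singular_class :: "config set"
  where "singular_class = {x. \<forall>i j. x$i = x$j}"

lemma psl_act_transitive: "\<exists>g. g \<bullet>\<^sub>H p = q"
proof transfer
  fix p q :: complex
  assume p: "0 < Im p" and q: "0 < Im q"
  define t where "t = Im q / Im p"
  have t: "0 < t"
    using p q by (simp add: t_def)
  define A :: "real^2^2" where
    "A = vector [vector [sqrt t, (Re q - t * Re p) / sqrt t], vector [0, 1 / sqrt t]]"
  have "det A = 1"
    using t by (simp add: A_def det_2)
  moreover have "linfrac A p = q"
    using t p by (simp add: A_def linfrac_def complex_eq_iff t_def[symmetric] field_simps
        flip: of_real_mult) (simp add: t_def)
  ultimately show "\<exists>A\<in>Collect (\<lambda>A. psl_rel A A). linfrac A p = q"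
    by (auto simp: psl_rel_def)
qed

lemma iso_class_singular: "iso_class (\<chi> i. p) = singular_class"
proof (rule Set.set_eqI)
  fix y :: config
  show "y \<in> iso_class (\<chi> i. p) \<longleftrightarrow> y \<in> singular_class"
  proof
    assume "y \<in> singular_class"
    moreover obtain g where "g \<bullet>\<^sub>H p = y$1"
      using psl_act_transitive by blast
    ultimately have "y = (\<chi> i. g \<bullet>\<^sub>H p)"
      by (auto simp: singular_class_def vec_eq_iff)
    then show "y \<in> iso_class (\<chi> i. p)"
      by (auto simp: iso_class_def)
  qed (auto simp: iso_class_def singular_class_def)
qed

definition X0 :: "config set set"
  where "X0 = connected_component_of_set X_top singular_class"

definition pinched :: "config \<Rightarrow> bool"
  where "pinched x \<longleftrightarrow>
    (\<exists>\<gamma>\<in>Mod_So. \<exists>y\<in>Sex. y$1 = y$2 \<and> y$3 = y$4 \<and> y$5 = y$6 \<and> x = \<gamma> y)"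

section \<open>Geometric algorithms\<close>

text \<open>A procedure is a finite program whose data are the six points of the current configuration
  (\<open>Vertex i\<close>), auxiliary points (\<open>Aux k\<close>) and natural-number counters for the discrete
  bookkeeping.  New points are only obtained by hyperbolic compass and straightedge, and the only
  other information about the points is read off from the figure: coincidence, comparison
  of distances, sides of lines, and whether two constructed curves meet.\<close>

datatype point = Vertex "6" | Aux nat

datatype curve =
    Line point point
  | Circle point point point  \<comment> \<open>center, and two points whose distance is the radius\<close>

datatype test =
    Same point point
  | Closer point point point point  \<comment> \<open>the first two are closer than the last two\<close>
  | LeftOf point point point  \<comment> \<open>the third is strictly to the left of the line from the first to the second\<close>
  | Meet curve curve
  | IsZero nat
  | Neg test
  | Both test test

datatype procedure =
    Skip
  | Copy nat point
  | Intersect nat curve curve point point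
  | Incr nat
  | Decr nat
  | Leap "6"
  | Unleap "6"
  | Seq procedure procedure
  | Cond test procedure procedure
  | While test procedure

text \<open>A state \<open>(\<delta>, r, k)\<close> consists of the product \<open>\<delta>\<close> of the moves made so far, so that
  the current configuration is \<open>\<delta> d\<close> when the procedure was started on \<open>d\<close>, together with the
  auxiliary points and the counters.\<close>

type_synonym state = "(config \<Rightarrow> config) \<times> (nat \<Rightarrow> h2) \<times> (nat \<Rightarrow> nat)"

fun pt :: "config \<Rightarrow> state \<Rightarrow> point \<Rightarrow> h2" where
  "pt d (\<delta>, r, k) (Vertex i) = \<delta> d $ i"
| "pt d (\<delta>, r, k) (Aux n) = r n"

fun curve_pts :: "config \<Rightarrow> state \<Rightarrow> curve \<Rightarrow> h2 set" where
  "curve_pts d s (Line a b) = hline (pt d s a) (pt d s b)"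
| "curve_pts d s (Circle a b c) = hcircle (pt d s a) (hdist (pt d s b) (pt d s c))"

fun holds :: "config \<Rightarrow> state \<Rightarrow> test \<Rightarrow> bool" where
  "holds d s (Same a b) \<longleftrightarrow> pt d s a = pt d s b"
| "holds d s (Closer a b a' b') \<longleftrightarrow> hdist (pt d s a) (pt d s b) < hdist (pt d s a') (pt d s b')"
| "holds d s (LeftOf a b c) \<longleftrightarrow> 0 < orient (pt d s a) (pt d s b) (pt d s c)"
| "holds d s (Meet C D) \<longleftrightarrow> curve_pts d s C \<inter> curve_pts d s D \<noteq> {}"
| "holds d (\<delta>, r, k) (IsZero n) \<longleftrightarrow> k n = 0"
| "holds d s (Neg t) \<longleftrightarrow> \<not> holds d s t"
| "holds d s (Both t u) \<longleftrightarrow> holds d s t \<and> holds d s u"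

text \<open>\<open>Intersect n C D a b\<close> constructs the intersection point of \<open>C\<close> and \<open>D\<close> that is not to the
  right of the line from \<open>a\<close> to \<open>b\<close>; it gets stuck unless there is exactly one.  For \<open>a = b\<close> there is
  no condition besides lying on both curves.\<close>

inductive run :: "config \<Rightarrow> procedure \<Rightarrow> state \<Rightarrow> state \<Rightarrow> bool" for d where
  Skip: "run d Skip s s"
| Copy: "run d (Copy n a) (\<delta>, r, k) (\<delta>, r(n := pt d (\<delta>, r, k) a), k)"
| Intersect:
    "{w \<in> curve_pts d (\<delta>, r, k) C \<inter> curve_pts d (\<delta>, r, k) D.
        0 \<le> orient (pt d (\<delta>, r, k) a) (pt d (\<delta>, r, k) b) w} = {z} \<Longrightarrow>
     run d (Intersect n C D a b) (\<delta>, r, k) (\<delta>, r(n := z), k)"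
| Incr: "run d (Incr n) (\<delta>, r, k) (\<delta>, r, k(n := k n + 1))"
| Decr: "run d (Decr n) (\<delta>, r, k) (\<delta>, r, k(n := k n - 1))"
| Leap: "run d (Leap i) (\<delta>, r, k) (leapfrog_elt i \<otimes>\<^bsub>BijGroup Sex\<^esub> \<delta>, r, k)"
| Unleap: "run d (Unleap i) (\<delta>, r, k)
    (inv\<^bsub>BijGroup Sex\<^esub> (leapfrog_elt i) \<otimes>\<^bsub>BijGroup Sex\<^esub> \<delta>, r, k)"
| Seq: "run d P s t \<Longrightarrow> run d Q t u \<Longrightarrow> run d (Seq P Q) s u"
| CondTrue: "holds d s c \<Longrightarrow> run d P s t \<Longrightarrow> run d (Cond c P Q) s t"
| CondFalse: "\<not> holds d s c \<Longrightarrow> run d Q s t \<Longrightarrow> run d (Cond c P Q) s t"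
| WhileTrue: "holds d s c \<Longrightarrow> run d P s t \<Longrightarrow> run d (While c P) t u \<Longrightarrow> run d (While c P) s u"
| WhileFalse: "\<not> holds d s c \<Longrightarrow> run d (While c P) s s"

lemma run_deterministic: "run d P s t \<Longrightarrow> run d P s u \<Longrightarrow> u = t"
proof (induction arbitrary: u rule: run.induct)
  case (WhileTrue s c P t v)
  from WhileTrue.prems show ?case
    by (cases rule: run.cases) (use WhileTrue in blast)+
next
  case (Seq P s t Q v)
  from Seq.prems show ?case
    by (cases rule: run.cases) (use Seq in blast)+
qed (erule run.cases; force)+

text \<open>\<open>provides P x \<gamma>\<close>: the sequence \<open>\<gamma>\<close> is obtained by iterating \<open>P\<close> from the configuration \<open>x\<close>.
  Each iteration has to terminate, and it is applied to the six points \<open>\<gamma> n x\<close> only: the auxiliary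
  points and counters are reset, the former to the first vertex.\<close>

definition provides :: "procedure \<Rightarrow> config \<Rightarrow> (nat \<Rightarrow> config \<Rightarrow> config) \<Rightarrow> bool"
  where "provides P x \<gamma> \<longleftrightarrow>
    \<gamma> 0 = \<one>\<^bsub>BijGroup Sex\<^esub> \<and>
    (\<forall>n. \<exists>\<delta> r k.
      run (\<gamma> n x) P (\<one>\<^bsub>BijGroup Sex\<^esub>, (\<lambda>_. \<gamma> n x $ 1), (\<lambda>_. 0)) (\<delta>, r, k) \<and>
      \<gamma> (Suc n) = \<delta> \<otimes>\<^bsub>BijGroup Sex\<^esub> \<gamma> n)"

end

theory Submission
  imports Defs
begin

text \<open>Represent a point \<open>z\<close> by the matrix \<open>J z\<close> of its half turn, with determinant 1 and positive lower left entry.  Then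
\<open>- trace (J z ** J w) / 2\<close> is the hyperbolic cosine \<open>ch z w\<close> of the distance, and all distances and signed areas
become polynomials.  For a configuration the product \<open>J x6 ** \<dots> ** J x1\<close> is \<open>1\<close> or \<open>-1\<close>.  The sign is locally constant
and invariant under isometries and moves, and it is \<open>-1\<close> for singular configurations; so the classes in \<open>X0\<close> consist of
configurations with product \<open>-1\<close>, called \<open>negative\<close> (\<open>X0_negative\<close>).

Group the six points into the pairs 12, 34, 56.  Leapfrogging inside a pair slides it along its axis and does not change
the product of its two half turns; the moves 1 to 5 in a row rotate the indices.  Let \<open>perim\<close> be the sum of the three pair
distances and let A, B, C be their hyperbolic cosines.

If the pair distances satisfy the strict triangle inequalities, the three axes are the sides of a triangle with these
side lengths.  Slide the pairs close to its vertices and then rotate the indices: the new pairs cut off the corners, so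
\<open>perim\<close> decreases (\<open>rot_shortens_placed\<close>).  If one pair is too long, say \<open>C \<ge> A * B\<close>, a half turn of the second pair around
a point of the third shortens the third pair, and repeating this must end with a triangle (\<open>triangle_below\<close>); here the
distance between the two other axes controls all positions, so that minimisers exist.  By compactness modulo isometries,
every nonempty closed invariant set of negative configurations contains a configuration with \<open>x1 = x2\<close>, \<open>x3 = x4\<close>,
\<open>x5 = x6\<close> (\<open>closed_inv_set_collapses\<close>).

Apply this to the closure of the orbit of a non-pinched \<open>c\<close>.  The orbit comes close to such a collapsed configuration
but does not contain one.  Near it, the three pairs are tiny while their mutual distances stay bounded.  Sliding a tiny pair takes tiny
steps, hence it can be stopped in a prescribed window, where a half turn as above produces a triangle.  The triangle is
tiny, and pairs placed at its vertices have all consecutive distances tiny (\<open>collapse_in_closure_links\<close>).  So the orbit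
of \<open>c\<close> contains configurations with arbitrarily small consecutive distances (\<open>small_links\<close>).

The procedure searches through all words in the rotation of the indices and the first move, which reach every point of the
orbit (\<open>Mod_So_word\<close>).  It stops at the first word that more than halves the largest of the five consecutive distances.  This can be
tested by comparing lengths only, since a leapfrog move doubles a segment, so the word found depends only on
the isometry class.  Iterating it, the consecutive distances tend to 0 and the classes tend to the singular class.\<close>

section \<open>Points as half turn matrices\<close>

text \<open>The half turn around \<open>z\<close> as an element of \<open>SL(2,R)\<close>: the sign is fixed by the positive lower left entry.
   These matrices form one sheet of the hyperboloid of determinant 1 in the space of traceless matrices.\<close>

definition J :: "h2 \<Rightarrow> real^2^2"
  where "J z = half_turn_matrix (of_h2 z)"

text \<open>The hyperbolic cosine of the distance.\<close>

definition ch :: "h2 \<Rightarrow> h2 \<Rightarrow> real"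
  where "ch z w = 1 + (cmod (of_h2 z - of_h2 w))\<^sup>2 / (2 * Im (of_h2 z) * Im (of_h2 w))"

text \<open>The determinant of the three vectors in Minkowski space: up to sign \<open>sinh\<close> of the distance from \<open>y\<close> to
  \<open>z\<close> times \<open>sinh\<close> of the distance of \<open>x\<close> from the line through them.\<close>

definition vol :: "h2 \<Rightarrow> h2 \<Rightarrow> h2 \<Rightarrow> real"
  where "vol x y z = trace (J x ** J y ** J z) / 2"

lemma hdist_eq: "hdist z w = arcosh (ch z w)"
  by (simp add: hdist_def ch_def)

lemma trace2: "trace (A :: real^2^2) = A$1$1 + A$2$2"
  by (simp add: trace_def sum_2)

lemmas mat2 = vec_eq_iff forall_2 matrix_matrix_mult_def sum_2 mat_def trace2 det_2

text \<open>The adjugate, which is the inverse for determinant 1.\<close>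

definition adj2 :: "real^2^2 \<Rightarrow> real^2^2"
  where "adj2 M = vector [vector [M$2$2, - M$1$2], vector [- M$2$1, M$1$1]]"

text \<open>Conjugating the rotation around \<open>z\<close> by an isometry gives the rotation around the image.  The sign is
  right because both sides have positive lower left entry.\<close>

lemma half_turn_matrix_linfrac:
  assumes G: "det G = 1" and z: "0 < Im z"
  shows "half_turn_matrix (linfrac G z) = G ** half_turn_matrix z ** adj2 G"
proof -
  define a b c d where abcd: "a = G$1$1" "b = G$1$2" "c = G$2$1" "d = G$2$2"
  have D: "a * d - b * c = 1" using G by (simp add: abcd det_2)
  define x y where xy: "x = Re z" "y = Im z"
  have y: "0 < y" using z by (simp add: xy)
  define N where "N = (c * x + d)\<^sup>2 + (c * y)\<^sup>2"
  have "c \<noteq> 0 \<or> d \<noteq> 0" using D by auto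
  then have N: "0 < N" using y unfolding N_def by (cases "c = 0") (auto simp: add_nonneg_pos)
  have l: "linfrac G z = (complex_of_real a * z + complex_of_real b) / (complex_of_real c * z + complex_of_real d)"
    by (simp add: linfrac_def abcd)
  have im: "Im (linfrac G z) = y / N"
  proof -
    have "Im (linfrac G z) = ((a * d - b * c) * y) / N"
      unfolding l Im_divide N_def by (simp add: xy algebra_simps)
    then show ?thesis by (simp add: D)
  qed
  have re: "Re (linfrac G z) = ((a * x + b) * (c * x + d) + a * c * y\<^sup>2) / N"
    unfolding l Re_divide N_def by (simp add: xy power2_eq_square algebra_simps)
  have sq: "(Re (linfrac G z))\<^sup>2 + (Im (linfrac G z))\<^sup>2 = ((a * x + b)\<^sup>2 + (a * y)\<^sup>2) / N"
  proof -
    have "(cmod (linfrac G z))\<^sup>2 = ((a * x + b)\<^sup>2 + (a * y)\<^sup>2) / N"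
      unfolding l norm_divide power_divide cmod_power2 N_def by (simp add: xy)
    then show ?thesis by (simp add: cmod_power2)
  qed
  have e: "Re (linfrac G z) / Im (linfrac G z) = ((a * x + b) * (c * x + d) + a * c * y\<^sup>2) / y"
    "((Re (linfrac G z))\<^sup>2 + (Im (linfrac G z))\<^sup>2) / Im (linfrac G z) = ((a * x + b)\<^sup>2 + (a * y)\<^sup>2) / y"
    "1 / Im (linfrac G z) = N / y"
    using N y by (simp_all only: sq) (simp_all add: re im)
  show ?thesis
    unfolding half_turn_matrix_def e using y D
    apply (simp add: mat2 adj2_def abcd[symmetric] xy[symmetric] N_def)
    apply (simp add: divide_simps)
    apply (simp add: power2_eq_square algebra_simps)
    done
qed

abbreviation traceless :: "real \<Rightarrow> real \<Rightarrow> real \<Rightarrow> real^2^2"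
  where "traceless u v w \<equiv> vector [vector [u, - v], vector [w, - u]]"

lemma J_coords:
  obtains u v w where "J z = traceless u v w" "v * w = 1 + u\<^sup>2" "0 < w" "0 < v"
proof -
  have p: "0 < Im (of_h2 z)" by simp
  then have p': "Im (of_h2 z) \<noteq> 0" by linarith
  have q: "0 < (Re (of_h2 z))\<^sup>2 + (Im (of_h2 z))\<^sup>2"
    using p by (simp add: add_nonneg_pos zero_less_power del: Im_of_h2)
  show ?thesis
    by (rule that[of "Re (of_h2 z) / Im (of_h2 z)" "((Re (of_h2 z))\<^sup>2 + (Im (of_h2 z))\<^sup>2) / Im (of_h2 z)" "1 / Im (of_h2 z)"])
       (use p p' q in \<open>simp_all add: J_def half_turn_matrix_def divide_simps power2_eq_square\<close>)
qed

lemma trace_J [simp]: "trace (J z) = 0"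
  by (simp add: J_def half_turn_matrix_def trace2)

lemma det_J [simp]: "det (J z) = 1"
  by (simp add: J_def det_half_turn_matrix)

lemma J_sq [simp]: "J z ** J z = - mat 1"
  by (rule J_coords[of z]) (simp add: mat2 algebra_simps power2_eq_square)

lemma J_sq_left [simp]: "J z ** (J z ** M) = - M" for M :: "real^2^2"
  by (simp add: matrix_mul_assoc)

lemma adj2_J: "adj2 (J p) = - J p"
  by (simp add: adj2_def J_def half_turn_matrix_def mat2)

lemma ch_coords:
  assumes "J z = traceless u v w" "J z' = traceless u' v' w'"
  shows "ch z z' = (v * w' + w * v') / 2 - u * u'"
proof -
  define x y x' y' where "x = Re (of_h2 z)" and "y = Im (of_h2 z)" and "x' = Re (of_h2 z')" and "y' = Im (of_h2 z')"
  have y: "0 < y" "0 < y'" by (simp_all add: y_def y'_def)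
  have e1: "u = x / y" "v = (x\<^sup>2 + y\<^sup>2) / y" "w = 1 / y" "u' = x' / y'" "v' = (x'\<^sup>2 + y'\<^sup>2) / y'" "w' = 1 / y'"
    using assms by (simp_all add: J_def half_turn_matrix_def mat2 x_def y_def x'_def y'_def)
  have e2: "ch z z' = 1 + ((x - x')\<^sup>2 + (y - y')\<^sup>2) / (2 * y * y')"
    by (simp add: ch_def cmod_power2 x_def y_def x'_def y'_def)
  show ?thesis
    unfolding e1 e2 using y by (simp add: field_simps power2_eq_square)
qed

lemma ch_trace: "ch z w = - trace (J z ** J w) / 2"
proof -
  obtain u v w' where 1: "J z = traceless u v w'" by (rule J_coords[of z])
  obtain u' v' w'' where 2: "J w = traceless u' v' w''" by (rule J_coords[of w])
  show ?thesis unfolding ch_coords[OF 1 2] unfolding 1 2 by (simp add: mat2 field_simps)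
qed

lemma ch_sym: "ch z w = ch w z"
  unfolding ch_trace by (subst trace_mul_sym) simp

lemma ch_refl [simp]: "ch z z = 1"
  by (simp add: ch_def)

lemma ch_ge_1: "1 \<le> ch z w"
proof -
  have "0 < 2 * Im (of_h2 z) * Im (of_h2 w)" by simp
  then show ?thesis unfolding ch_def by (simp add: divide_nonneg_pos)
qed

lemma ch_eq_1 [simp]: "ch z w = 1 \<longleftrightarrow> z = w"
  using Im_of_h2[of z] Im_of_h2[of w] by (auto simp: ch_def of_h2_inject simp del: Im_of_h2)

lemma J_half_turn: "J (half_turn a \<bullet>\<^sub>H b) = - (J a ** J b ** J a)"
proof -
  have "J (half_turn a \<bullet>\<^sub>H b) = J a ** J b ** adj2 (J a)"
    unfolding J_def by transfer (simp add: half_turn_matrix_linfrac det_half_turn_matrix)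
  then show ?thesis by (simp add: adj2_J)
qed

text \<open>A half turn is a point reflection in Minkowski space.  This makes iterated leapfrogging a linear
  recurrence.\<close>

lemma J_half_turn_linear: "J (half_turn a \<bullet>\<^sub>H b) = (2 * ch a b) *\<^sub>R J a - J b"
proof -
  obtain u v w' where 1: "J a = traceless u v w'" "v * w' = 1 + u\<^sup>2" by (rule J_coords[of a])
  obtain u' v' w'' where 2: "J b = traceless u' v' w''" by (rule J_coords[of b])
  have "- (J a ** J b ** J a) = (2 * ch a b) *\<^sub>R J a + (J a ** J a) ** J b"
    unfolding ch_coords[OF 1(1) 2(1)] unfolding 1 2 by (simp add: mat2 field_simps)
  then show ?thesis by (simp add: J_half_turn)
qed

lemma J_inject: "J z = J w \<longleftrightarrow> z = w"
proof
  assume "J z = J w"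
  then have "Im (of_h2 z) = Im (of_h2 w)" "Re (of_h2 z) / Im (of_h2 z) = Re (of_h2 w) / Im (of_h2 w)"
    by (auto simp: J_def half_turn_matrix_def mat2)
  moreover have "Im (of_h2 w) \<noteq> 0" using Im_of_h2[of w] by linarith
  ultimately have "of_h2 z = of_h2 w" by (auto simp: complex_eq_iff)
  then show "z = w" by (simp add: of_h2_inject)
qed simp

lemma J_surj:
  assumes "trace M = 0" "det M = 1" "0 < M$2$1"
  obtains z where "J z = M"
proof -
  define z where "z = Complex (M$1$1 / M$2$1) (1 / M$2$1)"
  have e1: "M$2$2 = - M$1$1"
    using assms(1) by (simp add: mat2)
  have e: "M$2$2 = - M$1$1" "M$1$2 * M$2$1 = - (1 + (M$1$1)\<^sup>2)"
    using assms(2) by (simp_all add: e1 mat2 power2_eq_square algebra_simps)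
  have e2: "M$1$2 = - (1 + (M$1$1)\<^sup>2) / M$2$1"
    using e(2) assms(3) by (simp add: field_simps)
  have "of_h2 (Abs_h2 z) = z"
    using assms(3) by (intro Abs_h2_inverse) (simp add: z_def)
  then have "J (Abs_h2 z) = M"
    using assms(3) e(1) unfolding J_def by (simp add: z_def half_turn_matrix_def mat2 e2 field_simps power2_eq_square)
  then show ?thesis using that by blast
qed

lemma J_surj_pm:
  assumes "trace M = 0" "det M = 1"
  obtains z where "J z = M \<or> J z = - M"
proof -
  have "M$2$1 \<noteq> 0"
  proof
    assume "M$2$1 = 0"
    moreover have "M$2$2 = - M$1$1"
      using assms(1) by (simp add: mat2)
    ultimately have "- (M$1$1 * M$1$1) = 1" using assms(2) by (simp add: mat2)
    then show False by (smt (verit) zero_le_square)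
  qed
  then consider "0 < M$2$1" | "0 < (- M)$2$1" by fastforce
  then show ?thesis
  proof cases
    case 1 then show ?thesis using J_surj assms that by metis
  next
    case 2
    have "trace (- M) = 0" "det (- M) = 1" using assms by (simp_all add: mat2)
    then obtain z where "J z = - M" using 2 J_surj by metis
    then show ?thesis using that by blast
  qed
qed

text \<open>The sign condition says that \<open>M\<close> lies on the same sheet of the hyperboloid as \<open>J p\<close>.\<close>

lemma J_surj_ch:
  assumes "trace M = 0" "det M = 1" "trace (J p ** M) < 0"
  obtains z where "J z = M"
proof -
  obtain z where z: "J z = M \<or> J z = - M" using J_surj_pm[OF assms(1,2)] .
  moreover have "J z \<noteq> - M"
  proof
    assume "J z = - M"
    then have "M = - J z" by simp
    then have "trace (J p ** M) = 2 * ch p z" by (simp add: ch_trace trace2)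
    then show False using assms(3) ch_ge_1[of p z] by linarith
  qed
  ultimately show ?thesis using that by blast
qed

lemma J_act:
  obtains G H where "G ** H = mat 1" "H ** G = mat 1" "\<And>z. J (g \<bullet>\<^sub>H z) = G ** J z ** H"
proof -
  have "\<exists>G. det G = 1 \<and> (\<forall>z. J (g \<bullet>\<^sub>H z) = G ** J z ** adj2 G)"
    unfolding J_def by transfer (auto simp: psl_rel_def half_turn_matrix_linfrac)
  then obtain G where G: "det G = 1" "\<And>z. J (g \<bullet>\<^sub>H z) = G ** J z ** adj2 G" by blast
  have "G ** adj2 G = mat 1" "adj2 G ** G = mat 1" using G(1) by (simp_all add: adj2_def mat2 algebra_simps)
  then show ?thesis using G(2) that by blast
qed

lemma trace_conj: "H ** G = mat 1 \<Longrightarrow> trace (G ** M ** H) = trace M" for G H M :: "real^2^2"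
  by (metis matrix_mul_assoc matrix_mul_lid trace_mul_sym)

lemma conj_mult:
  fixes G H M N :: "real^2^2"
  assumes "H ** G = mat 1"
  shows "(G ** M ** H) ** (G ** N ** H) = G ** (M ** N) ** H"
proof -
  have "(G ** M ** H) ** (G ** N ** H) = G ** M ** (H ** G) ** N ** H"
    by (simp add: matrix_mul_assoc)
  then show ?thesis by (simp add: assms matrix_mul_assoc)
qed

lemma ch_act [simp]: "ch (g \<bullet>\<^sub>H z) (g \<bullet>\<^sub>H w) = ch z w"
proof -
  obtain G H where "G ** H = mat 1" "H ** G = mat 1" "\<And>z. J (g \<bullet>\<^sub>H z) = G ** J z ** H" by (rule J_act) blast
  then show ?thesis by (simp add: ch_trace conj_mult trace_conj)
qed

lemma vol_act [simp]: "vol (g \<bullet>\<^sub>H x) (g \<bullet>\<^sub>H y) (g \<bullet>\<^sub>H z) = vol x y z"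
proof -
  obtain G H where "G ** H = mat 1" "H ** G = mat 1" "\<And>z. J (g \<bullet>\<^sub>H z) = G ** J z ** H" by (rule J_act) blast
  then show ?thesis by (simp add: vol_def conj_mult trace_conj)
qed

lemma act_half_turn: "half_turn (g \<bullet>\<^sub>H a) \<bullet>\<^sub>H (g \<bullet>\<^sub>H b) = g \<bullet>\<^sub>H (half_turn a \<bullet>\<^sub>H b)"
proof -
  obtain G H where "G ** H = mat 1" "H ** G = mat 1" "\<And>z. J (g \<bullet>\<^sub>H z) = G ** J z ** H" by (rule J_act) blast
  then have "J (half_turn (g \<bullet>\<^sub>H a) \<bullet>\<^sub>H (g \<bullet>\<^sub>H b)) = J (g \<bullet>\<^sub>H (half_turn a \<bullet>\<^sub>H b))"
    by (simp add: J_half_turn conj_mult)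
  then show ?thesis by (simp add: J_inject)
qed

section \<open>Gram determinants\<close>

lemma vol_coords:
  assumes "J z1 = traceless u1 v1 w1" "J z2 = traceless u2 v2 w2"
    "J z3 = traceless u3 v3 w3"
  shows "vol z1 z2 z3 = (u1 * (w2 * v3 - v2 * w3) + u2 * (v1 * w3 - w1 * v3) + u3 * (w1 * v2 - v1 * w2)) / 2"
  unfolding vol_def assms by (simp add: mat2 field_simps)

lemma vol_swap: "vol x z y = - vol x y z" "vol y x z = - vol x y z"
proof -
  obtain u1 v1 w1 where 1: "J x = traceless u1 v1 w1" by (rule J_coords[of x])
  obtain u2 v2 w2 where 2: "J y = traceless u2 v2 w2" by (rule J_coords[of y])
  obtain u3 v3 w3 where 3: "J z = traceless u3 v3 w3" by (rule J_coords[of z])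
  show "vol x z y = - vol x y z" "vol y x z = - vol x y z"
    unfolding vol_coords[OF 1 2 3] vol_coords[OF 1 3 2] vol_coords[OF 2 1 3] by (simp_all add: field_simps)
qed

lemma vol_degen [simp]: "vol x x y = 0" "vol x y x = 0" "vol x y y = 0"
  using vol_swap(2)[of x x y] vol_swap(1)[of x y y] vol_swap[of x x y] by simp_all

text \<open>The Gram determinant of three vectors for the form \<open>v * w - u * u\<close>, as a polynomial identity without
  normalisation of the vectors.\<close>

lemma gram_real:
  fixes u1 :: real
  shows "((u1 * (w2 * v3 - v2 * w3) + u2 * (v1 * w3 - w1 * v3) + u3 * (w1 * v2 - v1 * w2)) / 2)\<^sup>2 =
     (v1 * w1 - u1\<^sup>2) * (v2 * w2 - u2\<^sup>2) * (v3 * w3 - u3\<^sup>2)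
     + 2 * ((v1 * w2 + w1 * v2) / 2 - u1 * u2) * ((v2 * w3 + w2 * v3) / 2 - u2 * u3) * ((v1 * w3 + w1 * v3) / 2 - u1 * u3)
     - (v3 * w3 - u3\<^sup>2) * ((v1 * w2 + w1 * v2) / 2 - u1 * u2)\<^sup>2
     - (v1 * w1 - u1\<^sup>2) * ((v2 * w3 + w2 * v3) / 2 - u2 * u3)\<^sup>2
     - (v2 * w2 - u2\<^sup>2) * ((v1 * w3 + w1 * v3) / 2 - u1 * u3)\<^sup>2"
  by (simp add: power2_eq_square field_simps)

lemma vol_gram: "(vol x y z)\<^sup>2 = 1 + 2 * ch x y * ch y z * ch x z - (ch x y)\<^sup>2 - (ch y z)\<^sup>2 - (ch x z)\<^sup>2"
proof -
  obtain u1 v1 w1 where 1: "J x = traceless u1 v1 w1" "v1 * w1 = 1 + u1\<^sup>2" by (rule J_coords[of x])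
  obtain u2 v2 w2 where 2: "J y = traceless u2 v2 w2" "v2 * w2 = 1 + u2\<^sup>2" by (rule J_coords[of y])
  obtain u3 v3 w3 where 3: "J z = traceless u3 v3 w3" "v3 * w3 = 1 + u3\<^sup>2" by (rule J_coords[of z])
  define n1 n2 n3 where n: "n1 = v1 * w1 - u1\<^sup>2" "n2 = v2 * w2 - u2\<^sup>2" "n3 = v3 * w3 - u3\<^sup>2"
  have n': "n1 = 1" "n2 = 1" "n3 = 1" using 1(2) 2(2) 3(2) by (simp_all add: n)
  have "(vol x y z)\<^sup>2 = n1 * n2 * n3 + 2 * ch x y * ch y z * ch x z - n3 * (ch x y)\<^sup>2 - n1 * (ch y z)\<^sup>2 - n2 * (ch x z)\<^sup>2"
    unfolding vol_coords[OF 1(1) 2(1) 3(1)] ch_coords[OF 1(1) 2(1)] ch_coords[OF 2(1) 3(1)] ch_coords[OF 1(1) 3(1)] n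
    by (rule gram_real)
  then show ?thesis by (simp add: n')
qed

lemma trace4:
  "trace (J a ** J b ** J p ** J q) = 2 * (ch a b * ch p q - ch a p * ch b q + ch a q * ch b p)"
proof -
  obtain u1 v1 w1 where 1: "J a = traceless u1 v1 w1" by (rule J_coords[of a])
  obtain u2 v2 w2 where 2: "J b = traceless u2 v2 w2" by (rule J_coords[of b])
  obtain u3 v3 w3 where 3: "J p = traceless u3 v3 w3" by (rule J_coords[of p])
  obtain u4 v4 w4 where 4: "J q = traceless u4 v4 w4" by (rule J_coords[of q])
  show ?thesis
    unfolding ch_coords[OF 1 2] ch_coords[OF 3 4] ch_coords[OF 1 3] ch_coords[OF 2 4] ch_coords[OF 1 4] ch_coords[OF 2 3]
    unfolding 1 2 3 4 by (simp add: mat2 field_simps)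
qed

text \<open>The Gram determinant of the normal vector of the line \<open>ab\<close> with \<open>p\<close> and \<open>q\<close>.  The normal vector is not
  normalised and not timelike, so \<open>gram_real\<close> is used for arbitrary norms.\<close>

lemma gram4:
  "((ch a b)\<^sup>2 - 1) * ((ch p q)\<^sup>2 - 1) - (ch a p * ch b q - ch a q * ch b p)\<^sup>2 =
   (vol p a b)\<^sup>2 + (vol q a b)\<^sup>2 - 2 * ch p q * vol p a b * vol q a b"
proof -
  obtain u2 v2 w2 where 2: "J a = traceless u2 v2 w2" "v2 * w2 = 1 + u2\<^sup>2" by (rule J_coords[of a])
  obtain u3 v3 w3 where 3: "J b = traceless u3 v3 w3" "v3 * w3 = 1 + u3\<^sup>2" by (rule J_coords[of b])
  obtain u4 v4 w4 where 4: "J p = traceless u4 v4 w4" "v4 * w4 = 1 + u4\<^sup>2" by (rule J_coords[of p])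
  obtain u5 v5 w5 where 5: "J q = traceless u5 v5 w5" "v5 * w5 = 1 + u5\<^sup>2" by (rule J_coords[of q])
  define u1 v1 w1 where 1: "u1 = (v2 * w3 - w2 * v3) / 2" "v1 = u3 * v2 - u2 * v3" "w1 = u2 * w3 - u3 * w2"
  have fp: "vol p a b = (v1 * w4 + w1 * v4) / 2 - u1 * u4" and fq: "vol q a b = (v1 * w5 + w1 * v5) / 2 - u1 * u5"
    unfolding vol_coords[OF 4(1) 2(1) 3(1)] vol_coords[OF 5(1) 2(1) 3(1)] 1 by (simp_all add: field_simps)
  have "v1 * w1 - u1\<^sup>2 = (v2 * w2 - u2\<^sup>2) * (v3 * w3 - u3\<^sup>2) - (ch a b)\<^sup>2"
    unfolding ch_coords[OF 2(1) 3(1)] 1 by (simp add: power2_eq_square field_simps)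
  then have xi: "v1 * w1 - u1\<^sup>2 = 1 - (ch a b)\<^sup>2" by (simp add: 2 3)
  have E: "(u1 * (w4 * v5 - v4 * w5) + u4 * (v1 * w5 - w1 * v5) + u5 * (w1 * v4 - v1 * w4)) / 2
     = ch a p * ch b q - ch a q * ch b p"
    unfolding ch_coords[OF 2(1) 4(1)] ch_coords[OF 3(1) 5(1)] ch_coords[OF 2(1) 5(1)] ch_coords[OF 3(1) 4(1)] 1
    by (simp add: field_simps)
  have "((u1 * (w4 * v5 - v4 * w5) + u4 * (v1 * w5 - w1 * v5) + u5 * (w1 * v4 - v1 * w4)) / 2)\<^sup>2 =
     (v1 * w1 - u1\<^sup>2) * (v4 * w4 - u4\<^sup>2) * (v5 * w5 - u5\<^sup>2)
     + 2 * ((v1 * w4 + w1 * v4) / 2 - u1 * u4) * ((v1 * w5 + w1 * v5) / 2 - u1 * u5) * ((v4 * w5 + w4 * v5) / 2 - u4 * u5)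
     - (v5 * w5 - u5\<^sup>2) * ((v1 * w4 + w1 * v4) / 2 - u1 * u4)\<^sup>2
     - (v1 * w1 - u1\<^sup>2) * ((v4 * w5 + w4 * v5) / 2 - u4 * u5)\<^sup>2
     - (v4 * w4 - u4\<^sup>2) * ((v1 * w5 + w1 * v5) / 2 - u1 * u5)\<^sup>2"
    using gram_real[of u1 w4 v5 v4 w5 u4 v1 w1 u5] by (simp only: mult.assoc mult.commute mult.left_commute)
  from this[unfolded E xi fp[symmetric] fq[symmetric] ch_coords[OF 4(1) 5(1), symmetric]] have "(ch a p * ch b q - ch a q * ch b p)\<^sup>2 = (1 - (ch a b)\<^sup>2) + 2 * vol p a b * vol q a b * ch p q
     - (vol p a b)\<^sup>2 - (1 - (ch a b)\<^sup>2) * (ch p q)\<^sup>2 - (vol q a b)\<^sup>2"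
    using 4(2) 5(2) by simp
  then show ?thesis by (simp add: algebra_simps)
qed

text \<open>Cramer's rule for expanding the fourth vector in the second, the third and their cross product.\<close>

lemma span_real:
  fixes u2 v2 w2 u3 v3 w3 u4 v4 w4 :: real
  defines "A \<equiv> v2 * w3 + w2 * v3 - 2 * u2 * u3" and "X \<equiv> v4 * w2 + w4 * v2 - 2 * u4 * u2"
    and "Y \<equiv> v4 * w3 + w4 * v3 - 2 * u4 * u3"
    and "V \<equiv> u4 * (w2 * v3 - v2 * w3) + u2 * (v4 * w3 - w4 * v3) + u3 * (w4 * v2 - v4 * w2)"
    and "n2 \<equiv> v2 * w2 - u2 * u2" and "n3 \<equiv> v3 * w3 - u3 * u3"
  shows "(4 * n2 * n3 - A * A) * u4 = (2 * n3 * X - A * Y) * u2 + (2 * n2 * Y - A * X) * u3 + V * (v2 * w3 - w2 * v3)"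
   "(4 * n2 * n3 - A * A) * v4 = (2 * n3 * X - A * Y) * v2 + (2 * n2 * Y - A * X) * v3 + 2 * V * (u3 * v2 - u2 * v3)"
   "(4 * n2 * n3 - A * A) * w4 = (2 * n3 * X - A * Y) * w2 + (2 * n2 * Y - A * X) * w3 + 2 * V * (u2 * w3 - u3 * w2)"
  unfolding assms by algebra+

text \<open>A vanishing determinant removes the cross product term of \<open>span_real\<close>.\<close>

lemma coplanar_span:
  assumes "a \<noteq> b" "vol x a b = 0"
  obtains l m where "J x = l *\<^sub>R J a + m *\<^sub>R J b"
proof -
  obtain u2 v2 w2 where 2: "J a = traceless u2 v2 w2" "v2 * w2 = 1 + u2\<^sup>2" by (rule J_coords[of a])
  obtain u3 v3 w3 where 3: "J b = traceless u3 v3 w3" "v3 * w3 = 1 + u3\<^sup>2" by (rule J_coords[of b])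
  obtain u4 v4 w4 where 4: "J x = traceless u4 v4 w4" "v4 * w4 = 1 + u4\<^sup>2" by (rule J_coords[of x])
  define A X Y where A: "A = ch a b" and X: "X = ch x a" and Y: "Y = ch x b"
  have nz: "1 - A\<^sup>2 \<noteq> 0"
    using ch_ge_1[of a b] assms(1) unfolding A by (smt (verit) ch_eq_1 one_power2 power2_eq_iff)
  have V: "(u4 * (w2 * v3 - v2 * w3) + u2 * (v4 * w3 - w4 * v3) + u3 * (w4 * v2 - v4 * w2)) = 0"
    using assms(2) unfolding vol_coords[OF 4(1) 2(1) 3(1)] by simp
  have n: "v2 * w2 - u2\<^sup>2 = 1" "v3 * w3 - u3\<^sup>2 = 1" using 2 3 by simp_all
  note cs = ch_coords[OF 2(1) 3(1)] ch_coords[OF 4(1) 2(1)] ch_coords[OF 4(1) 3(1)]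
  have n': "v2 * w2 - u2 * u2 = 1" "v3 * w3 - u3 * u3 = 1" using n by (simp_all add: power2_eq_square)
  have c2: "v2 * w3 + w2 * v3 - 2 * u2 * u3 = 2 * A" "v4 * w2 + w4 * v2 - 2 * u4 * u2 = 2 * X" "v4 * w3 + w4 * v3 - 2 * u4 * u3 = 2 * Y"
    unfolding A X Y cs by simp_all
  have u: "(1 - A\<^sup>2) * u4 = (X - A * Y) * u2 + (Y - A * X) * u3"
    and v: "(1 - A\<^sup>2) * v4 = (X - A * Y) * v2 + (Y - A * X) * v3"
    and w: "(1 - A\<^sup>2) * w4 = (X - A * Y) * w2 + (Y - A * X) * w3"
    using span_real[where ?u2.0 = u2 and ?v2.0 = v2 and ?w2.0 = w2 and ?u3.0 = u3 and ?v3.0 = v3 and ?w3.0 = w3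
        and ?u4.0 = u4 and ?v4.0 = v4 and ?w4.0 = w4, unfolded c2 V n']
    by algebra+
  define l m where lm: "l = (X - A * Y) / (1 - A\<^sup>2)" "m = (Y - A * X) / (1 - A\<^sup>2)"
  have "u4 = l * u2 + m * u3" "v4 = l * v2 + m * v3" "w4 = l * w2 + m * w3"
    unfolding lm using nz u v w by (simp_all add: divide_simps mult.commute)
  then have "J x = l *\<^sub>R J a + m *\<^sub>R J b"
    unfolding 2 3 4 by (simp add: mat2)
  then show ?thesis using that by blast
qed

lemma ch_le_mult: "ch x z \<le> 2 * ch x y * ch y z"
proof -
  let ?X = "ch x y" and ?Y = "ch y z" and ?Z = "ch x z"
  have "(?Z - ?X * ?Y)\<^sup>2 = (?X\<^sup>2 - 1) * (?Y\<^sup>2 - 1) - (vol x y z)\<^sup>2"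
    unfolding vol_gram by (simp add: power2_eq_square algebra_simps)
  also have "\<dots> \<le> (?X\<^sup>2 - 1) * (?Y\<^sup>2 - 1)" by simp
  also have "\<dots> \<le> (?X * ?Y)\<^sup>2"
    using ch_ge_1[of x y] ch_ge_1[of y z] by (simp add: power_mult_distrib mult_mono')
  finally have "?Z - ?X * ?Y \<le> ?X * ?Y"
    by (rule power2_le_imp_le) (use ch_ge_1[of x y] ch_ge_1[of y z] in simp)
  then show ?thesis by simp
qed

section \<open>The hyperbolic metric\<close>

lemma cosh_hdist [simp]: "cosh (hdist x y) = ch x y"
  by (simp add: hdist_eq cosh_arcosh_real ch_ge_1)

lemma hdist_nonneg [simp]: "0 \<le> hdist x y"
  by (simp add: hdist_eq ch_ge_1 arcosh_nonneg_real)

lemma hdist_sym: "hdist x y = hdist y x"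
  by (simp add: hdist_eq ch_sym)

text \<open>The triangle inequality with its defect: \<open>vol\<close> measures how far the three points are from being
  collinear.\<close>

lemma ch_defect: "(ch x z - ch x y * ch y z)\<^sup>2 = (sinh (hdist x y) * sinh (hdist y z))\<^sup>2 - (vol x y z)\<^sup>2"
proof -
  have s: "(sinh (hdist x y))\<^sup>2 = (ch x y)\<^sup>2 - 1" for x y
    using sinh_square_eq[of "hdist x y"] by simp
  show ?thesis unfolding power_mult_distrib s vol_gram by (simp add: power2_eq_square algebra_simps)
qed

lemma hdist_triangle: "hdist x z \<le> hdist x y + hdist y z"
proof -
  have "(ch x z - ch x y * ch y z)\<^sup>2 \<le> (sinh (hdist x y) * sinh (hdist y z))\<^sup>2"
    unfolding ch_defect by simp
  then have "ch x z - ch x y * ch y z \<le> sinh (hdist x y) * sinh (hdist y z)"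
    by (rule power2_le_imp_le) simp
  then have "cosh (hdist x z) \<le> cosh (hdist x y + hdist y z)"
    by (simp add: cosh_add)
  then show ?thesis
    by (subst (asm) cosh_real_nonneg_le_iff) auto
qed

lemma hdist_triangle_strict: "vol x y z \<noteq> 0 \<Longrightarrow> hdist x z < hdist x y + hdist y z"
proof -
  assume "vol x y z \<noteq> 0"
  then have "(ch x z - ch x y * ch y z)\<^sup>2 < (sinh (hdist x y) * sinh (hdist y z))\<^sup>2"
    unfolding ch_defect by simp
  then have "ch x z - ch x y * ch y z < sinh (hdist x y) * sinh (hdist y z)"
    by (rule power2_less_imp_less) simp
  then have "cosh (hdist x z) < cosh (hdist x y + hdist y z)"
    by (simp add: cosh_add)
  then show ?thesis
    by (subst (asm) cosh_real_nonneg_less_iff) auto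
qed

lemma adj2_mult: "adj2 (M ** N) = adj2 N ** adj2 M"
  by (simp add: adj2_def mat2)

lemma trace_adj2: "trace (M ** N) + trace (adj2 M ** N) = trace M * trace N"
  by (simp add: adj2_def mat2 algebra_simps)

text \<open>The trace identity behind \<open>flip_third_ch\<close>: \<open>J p ** B ** J p\<close> is what a half turn around \<open>p\<close> makes of
  \<open>B\<close>, up to sign.\<close>

lemma trace_JBJA: "trace (J p ** B ** J p ** A) = trace (J p ** B) * trace (J p ** A) - trace A * trace B + trace (B ** A)"
proof -
  have "adj2 (J p ** B) ** (J p ** A) = adj2 B ** A"
    by (simp add: adj2_mult adj2_J flip: matrix_mul_assoc)
  then have "trace (J p ** B ** (J p ** A)) + trace (adj2 B ** A) = trace (J p ** B) * trace (J p ** A)"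
    using trace_adj2[of "J p ** B" "J p ** A"] by simp
  with trace_adj2[of B A] show ?thesis by (simp add: matrix_mul_assoc algebra_simps)
qed

section \<open>Hyperbolic cosine sequences and triangle inequalities\<close>

text \<open>A solution of the recurrence \<open>u (n + 1) = 2 * cosh a * u n - u (n - 1)\<close> has the invariant \<open>I\<close>.  For \<open>I >
  0\<close> and a positive start it is a shifted hyperbolic cosine.\<close>

lemma cosh_representation:
  fixes u0 u1 a :: real
  assumes a: "0 < a" and u: "0 < u0" and I: "I = 2 * cosh a * u0 * u1 - u0\<^sup>2 - u1\<^sup>2" "0 < I"
  obtains k s where "0 < k" "u0 = k * cosh (a * s)" "u1 = k * cosh (a * (s + 1))" "k\<^sup>2 * ((cosh a)\<^sup>2 - 1) = I"
proof -
  define S where "S = sinh a"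
  have S: "0 < S" using a by (simp add: S_def)
  have S2: "S\<^sup>2 = (cosh a)\<^sup>2 - 1" by (simp add: S_def sinh_square_eq)
  define k where "k = sqrt I / S"
  have k: "0 < k" "k\<^sup>2 * S\<^sup>2 = I" using S I by (simp_all add: k_def power_divide)
  define t where "t = (u1 - cosh a * u0) / (k * S)"
  define s where "s = arsinh t / a"
  have as: "a * s = arsinh t" using a by (simp add: s_def)
  have sh: "sinh (a * s) = t" by (simp add: as)
  have "(k * cosh (a * s))\<^sup>2 = k\<^sup>2 + (k * t)\<^sup>2"
    using cosh_square_eq[of "a * s"] by (simp add: power_mult_distrib sh algebra_simps)
  also have "k * t = (u1 - cosh a * u0) / S" using k(1) S by (simp add: t_def)
  also have "k\<^sup>2 = I / S\<^sup>2" using k(2) S by (simp add: field_simps)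
  also have "I / S\<^sup>2 + ((u1 - cosh a * u0) / S)\<^sup>2 = (I + (u1 - cosh a * u0)\<^sup>2) / S\<^sup>2"
    using S by (simp add: power_divide add_divide_distrib)
  also have "I + (u1 - cosh a * u0)\<^sup>2 = S\<^sup>2 * u0\<^sup>2" unfolding S2 I(1) by (simp add: power2_eq_square algebra_simps)
  finally have "(k * cosh (a * s))\<^sup>2 = u0\<^sup>2" using S by simp
  then have u0: "u0 = k * cosh (a * s)"
    using u k(1) by (metis cosh_real_nonneg less_imp_le mult_nonneg_nonneg power2_eq_imp_eq)
  have "k * cosh (a * (s + 1)) = cosh a * (k * cosh (a * s)) + S * (k * t)"
    by (simp add: distrib_left cosh_add sh S_def algebra_simps)
  also have "\<dots> = u1" using k(1) S unfolding u0[symmetric] t_def by simp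
  finally show ?thesis using that[of k s] k u0 S2 by simp
qed

lemma cosh_half_sq: "(cosh (a / 2))\<^sup>2 = (cosh a + 1) / 2" for a :: real
  using cosh_double_cosh[of "a / 2"] by simp

text \<open>Some value of a \<open>cosh\<close> sequence with step \<open>a\<close> is taken within \<open>a / 2\<close> of the minimum; this bounds that
  value by the invariant.\<close>

lemma cosh_le_half:
  fixes a s k :: real
  assumes "0 < a" "\<bar>s\<bar> \<le> 1 / 2" "k\<^sup>2 * ((cosh a)\<^sup>2 - 1) = I"
  shows "(k * cosh (a * s))\<^sup>2 * (2 * (cosh a - 1)) \<le> I"
proof -
  have "\<bar>a * s\<bar> \<le> a / 2" using assms by (simp add: abs_mult)
  then have "cosh \<bar>a * s\<bar> \<le> cosh (a / 2)" by (subst cosh_real_nonneg_le_iff) (use assms in auto)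
  then have c: "cosh (a * s) \<le> cosh (a / 2)" by simp
  have "(cosh (a * s))\<^sup>2 \<le> (cosh a + 1) / 2"
    unfolding cosh_half_sq[symmetric] using c by (rule power_mono) simp
  moreover have "1 \<le> cosh a" by (rule cosh_real_ge_1)
  ultimately have "(cosh (a * s))\<^sup>2 * (2 * (cosh a - 1)) \<le> (cosh a + 1) / 2 * (2 * (cosh a - 1))"
    by (intro mult_right_mono) auto
  also have "\<dots> = (cosh a)\<^sup>2 - 1" by (simp add: power2_eq_square field_simps)
  finally have "(cosh (a * s))\<^sup>2 * (2 * (cosh a - 1)) \<le> (cosh a)\<^sup>2 - 1" .
  then have "k\<^sup>2 * ((cosh (a * s))\<^sup>2 * (2 * (cosh a - 1))) \<le> k\<^sup>2 * ((cosh a)\<^sup>2 - 1)"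
    by (rule mult_left_mono) simp
  then show ?thesis using assms(3) by (simp add: power_mult_distrib mult.assoc)
qed

text \<open>Minus the Gram determinant.  For \<open>A\<close>, \<open>B\<close>, \<open>C\<close> the hyperbolic cosines of three lengths it is negative if
  and only if the lengths satisfy the strict triangle inequalities.\<close>

definition disc :: "real \<Rightarrow> real \<Rightarrow> real \<Rightarrow> real"
  where "disc A B C = A\<^sup>2 + B\<^sup>2 + C\<^sup>2 - 2 * A * B * C - 1"

lemma disc_alt: "disc A B C = (C - A * B)\<^sup>2 - (A\<^sup>2 - 1) * (B\<^sup>2 - 1)"
  by (simp add: disc_def power2_eq_square algebra_simps)

lemma disc_cycle: "disc B C A = disc A B C"
  by (simp add: disc_def)

lemma disc_nonneg_aux:
  assumes "1 < C" "C \<le> B" "B \<le> A" "0 \<le> disc A B C" shows "B * C \<le> A"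
proof (rule ccontr)
  assume "\<not> B * C \<le> A"
  then have l: "0 < B * C - A" "B * C - A \<le> B * C - B" using assms by auto
  have "(B\<^sup>2 - 1) * (C\<^sup>2 - 1) \<le> (B * C - A)\<^sup>2" using assms(4) by (simp add: disc_def power2_eq_square algebra_simps)
  also have "\<dots> \<le> (B * C - B)\<^sup>2" using l by (intro power_mono) auto
  finally have "(C - 1) * ((B\<^sup>2 - 1) * (C + 1)) \<le> (C - 1) * (B\<^sup>2 * (C - 1))"
    by (simp add: power2_eq_square algebra_simps)
  then have "(B\<^sup>2 - 1) * (C + 1) \<le> B\<^sup>2 * (C - 1)" using assms by simp
  then have "2 * B\<^sup>2 \<le> C + 1" by (simp add: algebra_simps)
  moreover have "1 * B < B * B" by (rule mult_strict_right_mono) (use assms in auto)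
  ultimately show False using assms by (simp add: power2_eq_square)
qed

text \<open>If the triangle inequalities fail, one side is at least as long as the other two together; a fortiori
  its hyperbolic cosine is at least the product of theirs.\<close>

lemma disc_nonneg_cases:
  assumes "1 < A" "1 < B" "1 < C" "0 \<le> disc A B C"
  shows "A * B \<le> C \<or> B * C \<le> A \<or> C * A \<le> B"
proof -
  have s: "disc A B C = disc B A C" "disc A B C = disc A C B" "disc A B C = disc C B A" "disc A B C = disc C A B" "disc A B C = disc B C A"
    by (simp_all add: disc_def)
  consider "C \<le> B" "B \<le> A" | "B \<le> C" "C \<le> A" | "C \<le> A" "A \<le> B" | "A \<le> C" "C \<le> B" | "A \<le> B" "B \<le> C" | "B \<le> A" "A \<le> C"
    by linarith
  then show ?thesis
    by cases (use assms s disc_nonneg_aux[of C B A] disc_nonneg_aux[of B C A] disc_nonneg_aux[of C A B] disc_nonneg_aux[of A C B]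
       disc_nonneg_aux[of A B C] disc_nonneg_aux[of B A C] in \<open>auto simp: mult.commute\<close>)
qed

text \<open>Here \<open>h\<close> stands for the product \<open>f5 * f6\<close> of a centred third pair, and \<open>2 * A * B - C + 2 * h\<close> is the
  new value of \<open>C\<close> after a flip (\<open>flip_third_ch\<close>).\<close>

lemma flip_shortens:
  assumes "1 < A" "1 < B" "A * B \<le> C" "(C\<^sup>2 - 1) * h \<le> C * disc A B C"
  shows "2 * A * B - C + 2 * h < C"
proof -
  have 1: "1 * 1 < A * B" by (rule mult_strict_mono) (use assms in auto)
  then have C: "1 < C" using assms(3) by simp
  then have C2: "0 < C\<^sup>2 - 1" by (simp add: one_less_power)
  have "B * 1 < B * A" "A * 1 < A * B" using assms by simp_all
  then have CB: "B < C" "A < C" using assms(3) by (simp_all add: mult.commute)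
  have "1 * B < A * C" by (rule mult_strict_mono) (use assms CB in auto)
  moreover have "1 * A < B * C" by (rule mult_strict_mono) (use assms CB in auto)
  ultimately have p: "0 < (A * C - B) * (B * C - A)" by simp
  have "C * disc A B C = (C\<^sup>2 - 1) * (C - A * B) - (A * C - B) * (B * C - A)"
    by (simp add: disc_def power2_eq_square algebra_simps)
  with p assms(4) have "(C\<^sup>2 - 1) * h < (C\<^sup>2 - 1) * (C - A * B)" by simp
  then have "h < C - A * B" using C2 by simp
  then show ?thesis by simp
qed

text \<open>The flipped third pair cannot become too short when the first two have different lengths.\<close>

lemma flip_lower_bound:
  assumes "1 < C" "disc A B C \<le> 2 * (C - 1) * h"
  shows "(A - B)\<^sup>2 \<le> (2 * A * B - C + 2 * h - 1) * (C - 1)"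
  using assms(2) by (simp add: disc_def power2_eq_square algebra_simps)

text \<open>When the flip makes the second pair the longest, the pairs exchange roles.  The quotient of the squared
  excess by \<open>(A\<^sup>2 - 1) * (C'\<^sup>2 - 1)\<close> then takes the place of the quotient by \<open>(A\<^sup>2 - 1) * (B\<^sup>2 - 1)\<close>.  It has
  not grown.  In the variables \<open>q\<close>, \<open>w\<close>, \<open>d\<close> the hypotheses become \<open>Z \<le> q\<^sup>2\<close> and \<open>Cl\<close>; multiplying \<open>q\<^sup>2 - Z\<close>
  by a suitable nonnegative term combines them to the claim.\<close>

lemma excess_ratio_transfer:
  fixes A B C C' :: real
  assumes A: "1 < A" "A \<le> B" and C: "A * B \<le> C" "1 < C" and C': "1 < C'" "A * C' \<le> B" "0 \<le> disc A C' B"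
    and low: "(A - B)\<^sup>2 \<le> (C' - 1) * (C - 1)"
  shows "(B - A * C')\<^sup>2 * (B\<^sup>2 - 1) \<le> (C - A * B)\<^sup>2 * (C'\<^sup>2 - 1)"
proof -
  define w where "w = C' - 1"
  have w: "0 < w" "C' = w + 1" using C' by (simp_all add: w_def)
  define d where "d = B - A"
  define q where "q = d - A * w"
  define e where "e = A\<^sup>2 - 1"
  have e: "0 \<le> e" using A by (simp add: e_def one_le_power)
  have q: "q = B - A * C'" by (simp add: q_def d_def w algebra_simps)
  have q0: "0 \<le> q" using C' q by simp
  have d0: "0 \<le> d" using A by (simp add: d_def)
  define Z where "Z = e * (w * (w + 2))"
  have Z: "Z \<le> q\<^sup>2" using C'(3) unfolding disc_alt Z_def q e_def w(2) by (simp add: power2_eq_square algebra_simps)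
  have "e * w * 2 \<le> e * w * (w + 2)" using e w by (intro mult_left_mono) auto
  then have Zew: "2 * (e * w) \<le> Z" by (simp add: Z_def algebra_simps)
  have Z0: "0 \<le> e * w" using e w by simp
  have dq: "q\<^sup>2 \<le> d * q" unfolding power2_eq_square
    by (rule mult_right_mono) (use q0 A w in \<open>auto simp: q_def\<close>)
  have pos: "0 \<le> d * q - e * w" using dq Z Zew Z0 by linarith
  have Cl: "d * q - e * w \<le> (C - A * B) * w"
  proof -
    have "d\<^sup>2 \<le> w * (C - 1)" using low by (simp add: d_def w_def power2_commute)
    moreover have "d * q - e * w + (A * B - 1) * w = d\<^sup>2"
      by (simp add: q_def e_def d_def power2_eq_square algebra_simps)
    ultimately show ?thesis by (simp add: algebra_simps)
  qed
  have "0 \<le> (q\<^sup>2 - Z) * (2 * q\<^sup>2 + 2 * A * w * q - e * w)"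
  proof (rule mult_nonneg_nonneg)
    have "0 \<le> 2 * A * w * q" using A w q0 by simp
    then show "0 \<le> 2 * q\<^sup>2 + 2 * A * w * q - e * w" using Z Zew Z0 by linarith
  qed (use Z in simp)
  also have "\<dots> = (d * q - e * w)\<^sup>2 * (w + 2) - q\<^sup>2 * (B\<^sup>2 - 1) * w"
  proof -
    have B: "B = q + A * w + A" "d = q + A * w" by (simp_all add: q_def d_def)
    show ?thesis unfolding B Z_def e_def by algebra
  qed
  finally have "q\<^sup>2 * (B\<^sup>2 - 1) * w \<le> (d * q - e * w)\<^sup>2 * (w + 2)" by simp
  also have "\<dots> \<le> ((C - A * B) * w)\<^sup>2 * (w + 2)"
    by (intro mult_right_mono power_mono Cl pos) (use w in simp)
  finally have "w * (q\<^sup>2 * (B\<^sup>2 - 1)) \<le> w * ((C - A * B)\<^sup>2 * (w * (w + 2)))"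
    by (simp add: power2_eq_square algebra_simps)
  then have "q\<^sup>2 * (B\<^sup>2 - 1) \<le> (C - A * B)\<^sup>2 * (w * (w + 2))" using w by simp
  then show ?thesis unfolding q w by (simp add: power2_eq_square algebra_simps)
qed

lemma cosh_step: "cosh (x + c) \<le> exp c * cosh x" if "0 \<le> c" for x c :: real
proof -
  have "exp (- x - c) \<le> exp (c - x)" using that by simp
  then show ?thesis unfolding cosh_def by (simp add: exp_add exp_diff exp_minus field_simps)
qed

text \<open>Sliding the third pair by one step multiplies twice the product of the two signed heights, which is to
  lie between \<open>E - X\<close> and \<open>E + X\<close>, by at most \<open>exp (2 * c)\<close>.  The bound \<open>G\<close> makes the quotient of the two ends
  larger than this factor, so the window cannot be jumped over.  The sequence starts below the upper end, as
  the two points are on both sides of the minimum, and it is unbounded.\<close>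

lemma cosh_product_enters_window:
  fixes c k s A B :: real
  assumes c: "0 < c" and C: "C = cosh c" and A: "1 < A" and B: "1 < B" and X: "0 < X" "X\<^sup>2 = (A\<^sup>2 - 1) * (B\<^sup>2 - 1)"
    and E: "E = C - A * B" "X < E" and k: "0 < k" "k\<^sup>2 * (C\<^sup>2 - 1) = disc A B C"
    and G: "E \<le> G * X" "exp (2 * c) * (G - 1) < G + 1" and s: "-1 \<le> s" "s \<le> 0"
  shows "\<exists>n::nat. \<bar>2 * (k * cosh (c * (s + real n))) * (k * cosh (c * (s + real n + 1))) - E\<bar> < X"
proof -
  define h where "h n = 2 * (k * cosh (c * (s + real n))) * (k * cosh (c * (s + real n + 1)))" for n
  have GX: "exp (2 * c) * (E - X) < E + X"
  proof -
    have "X < G * X" using G E by linarith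
    then have G1: "0 < G - 1" using X by simp
    have "(E - X) * (G + 1) \<le> (E + X) * (G - 1)" using G(1) by (simp add: algebra_simps)
    moreover have "(E - X) * (exp (2 * c) * (G - 1)) < (E - X) * (G + 1)" using G(2) E by simp
    ultimately have "(exp (2 * c) * (E - X)) * (G - 1) < (E + X) * (G - 1)" by (simp add: algebra_simps)
    then show ?thesis using G1 by simp
  qed
  have hstep: "h (Suc n) \<le> exp (2 * c) * h n" for n
  proof -
    have "cosh (c * (s + real (Suc n))) \<le> exp c * cosh (c * (s + real n))"
      using cosh_step[of c "c * (s + real n)"] c by (simp add: algebra_simps)
    moreover have "cosh (c * (s + real (Suc n) + 1)) \<le> exp c * cosh (c * (s + real n + 1))"
      using cosh_step[of c "c * (s + real n + 1)"] c by (simp add: algebra_simps)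
    ultimately have "cosh (c * (s + real (Suc n))) * cosh (c * (s + real (Suc n) + 1)) \<le>
        (exp c * cosh (c * (s + real n))) * (exp c * cosh (c * (s + real n + 1)))"
      by (rule mult_mono) simp_all
    then have "2 * k\<^sup>2 * (cosh (c * (s + real (Suc n))) * cosh (c * (s + real (Suc n) + 1))) \<le>
        2 * k\<^sup>2 * ((exp c * cosh (c * (s + real n))) * (exp c * cosh (c * (s + real n + 1))))"
      by (rule mult_left_mono) simp
    moreover have "exp (2 * c) = exp c * exp c" by (simp add: exp_add[symmetric])
    ultimately show ?thesis unfolding h_def by (simp add: power2_eq_square algebra_simps)
  qed
  have h0: "h 0 < E + X"
  proof -
    have "cosh (c * (2 * s + 1)) \<le> cosh c"
    proof -
      have "\<bar>c * (2 * s + 1)\<bar> \<le> c" using s c by (simp add: abs_mult mult_le_cancel_left1 abs_le_iff)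
      then have "cosh \<bar>c * (2 * s + 1)\<bar> \<le> cosh c" by (subst cosh_real_nonneg_le_iff) (use c in auto)
      then show ?thesis by simp
    qed
    moreover have "2 * cosh (c * s) * cosh (c * (s + 1)) = cosh (c * (2 * s + 1)) + cosh c"
    proof -
      have e: "cosh (c * (2 * s + 1)) = cosh (c * s + c * (s + 1))" "cosh c = cosh (c * (s + 1) - c * s)"
        by (simp_all add: algebra_simps)
      show ?thesis unfolding e cosh_add cosh_diff by simp
    qed
    ultimately have "2 * (cosh (c * s) * cosh (c * (s + 1))) \<le> 2 * C" by (simp add: C)
    then have "k\<^sup>2 * (2 * (cosh (c * s) * cosh (c * (s + 1)))) \<le> k\<^sup>2 * (2 * C)"
      by (rule mult_left_mono) simp
    then have 1: "h 0 \<le> k\<^sup>2 * (2 * C)" by (simp add: h_def power2_eq_square algebra_simps)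
    have AB: "1 + X \<le> A * B"
    proof -
      have "(1 + X)\<^sup>2 \<le> (A * B)\<^sup>2"
      proof -
        have "(2 * X)\<^sup>2 \<le> ((A\<^sup>2 - 1) + (B\<^sup>2 - 1))\<^sup>2"
          unfolding power_mult_distrib X(2) using sum_squares_ge_zero[of "(A\<^sup>2 - 1) - (B\<^sup>2 - 1)" 0]
          by (simp add: power2_eq_square algebra_simps)
        then have "2 * X \<le> (A\<^sup>2 - 1) + (B\<^sup>2 - 1)"
          by (rule power2_le_imp_le) (use A B one_le_power[of A 2] one_le_power[of B 2] in linarith)
        then show ?thesis using X(2) by (simp add: power2_eq_square algebra_simps)
      qed
      then show ?thesis by (rule power2_le_imp_le) (use A B in simp)
    qed
    \<comment> \<open>From \<open>1 + X \<le> A * B\<close>, which is the inequality between the arithmetic and the geometric mean.\<close>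
    have C1: "2 * (X + E) \<le> C\<^sup>2 - 1"
    proof -
      have "1 + X + E \<le> C" using AB E by simp
      then have "(1 + X + E)\<^sup>2 \<le> C\<^sup>2" by (intro power_mono) (use X E in auto)
      moreover have "(1 + X + E)\<^sup>2 = 1 + 2 * (X + E) + (X + E)\<^sup>2" by (simp add: power2_eq_square algebra_simps)
      moreover have "0 \<le> (X + E)\<^sup>2" by simp
      ultimately show ?thesis by linarith
    qed
    have "0 < 2 * (X + E)" using X(1) E(2) by simp
    then have C0: "0 < C\<^sup>2 - 1" using C1 by (rule less_le_trans)
    have "C \<le> exp c" unfolding C cosh_def using c by simp
    also have "exp c \<le> exp (2 * c)" using c by simp
    finally have "C * (E - X) \<le> exp (2 * c) * (E - X)" using E by (intro mult_right_mono) auto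
    then have 2: "C * (E - X) < E + X" using GX by simp
    have "k\<^sup>2 * (2 * C) * (C\<^sup>2 - 1) = 2 * C * disc A B C" using k(2) by (simp add: algebra_simps)
    also have "disc A B C = (E - X) * (E + X)" unfolding disc_alt E(1)[symmetric] X(2)[symmetric] by (simp add: power2_eq_square algebra_simps)
    also have "2 * C * ((E - X) * (E + X)) = (C * (E - X)) * (2 * (X + E))" by (simp add: algebra_simps)
    also have "\<dots> < (E + X) * (2 * (X + E))" using 2 X E by (intro mult_strict_right_mono) auto
    also have "\<dots> \<le> (E + X) * (C\<^sup>2 - 1)" using C1 X E by (intro mult_left_mono) auto
    finally have "k\<^sup>2 * (2 * C) < E + X" using C0 by simp
    with 1 show ?thesis by simp
  qed
  have "\<exists>n. E - X < h n"
  proof -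
    obtain n :: nat where n: "(E - X) / (k\<^sup>2 * c) + 1 < real n" using reals_Archimedean2 by blast
    have ge: "x \<le> 2 * cosh x" for x :: real
    proof -
      have "2 * cosh x = exp x + exp (- x)" by (simp add: cosh_field_def)
      then show ?thesis using exp_ge_add_one_self[of x] exp_gt_zero[of "-x"] by linarith
    qed
    have "0 \<le> (E - X) / (k\<^sup>2 * c)" using E k c by simp
    then have n1: "1 < real n" using n by linarith
    have "E - X < k\<^sup>2 * (c * (real n - 1))" using n k c by (simp add: field_simps)
    also have "\<dots> \<le> k\<^sup>2 * (2 * cosh (c * (s + real n + 1)))"
    proof (rule mult_left_mono)
      have "c * (real n - 1) \<le> c * (s + real n + 1)" using s c by simp
      also have "\<dots> \<le> 2 * cosh (c * (s + real n + 1))" by (rule ge)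
      finally show "c * (real n - 1) \<le> 2 * cosh (c * (s + real n + 1))" .
    qed simp
    also have "\<dots> = 2 * k\<^sup>2 * cosh (c * (s + real n + 1))" by simp
    also have "\<dots> \<le> 2 * k\<^sup>2 * cosh (c * (s + real n + 1)) * cosh (c * (s + real n))"
      using cosh_real_ge_1[of "c * (s + real n)"] k by simp
    also have "\<dots> = h n" by (simp add: h_def power2_eq_square algebra_simps)
    finally show ?thesis by blast
  qed
  then obtain n where n: "E - X < h n" and least: "\<And>m. m < n \<Longrightarrow> \<not> E - X < h m"
    using exists_least_iff[of "\<lambda>n. E - X < h n"] by blast
  have "h n < E + X"
  proof (cases n)
    case 0 then show ?thesis using h0 by simp
  next
    case (Suc m)
    then have "h m \<le> E - X" using least[of m] by simp
    then have "exp (2 * c) * h m \<le> exp (2 * c) * (E - X)" by simp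
    then have "h (Suc m) \<le> exp (2 * c) * (E - X)" by (rule order_trans[OF hstep])
    then show ?thesis unfolding Suc using GX by (rule le_less_trans)
  qed
  with n have "\<bar>h n - E\<bar> < X" by linarith
  then show ?thesis unfolding h_def by blast
qed

section \<open>Moves and negative configurations\<close>

definition unleap :: "6 \<Rightarrow> config \<Rightarrow> config"
  where "unleap i y = (\<chi> j. if j = i then half_turn (y$i) \<bullet>\<^sub>H y$(i+1) else if j = i + 1 then y$i else y$j)"

definition rot :: "config \<Rightarrow> config"
  where "rot y = (\<chi> j. y$(j+1))"

definition transport :: "psl2r \<Rightarrow> config \<Rightarrow> config"
  where "transport g y = (\<chi> j. g \<bullet>\<^sub>H y$j)"

text \<open>Configurations whose half turn matrices multiply to \<open>-1\<close> in \<open>SL(2,R)\<close>, and not just to the identity in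
  \<open>PSL(2,R)\<close>.\<close>

definition negative :: "config \<Rightarrow> bool"
  where "negative y \<longleftrightarrow> J (y$6) ** J (y$5) ** J (y$4) ** J (y$3) ** J (y$2) ** J (y$1) = - mat 1"

lemma Sex_iff: "y \<in> Sex \<longleftrightarrow> negative y \<or> J (y$6) ** J (y$5) ** J (y$4) ** J (y$3) ** J (y$2) ** J (y$1) = mat 1"
proof -
  have "half_turn a * half_turn b * half_turn c * half_turn d * half_turn e * half_turn f = 1 \<longleftrightarrow>
    (J a ** J b ** J c ** J d ** J e ** J f = mat 1 \<or> J a ** J b ** J c ** J d ** J e ** J f = - mat 1)" for a b c d e f
    unfolding J_def by transfer (auto simp: psl_rel_def det_mul det_half_turn_matrix)
  then show ?thesis by (auto simp: Sex_def negative_def)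
qed

lemma unleap_leapfrog [simp]: "unleap i (leapfrog i y) = y"
  by (simp add: vec_eq_iff unleap_def leapfrog_def half_turn_square flip: psl_act_mult)

lemma leapfrog_unleap [simp]: "leapfrog i (unleap i y) = y"
  by (simp add: vec_eq_iff unleap_def leapfrog_def half_turn_square flip: psl_act_mult)

lemma rot_nth: "rot y $ j = y $ (j + 1)"
  by (simp add: rot_def)

lemma transport_nth [simp]: "transport g y $ j = g \<bullet>\<^sub>H y $ j"
  by (simp add: transport_def)

lemma leapfrog_rot: "leapfrog i (rot y) = rot (leapfrog (i + 1) y)"
  by (simp add: vec_eq_iff leapfrog_def rot_nth)

lemma leapfrog_transport: "leapfrog i (transport g y) = transport g (leapfrog i y)"
  by (simp add: vec_eq_iff leapfrog_def act_half_turn)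

lemma unleap_transport: "unleap i (transport g y) = transport g (unleap i y)"
  by (simp add: vec_eq_iff unleap_def act_half_turn)

lemma rot_transport: "rot (transport g y) = transport g (rot y)"
  by (simp add: vec_eq_iff rot_nth)

lemma iso_class_transport: "iso_class x = range (\<lambda>g. transport g x)"
  by (simp add: iso_class_def transport_def)

lemma leapfrog_nth:
  "leapfrog 1 y $ 1 = y$2" "leapfrog 1 y $ 2 = half_turn (y$2) \<bullet>\<^sub>H y$1"
  "leapfrog 1 y $ 3 = y$3" "leapfrog 1 y $ 4 = y$4" "leapfrog 1 y $ 5 = y$5" "leapfrog 1 y $ 6 = y$6"
  "leapfrog 2 y $ 2 = y$3" "leapfrog 2 y $ 3 = half_turn (y$3) \<bullet>\<^sub>H y$2"
  "leapfrog 2 y $ 1 = y$1" "leapfrog 2 y $ 4 = y$4" "leapfrog 2 y $ 5 = y$5" "leapfrog 2 y $ 6 = y$6"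
  "leapfrog 3 y $ 3 = y$4" "leapfrog 3 y $ 4 = half_turn (y$4) \<bullet>\<^sub>H y$3"
  "leapfrog 3 y $ 1 = y$1" "leapfrog 3 y $ 2 = y$2" "leapfrog 3 y $ 5 = y$5" "leapfrog 3 y $ 6 = y$6"
  "leapfrog 4 y $ 4 = y$5" "leapfrog 4 y $ 5 = half_turn (y$5) \<bullet>\<^sub>H y$4"
  "leapfrog 4 y $ 1 = y$1" "leapfrog 4 y $ 2 = y$2" "leapfrog 4 y $ 3 = y$3" "leapfrog 4 y $ 6 = y$6"
  "leapfrog 5 y $ 5 = y$6" "leapfrog 5 y $ 6 = half_turn (y$6) \<bullet>\<^sub>H y$5"
  "leapfrog 5 y $ 1 = y$1" "leapfrog 5 y $ 2 = y$2" "leapfrog 5 y $ 3 = y$3" "leapfrog 5 y $ 4 = y$4"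
  by (simp_all add: leapfrog_def)

lemma config_eqI:
  "x$1 = y$1 \<Longrightarrow> x$2 = y$2 \<Longrightarrow> x$3 = y$3 \<Longrightarrow> x$4 = y$4 \<Longrightarrow> x$5 = y$5 \<Longrightarrow> x$6 = y$6 \<Longrightarrow> x = y" for x y :: config
  unfolding vec_eq_iff
proof (rule allI)
  fix i :: 6
  assume "x$1 = y$1" "x$2 = y$2" "x$3 = y$3" "x$4 = y$4" "x$5 = y$5" "x$6 = y$6"
  then show "x$i = y$i" using exhaust_6[of i] by (elim disjE) simp_all
qed

lemma rot_nths: "rot y $ 1 = y$2" "rot y $ 2 = y$3" "rot y $ 3 = y$4" "rot y $ 4 = y$5" "rot y $ 5 = y$6" "rot y $ 6 = y$1"
  by (simp_all add: seven_eq rot_nth)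

text \<open>The first point jumps over all others; the defining relation brings the last image of \<open>x1\<close> back to
  \<open>x1\<close>.\<close>

lemma rot_leapfrogs:
  assumes "y \<in> Sex"
  shows "rot y = leapfrog 5 (leapfrog 4 (leapfrog 3 (leapfrog 2 (leapfrog 1 y))))"
proof -
  let ?s = "\<lambda>j. half_turn (y$j)"
  have "?s 6 * (?s 5 * (?s 4 * (?s 3 * ?s 2))) = ?s 1"
  proof -
    have "?s 6 * (?s 5 * (?s 4 * (?s 3 * ?s 2))) * (?s 1 * ?s 1) =
        (?s 6 * (?s 5 * (?s 4 * (?s 3 * (?s 2 * ?s 1))))) * ?s 1"
      by (simp only: mult.assoc)
    then show ?thesis
      by (simp only: Sex_relations(1)[OF assms] half_turn_square mult.left_neutral mult.right_neutral)
  qed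
  then have "?s 6 \<bullet>\<^sub>H ?s 5 \<bullet>\<^sub>H ?s 4 \<bullet>\<^sub>H ?s 3 \<bullet>\<^sub>H ?s 2 \<bullet>\<^sub>H y$1 = ?s 1 \<bullet>\<^sub>H y$1"
    by (simp only: psl_act_mult[symmetric])
  then show ?thesis
    by (intro config_eqI) (simp_all only: rot_nths leapfrog_nth half_turn_fixes)
qed

lemmas rassoc = matrix_mul_assoc[symmetric]

lemma negative_iff: "negative y \<longleftrightarrow> J (y$6) ** (J (y$5) ** (J (y$4) ** (J (y$3) ** (J (y$2) ** J (y$1))))) = - mat 1"
  unfolding negative_def by (simp only: rassoc)

lemma negative_rot:
  assumes "negative y" shows "negative (rot y)"
proof -
  have "J (y$1) ** ((J (y$6) ** (J (y$5) ** (J (y$4) ** (J (y$3) ** (J (y$2) ** J (y$1)))))) ** J (y$1)) = J (y$1) ** (- mat 1 ** J (y$1))"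
    using assms unfolding negative_iff by (rule arg_cong)
  then have "- (J (y$1) ** (J (y$6) ** (J (y$5) ** (J (y$4) ** (J (y$3) ** J (y$2)))))) = mat 1"
    by (simp only: rassoc J_sq matrix_mult_uminus matrix_mul_lid matrix_mul_rid minus_minus)
  then have "- mat 1 = J (y$1) ** (J (y$6) ** (J (y$5) ** (J (y$4) ** (J (y$3) ** J (y$2)))))"
    by (rule iffD1[OF minus_equation_iff])
  then show ?thesis unfolding negative_iff rot_nths by (rule sym)
qed

text \<open>Sets of negative configurations on which the group of moves and the isometries act.\<close>

definition inv_set :: "config set \<Rightarrow> bool"
  where "inv_set K \<longleftrightarrow> (\<forall>y\<in>K. negative y \<and> (\<forall>i. leapfrog i y \<in> K \<and> unleap i y \<in> K) \<and> (\<forall>g. transport g y \<in> K))"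

lemma inv_setD:
  assumes "inv_set K" "y \<in> K"
  shows "negative y" "leapfrog i y \<in> K" "unleap i y \<in> K" "transport g y \<in> K" "y \<in> Sex" "rot y \<in> K"
proof -
  have 1: "negative y" "\<And>i. leapfrog i y \<in> K" "\<And>i. unleap i y \<in> K" "\<And>g. transport g y \<in> K"
    using assms by (auto simp: inv_set_def)
  then show "negative y" "leapfrog i y \<in> K" "unleap i y \<in> K" "transport g y \<in> K" by blast+
  show "y \<in> Sex" using 1(1) by (simp add: Sex_iff)
  then show "rot y \<in> K" using assms by (auto simp: rot_leapfrogs inv_set_def)
qed

text \<open>Hyperbolic cosines of the three pair distances, and the scaled signed heights of \<open>x5\<close> and \<open>x6\<close> over the
  axis of the first pair (see \<open>vol\<close>), called heights below.\<close>

abbreviation "cA y \<equiv> ch (y$1) (y$2)"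

abbreviation "cB y \<equiv> ch (y$3) (y$4)"

abbreviation "cC y \<equiv> ch (y$5) (y$6)"

abbreviation "f5 y \<equiv> vol (y$5) (y$1) (y$2)"

abbreviation "f6 y \<equiv> vol (y$6) (y$1) (y$2)"

text \<open>Both equations are the relation with some factors moved to the other side.  The sign is where negativity
  enters: in the positive case \<open>negative_trace\<close> would have the opposite sign.\<close>

lemma negative_split:
  assumes "negative y"
  shows "J (y$4) ** J (y$3) ** J (y$2) ** J (y$1) = - (J (y$5) ** J (y$6))"
    "J (y$5) ** J (y$4) ** J (y$3) = J (y$6) ** J (y$1) ** J (y$2)"
proof -
  let ?J = "\<lambda>i. J (y$i)"
  note s = J_sq J_sq_left matrix_mult_uminus matrix_mul_lid matrix_mul_rid minus_minus
  have e: "?J 6 ** (?J 5 ** (?J 4 ** (?J 3 ** (?J 2 ** ?J 1)))) = - mat 1"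
    using assms unfolding negative_iff .
  have "?J 5 ** (?J 6 ** (?J 6 ** (?J 5 ** (?J 4 ** (?J 3 ** (?J 2 ** ?J 1)))))) = ?J 5 ** (?J 6 ** (- mat 1))"
    unfolding e ..
  then show "?J 4 ** ?J 3 ** ?J 2 ** ?J 1 = - (?J 5 ** ?J 6)"
    by (simp only: rassoc s)
  have "?J 6 ** ((?J 6 ** (?J 5 ** (?J 4 ** (?J 3 ** (?J 2 ** ?J 1))))) ** (?J 1 ** ?J 2)) = ?J 6 ** (- mat 1 ** (?J 1 ** ?J 2))"
    unfolding e ..
  then have "- (?J 5 ** (?J 4 ** ?J 3)) = - (?J 6 ** (?J 1 ** ?J 2))"
    by (simp only: rassoc s)
  then show "?J 5 ** ?J 4 ** ?J 3 = ?J 6 ** ?J 1 ** ?J 2"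
    by (simp only: rassoc neg_equal_iff_equal)
qed

lemma trace_minus: "trace (- M) = - trace M" for M :: "real^2^2"
  by (simp add: trace2)

lemma negative_trace: "negative y \<Longrightarrow> trace (J (y$4) ** J (y$3) ** J (y$2) ** J (y$1)) = 2 * cC y"
  unfolding negative_split(1) ch_trace trace_minus by simp

lemma negative_vol: "negative y \<Longrightarrow> vol (y$5) (y$4) (y$3) = f6 y"
  unfolding vol_def negative_split(2) ..

text \<open>The Gram identity for the pairs 12 and 56, in which the relation expresses the distance of the pair 34.\<close>

lemma negative_disc: assumes "negative y"
  shows "disc (cA y) (cB y) (cC y) = 2 * cC y * f5 y * f6 y - (f5 y)\<^sup>2 - (f6 y)\<^sup>2"
proof -
  have "negative (rot (rot (rot (rot y))))" using assms by (intro negative_rot)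
  from negative_trace[OF this] have "trace (J (y$2) ** J (y$1) ** J (y$6) ** J (y$5)) = 2 * cB y"
    by (simp add: rot_nths)
  then have B: "cB y = cA y * cC y - ch (y$2) (y$6) * ch (y$1) (y$5) + ch (y$2) (y$5) * ch (y$1) (y$6)"
    unfolding trace4 by (simp add: ch_sym)
  show ?thesis using gram4[of "y$1" "y$2" "y$5" "y$6"] unfolding disc_def B
    by (simp add: power2_eq_square algebra_simps)
qed

text \<open>Moves that replace \<open>x3\<close> and \<open>x4\<close> by their images under the half turn around \<open>x5\<close>.\<close>

definition flip_third :: "config \<Rightarrow> config"
  where "flip_third y = leapfrog 4 (leapfrog 3 (leapfrog 3 (leapfrog 4 y)))"

lemma flip_third_in:
  assumes "inv_set K" "y \<in> K" shows "flip_third y \<in> K"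
  unfolding flip_third_def
  by (rule inv_setD(2)[OF assms(1)], rule inv_setD(2)[OF assms(1)], rule inv_setD(2)[OF assms(1)], rule inv_setD(2)[OF assms])

text \<open>Since the relation makes \<open>C\<close> half the trace of \<open>J x4 ** J x3 ** J x2 ** J x1\<close>, the half turn of \<open>x3\<close> and
  \<open>x4\<close> changes \<open>C\<close> by the trace identity \<open>trace_JBJA\<close>.\<close>

lemma flip_third_ch:
  assumes y: "negative y" and m: "negative (flip_third y)"
  shows "cA (flip_third y) = cA y" "cB (flip_third y) = cB y" "cC (flip_third y) = 2 * cA y * cB y - cC y + 2 * f5 y * f6 y"
proof -
  have n: "flip_third y $ 1 = y$1" "flip_third y $ 2 = y$2"
    "flip_third y $ 3 = half_turn (y$5) \<bullet>\<^sub>H y$3" "flip_third y $ 4 = half_turn (y$5) \<bullet>\<^sub>H y$4"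
    unfolding flip_third_def leapfrog_nth by (rule refl)+
  show "cA (flip_third y) = cA y" "cB (flip_third y) = cB y" unfolding n by simp_all
  define A B where A: "A = - (J (y$2) ** J (y$1))" and B: "B = - (J (y$4) ** J (y$3))"
  note s = J_sq J_sq_left matrix_mult_uminus matrix_mul_lid matrix_mul_rid minus_minus
  have v: "trace (J a ** J b ** J c) = 2 * vol a b c" for a b c by (simp add: vol_def)
  have "J (y$5) ** B = - (J (y$5) ** J (y$4) ** J (y$3))" unfolding B by (simp only: matrix_mult_uminus rassoc)
  then have tB: "trace (J (y$5) ** B) = - 2 * f6 y" by (simp add: trace_minus v negative_vol[OF y])
  have "J (y$5) ** A = - (J (y$5) ** J (y$2) ** J (y$1))" unfolding A by (simp only: matrix_mult_uminus rassoc)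
  then have tA: "trace (J (y$5) ** A) = 2 * f5 y" by (simp add: trace_minus v vol_swap(1)[of "y$5" "y$1" "y$2"])
  have tt: "trace A = 2 * cA y" "trace B = 2 * cB y"
    unfolding A B ch_trace trace_minus trace_mul_sym[of "J (y$2)"] trace_mul_sym[of "J (y$4)"] by simp_all
  have "B ** A = J (y$4) ** J (y$3) ** J (y$2) ** J (y$1)" unfolding A B by (simp only: matrix_mult_uminus rassoc minus_minus)
  then have tBA: "trace (B ** A) = 2 * cC y" using negative_trace[OF y] by simp
  have "(- (J (y$5) ** J (y$4) ** J (y$5))) ** (- (J (y$5) ** J (y$3) ** J (y$5))) ** J (y$2) ** J (y$1) = - (J (y$5) ** B ** J (y$5) ** A)"
    unfolding A B by (simp only: rassoc s)
  moreover have "2 * cC (flip_third y) = trace ((- (J (y$5) ** J (y$4) ** J (y$5))) ** (- (J (y$5) ** J (y$3) ** J (y$5))) ** J (y$2) ** J (y$1))"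
    using negative_trace[OF m] unfolding n(1-4) J_half_turn by (rule sym)
  ultimately have "2 * cC (flip_third y) = - trace (J (y$5) ** B ** J (y$5) ** A)"
    by (simp only: trace_minus)
  then show "cC (flip_third y) = 2 * cA y * cB y - cC y + 2 * f5 y * f6 y"
    unfolding trace_JBJA tA tB tt tBA by (simp add: algebra_simps)
qed

section \<open>Sliding a pair along its axis\<close>

text \<open>The pair \<open>i\<close>, \<open>i + 1\<close> is slid along its axis: the product of its half turns, a translation by twice its
  distance, stays the same.\<close>

definition twist :: "6 \<Rightarrow> config \<Rightarrow> config \<Rightarrow> bool"
  where "twist i y z \<longleftrightarrow> (\<forall>j. j \<noteq> i \<and> j \<noteq> i + 1 \<longrightarrow> z$j = y$j) \<and> J (z$(i+1)) ** J (z$i) = J (y$(i+1)) ** J (y$i)"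

lemma twist_ch: "twist i y z \<Longrightarrow> ch (z$i) (z$(i+1)) = ch (y$i) (y$(i+1))"
  by (simp add: twist_def ch_trace trace_mul_sym[of "J (z$i)"] trace_mul_sym[of "J (y$i)"])

lemma vol_as_trace: "vol x a b = - trace (J x ** (J b ** J a)) / 2"
  using vol_swap(1)[of x b a] by (simp add: vol_def matrix_mul_assoc)

lemma twist_vol: "twist i y z \<Longrightarrow> vol x (z$i) (z$(i+1)) = vol x (y$i) (y$(i+1))"
  by (simp add: twist_def vol_as_trace)

lemma twist_leapfrog:
  assumes "twist i y z" shows "twist i y (leapfrog i z)"
proof -
  have "J (leapfrog i z $ (i+1)) ** J (leapfrog i z $ i) = J (z$(i+1)) ** J (z$i)"
    by (simp add: leapfrog_def J_half_turn) (simp only: rassoc J_sq matrix_mult_uminus minus_minus matrix_mul_rid)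
  then show ?thesis using assms unfolding twist_def by (simp add: leapfrog_def)
qed

lemma twist_unleap:
  assumes "twist i y z" shows "twist i y (unleap i z)"
proof -
  have "J (unleap i z $ (i+1)) ** J (unleap i z $ i) = J (z$(i+1)) ** J (z$i)"
    by (simp add: unleap_def J_half_turn) (simp only: rassoc J_sq_left matrix_mult_uminus minus_minus)
  then show ?thesis using assms unfolding twist_def by (simp add: unleap_def)
qed

text \<open>A linear functional, evaluated along the points visited by a sliding pair, satisfies the linear
  recurrence of \<open>J_half_turn_linear\<close>, so the solution with the same start is realised in both directions.\<close>

lemma twist_seq:
  fixes s :: "int \<Rightarrow> real"
  assumes K: "inv_set K" "y \<in> K" and l: "linear \<phi>"
    and s: "\<And>n. s (n + 1) = 2 * ch (y$i) (y$(i+1)) * s n - s (n - 1)"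
    and s0: "s 0 = \<phi> (J (y$i))" "s 1 = \<phi> (J (y$(i+1)))"
  shows "\<exists>z\<in>K. twist i y z \<and> \<phi> (J (z$i)) = s n \<and> \<phi> (J (z$(i+1))) = s (n + 1)"
proof (induction n rule: int_induct[where k = 0])
  case base
  show ?case by (rule bexI[OF _ K(2)]) (simp add: s0 twist_def)
next
  case (step1 n)
  then obtain z where z: "z \<in> K" "twist i y z" "\<phi> (J (z$i)) = s n" "\<phi> (J (z$(i+1))) = s (n + 1)" by blast
  let ?z = "leapfrog i z"
  have "\<phi> (J (?z$(i+1))) = 2 * ch (y$i) (y$(i+1)) * s (n + 1) - s n"
    using z twist_ch[OF z(2)] by (simp add: leapfrog_def J_half_turn_linear linear_diff[OF l] linear_cmul[OF l] ch_sym)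
  then have "\<phi> (J (?z$(i+1))) = s (n + 1 + 1)" using s[of "n + 1"] by simp
  moreover have "\<phi> (J (?z$i)) = s (n + 1)" using z by (simp add: leapfrog_def)
  ultimately show ?case using inv_setD(2)[OF K(1) z(1)] twist_leapfrog[OF z(2)] by blast
next
  case (step2 n)
  then obtain z where z: "z \<in> K" "twist i y z" "\<phi> (J (z$i)) = s n" "\<phi> (J (z$(i+1))) = s (n + 1)" by blast
  let ?z = "unleap i z"
  have "\<phi> (J (?z$i)) = 2 * ch (y$i) (y$(i+1)) * s n - s (n + 1)"
    using z twist_ch[OF z(2)] by (simp add: unleap_def J_half_turn_linear linear_diff[OF l] linear_cmul[OF l])
  then have "\<phi> (J (?z$i)) = s (n - 1)" using s[of n] by simp
  moreover have "\<phi> (J (?z$(i+1))) = s (n - 1 + 1)" using z by (simp add: unleap_def)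
  ultimately show ?case using inv_setD(3)[OF K(1) z(1)] twist_unleap[OF z(2)] by blast
qed

lemma cosh_recurrence: "k * cosh (a * (s + real_of_int (n + 1))) =
    2 * cosh a * (k * cosh (a * (s + real_of_int n))) - k * cosh (a * (s + real_of_int (n - 1)))" for a k s :: real
proof -
  have e: "a * (s + real_of_int (n + 1)) = a * (s + real_of_int n) + a" "a * (s + real_of_int (n - 1)) = a * (s + real_of_int n) - a"
    by (simp_all add: algebra_simps)
  show ?thesis unfolding e cosh_add cosh_diff by (simp add: algebra_simps)
qed

lemma twist_cosh:
  assumes K: "inv_set K" "y \<in> K" and l: "linear \<phi>"
    and A: "A = ch (y$i) (y$(i+1))" "1 < A" and pos: "0 < \<phi> (J (y$i))"
    and I: "I = 2 * A * \<phi> (J (y$i)) * \<phi> (J (y$(i+1))) - (\<phi> (J (y$i)))\<^sup>2 - (\<phi> (J (y$(i+1))))\<^sup>2" "0 < I"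
  obtains a k s where "0 < a" "A = cosh a" "0 < k" "k\<^sup>2 * (A\<^sup>2 - 1) = I"
    "\<And>n::int. \<exists>z\<in>K. twist i y z \<and> \<phi> (J (z$i)) = k * cosh (a * (s + real_of_int n)) \<and>
       \<phi> (J (z$(i+1))) = k * cosh (a * (s + real_of_int n + 1))"
proof -
  define a where "a = arcosh A"
  have a: "0 < a" "A = cosh a" using A(2) by (simp_all add: a_def)
  obtain k s where ks: "0 < k" "\<phi> (J (y$i)) = k * cosh (a * s)" "\<phi> (J (y$(i+1))) = k * cosh (a * (s + 1))"
    "k\<^sup>2 * ((cosh a)\<^sup>2 - 1) = I"
    using cosh_representation[OF a(1) pos I(1)[unfolded a(2)] I(2)] by blast
  have "\<exists>z\<in>K. twist i y z \<and> \<phi> (J (z$i)) = k * cosh (a * (s + real_of_int n)) \<and>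
       \<phi> (J (z$(i+1))) = k * cosh (a * (s + real_of_int (n + 1)))" for n
    by (rule twist_seq[OF K l])
       (use ks cosh_recurrence[of k a s] in \<open>simp_all add: A(1)[symmetric] a(2)\<close>)
  then have "\<exists>z\<in>K. twist i y z \<and> \<phi> (J (z$i)) = k * cosh (a * (s + real_of_int n)) \<and>
       \<phi> (J (z$(i+1))) = k * cosh (a * (s + real_of_int n + 1))" for n
    by (simp add: add.assoc)
  with a ks show ?thesis using that[of a k s] by simp
qed

text \<open>A pair can be slid such that its first or its second point is nearest to the minimum of the \<open>cosh\<close>
  sequence, or such that the minimum is between its points.\<close>

lemma twist_min:
  assumes K: "inv_set K" "y \<in> K" and l: "linear \<phi>"
    and A: "A = ch (y$i) (y$(i+1))" "1 < A" and pos: "0 < \<phi> (J (y$i))"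
    and I: "I = 2 * A * \<phi> (J (y$i)) * \<phi> (J (y$(i+1))) - (\<phi> (J (y$i)))\<^sup>2 - (\<phi> (J (y$(i+1))))\<^sup>2" "0 < I"
  shows "\<exists>z\<in>K. twist i y z \<and> (\<phi> (J (z$i)))\<^sup>2 * (2 * (A - 1)) \<le> I"
    and "\<exists>z\<in>K. twist i y z \<and> (\<phi> (J (z$(i+1))))\<^sup>2 * (2 * (A - 1)) \<le> I"
    and "\<exists>z\<in>K. twist i y z \<and> 0 < \<phi> (J (z$i)) \<and> 0 < \<phi> (J (z$(i+1))) \<and> \<phi> (J (z$i)) \<le> A * \<phi> (J (z$(i+1))) \<and>
      \<phi> (J (z$(i+1))) \<le> A * \<phi> (J (z$i))"
proof -
  obtain a k s where a: "0 < a" "A = cosh a" "0 < k" "k\<^sup>2 * (A\<^sup>2 - 1) = I"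
    and ex: "\<And>n::int. \<exists>z\<in>K. twist i y z \<and> \<phi> (J (z$i)) = k * cosh (a * (s + real_of_int n)) \<and>
       \<phi> (J (z$(i+1))) = k * cosh (a * (s + real_of_int n + 1))"
    by (rule twist_cosh[OF assms]) blast
  \<comment> \<open>The integer shift for which \<open>s + m\<close> is nearest to the minimum at 0.\<close>
  define m where "m = - round s"
  have m: "\<bar>s + real_of_int m\<bar> \<le> 1 / 2" using of_int_round_abs_le[of s] by (simp add: m_def abs_minus_commute)
  have le: "(k * cosh (a * (s + real_of_int m)))\<^sup>2 * (2 * (A - 1)) \<le> I"
    using cosh_le_half[OF a(1) m, of k I] a(2,4) by simp
  show "\<exists>z\<in>K. twist i y z \<and> (\<phi> (J (z$i)))\<^sup>2 * (2 * (A - 1)) \<le> I"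
    using ex[of m] le by metis
  have "s + real_of_int (m - 1) + 1 = s + real_of_int m" by simp
  then show "\<exists>z\<in>K. twist i y z \<and> (\<phi> (J (z$(i+1))))\<^sup>2 * (2 * (A - 1)) \<le> I"
    using ex[of "m - 1"] le by metis
  \<comment> \<open>The integer shift for which 0 is between \<open>s + p\<close> and \<open>s + p + 1\<close>.\<close>
  define p where "p = - \<lceil>s\<rceil>"
  have p: "-1 \<le> s + real_of_int p" "s + real_of_int p \<le> 0"
    unfolding p_def by (simp_all) linarith+
  define x where "x = a * (s + real_of_int p)"
  have x: "- a \<le> x" "x \<le> 0" using p a(1) mult_left_mono[of "-1" "s + real_of_int p" a]
    by (simp_all add: x_def mult_nonneg_nonpos)
  have e: "a * (s + real_of_int p + 1) = x + a" by (simp add: x_def algebra_simps)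
  have "cosh (x + a) \<le> cosh a * cosh x"
    using x a(1) by (simp add: cosh_add mult_nonpos_nonneg)
  moreover have "cosh x \<le> cosh a * cosh (x + a)"
  proof -
    have "cosh x = cosh ((x + a) - a)" by simp
    also have "\<dots> = cosh (x + a) * cosh a - sinh (x + a) * sinh a" by (rule cosh_diff)
    also have "\<dots> \<le> cosh a * cosh (x + a)" using x a(1) by simp
    finally show ?thesis .
  qed
  ultimately have "k * cosh (x + a) \<le> A * (k * cosh x)" "k * cosh x \<le> A * (k * cosh (x + a))"
    using a(3) by (simp_all add: a(2))
  then show "\<exists>z\<in>K. twist i y z \<and> 0 < \<phi> (J (z$i)) \<and> 0 < \<phi> (J (z$(i+1))) \<and> \<phi> (J (z$i)) \<le> A * \<phi> (J (z$(i+1))) \<and>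
      \<phi> (J (z$(i+1))) \<le> A * \<phi> (J (z$i))"
    using ex[of p] a(3) unfolding e x_def[symmetric] by (metis cosh_real_pos mult_pos_pos)
qed

text \<open>Hyperbolic cosine of the distance to a point, and scaled height over a line, as linear functionals of
  \<open>J\<close>.\<close>

definition phi_ch :: "h2 \<Rightarrow> real^2^2 \<Rightarrow> real" where "phi_ch p M = - trace (J p ** M) / 2"

definition phi_vol :: "h2 \<Rightarrow> h2 \<Rightarrow> real^2^2 \<Rightarrow> real" where "phi_vol a b M = trace (M ** (J a ** J b)) / 2"

lemma linear_phi: "linear (phi_ch p)" "linear (phi_vol a b)"
  by (rule linearI; simp add: phi_ch_def phi_vol_def mat2 field_simps)+

lemma phi_simps [simp]: "phi_ch p (J x) = ch p x" "phi_vol a b (J x) = vol x a b"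
  by (simp_all add: phi_ch_def ch_trace phi_vol_def vol_def matrix_mul_assoc)

lemma gram_third: "2 * ch x y * ch p x * ch p y - (ch p x)\<^sup>2 - (ch p y)\<^sup>2 = (ch x y)\<^sup>2 - 1 + (vol p x y)\<^sup>2"
  unfolding vol_gram by (simp add: algebra_simps)

text \<open>The nearest point of a sliding pair to \<open>p\<close> is at most half the pair distance away from the foot of the
  perpendicular from \<open>p\<close> to the axis.  The bound combines this with the height \<open>f\<close> of \<open>p\<close>.\<close>

lemma twist_near:
  assumes K: "inv_set K" "y \<in> K" and A: "A = ch (y$i) (y$(i+1))" "1 < A" and f: "f = vol p (y$i) (y$(i+1))"
  shows "\<exists>z\<in>K. twist i y z \<and> (ch p (z$i))\<^sup>2 \<le> (A + 1) / 2 + f\<^sup>2 / (2 * (A - 1))"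
    and "\<exists>z\<in>K. twist i y z \<and> (ch p (z$(i+1)))\<^sup>2 \<le> (A + 1) / 2 + f\<^sup>2 / (2 * (A - 1))"
proof -
  define I where "I = A\<^sup>2 - 1 + f\<^sup>2"
  have I: "0 < I" using A(2) by (simp add: I_def add_pos_nonneg one_less_power)
  have Ig: "I = 2 * A * phi_ch p (J (y$i)) * phi_ch p (J (y$(i+1))) - (phi_ch p (J (y$i)))\<^sup>2 - (phi_ch p (J (y$(i+1))))\<^sup>2"
    unfolding phi_simps A(1) gram_third I_def f ..
  have le: "x \<le> (A + 1) / 2 + f\<^sup>2 / (2 * (A - 1))" if "x * (2 * (A - 1)) \<le> I" for x
  proof -
    have "x \<le> I / (2 * (A - 1))" using that A(2) by (simp add: pos_le_divide_eq)
    also have "\<dots> = ((A + 1) * (A - 1) + f\<^sup>2) / (2 * (A - 1))"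
      by (simp add: I_def power2_eq_square algebra_simps)
    also have "\<dots> = ((A + 1) * (A - 1)) / (2 * (A - 1)) + f\<^sup>2 / (2 * (A - 1))"
      by (rule add_divide_distrib)
    also have "((A + 1) * (A - 1)) / (2 * (A - 1)) = (A + 1) / 2"
      by (rule nonzero_mult_divide_mult_cancel_right) (use A(2) in simp)
    finally show ?thesis .
  qed
  have pos: "0 < phi_ch p (J (y$i))" using ch_ge_1[of p "y$i"] unfolding phi_simps by linarith
  obtain z where z: "z \<in> K" "twist i y z" "(ch p (z$i))\<^sup>2 * (2 * (A - 1)) \<le> I"
    using twist_min(1)[OF K linear_phi(1) A pos Ig I] unfolding phi_simps by blast
  show "\<exists>z\<in>K. twist i y z \<and> (ch p (z$i))\<^sup>2 \<le> (A + 1) / 2 + f\<^sup>2 / (2 * (A - 1))"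
    by (rule bexI[OF _ z(1)]) (intro conjI z(2) le z(3))
  obtain w where w: "w \<in> K" "twist i y w" "(ch p (w$(i+1)))\<^sup>2 * (2 * (A - 1)) \<le> I"
    using twist_min(2)[OF K linear_phi(1) A pos Ig I] unfolding phi_simps by blast
  show "\<exists>z\<in>K. twist i y z \<and> (ch p (z$(i+1)))\<^sup>2 \<le> (A + 1) / 2 + f\<^sup>2 / (2 * (A - 1))"
    by (rule bexI[OF _ w(1)]) (intro conjI w(2) le w(3))
qed

section \<open>Compactness modulo isometries\<close>

text \<open>Invariant sets are called closed when their image in this Euclidean space is closed.\<close>

definition coords :: "config \<Rightarrow> ((real^2)^2)^6" where "coords y = (\<chi> j. J (y$j))"

lemma ch_tendsto:
  assumes "(\<lambda>n. J (x n)) \<longlonglongrightarrow> J a" "(\<lambda>n. J (y n)) \<longlonglongrightarrow> J b"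
  shows "(\<lambda>n. ch (x n) (y n)) \<longlonglongrightarrow> ch a b"
  unfolding ch_trace trace2 matrix_matrix_mult_def sum_2
  by simp (intro tendsto_intros assms; simp)

lemma vol_tendsto:
  assumes "(\<lambda>n. J (x n)) \<longlonglongrightarrow> J a" "(\<lambda>n. J (y n)) \<longlonglongrightarrow> J b" "(\<lambda>n. J (z n)) \<longlonglongrightarrow> J c"
  shows "(\<lambda>n. vol (x n) (y n) (z n)) \<longlonglongrightarrow> vol a b c"
  unfolding vol_def trace2 matrix_matrix_mult_def sum_2
  by simp (intro tendsto_intros assms; simp)

lemma norm_vec_le: "norm x \<le> (\<Sum>i\<in>UNIV. norm (x$i))" for x :: "'a::real_normed_vector ^ 'n"
  unfolding norm_vec_def by (rule L2_set_le_sum) simp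

definition h2_i :: h2 where "h2_i = Abs_h2 \<i>"

lemma J_h2_i: "J h2_i = vector [vector [0, -1], vector [1, 0]]"
proof -
  have "of_h2 h2_i = \<i>" unfolding h2_i_def by (rule Abs_h2_inverse) simp
  then show ?thesis by (simp add: J_def half_turn_matrix_def)
qed

lemma norm_J_le: "norm (J z) \<le> 8 * ch h2_i z"
proof -
  obtain u v w where 1: "J z = traceless u v w" "v * w = 1 + u\<^sup>2" "0 < w" "0 < v" by (rule J_coords[of z])
  have c: "ch h2_i z = (v + w) / 2"
    using ch_coords[of h2_i 0 1 1 z, OF _ 1(1)] by (simp add: J_h2_i)
  have "u\<^sup>2 \<le> (v + w)\<^sup>2" using 1 by (simp add: power2_eq_square algebra_simps add_nonneg_nonneg)
  then have u: "\<bar>u\<bar> \<le> v + w" using 1 by (simp add: abs_le_square_iff[symmetric])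
  have "norm (J z) \<le> (\<Sum>i\<in>UNIV. norm (J z $ i))" by (rule norm_vec_le)
  also have "\<dots> \<le> (\<Sum>i\<in>UNIV. (\<Sum>j\<in>UNIV. norm (J z $ i $ j)))" by (rule sum_mono) (rule norm_vec_le)
  also have "\<dots> = \<bar>u\<bar> + v + w + \<bar>u\<bar>" using 1 by (simp add: sum_2)
  also have "\<dots> \<le> 4 * (v + w)" using u 1 by simp
  finally show ?thesis by (simp add: c)
qed

text \<open>Invariance allows moving one vertex to \<open>h2_i\<close>; then the others stay in a bounded, hence compact, part.\<close>

lemma compactness:
  assumes K: "inv_set K" "closed (coords ` K)" and y: "\<And>n. y n \<in> K" "\<And>n j. ch (y n $ c) (y n $ j) \<le> M"
  obtains z r where "z \<in> K" "strict_mono (r :: nat \<Rightarrow> nat)"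
    "\<And>i j. (\<lambda>n. ch (y (r n) $ i) (y (r n) $ j)) \<longlonglongrightarrow> ch (z$i) (z$j)"
    "\<And>i j k. (\<lambda>n. vol (y (r n) $ i) (y (r n) $ j) (y (r n) $ k)) \<longlonglongrightarrow> vol (z$i) (z$j) (z$k)"
proof -
  have "\<exists>g. g \<bullet>\<^sub>H (y n $ c) = h2_i" for n by (rule psl_act_transitive)
  then obtain g where g: "\<And>n. g n \<bullet>\<^sub>H (y n $ c) = h2_i" by metis
  define x where "x n = transport (g n) (y n)" for n
  have x: "x n \<in> K" for n unfolding x_def by (rule inv_setD(4)[OF K(1) y(1)])
  have "norm (J (x n $ j)) \<le> 8 * M" for n j
  proof -
    have "norm (J (x n $ j)) \<le> 8 * ch h2_i (x n $ j)" by (rule norm_J_le)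
    also have "ch h2_i (x n $ j) = ch (y n $ c) (y n $ j)"
      using ch_act[of "g n" "y n $ c" "y n $ j"] by (simp add: g x_def)
    finally show ?thesis using y(2)[of n j] by simp
  qed
  note nb = this
  have "norm (coords (x n)) \<le> 48 * M" for n
  proof -
    have "norm (coords (x n)) \<le> (\<Sum>j\<in>(UNIV::6 set). norm (J (x n $ j)))"
      using norm_vec_le[of "coords (x n)"] by (simp add: coords_def)
    also have "\<dots> \<le> (\<Sum>j\<in>(UNIV::6 set). 8 * M)" by (rule sum_mono) (rule nb)
    finally show ?thesis by simp
  qed
  then have in_S: "coords (x n) \<in> coords ` K \<inter> cball 0 (48 * M)" for n using x by simp
  have "compact (coords ` K \<inter> cball 0 (48 * M))"
    by (rule closed_Int_compact[OF K(2)]) simp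
  then have "seq_compact (coords ` K \<inter> cball 0 (48 * M))" by (rule compact_imp_seq_compact)
  then obtain l r where l: "l \<in> coords ` K \<inter> cball 0 (48 * M)" and r: "strict_mono (r :: nat \<Rightarrow> nat)" "((\<lambda>n. coords (x n)) \<circ> r) \<longlonglongrightarrow> l"
    by (rule seq_compactE[of _ "\<lambda>n. coords (x n)"]) (use in_S in blast)+
  then obtain z where z: "z \<in> K" "l = coords z" by blast
  have lim: "(\<lambda>n. J (x (r n) $ j)) \<longlonglongrightarrow> J (z$j)" for j
    using tendsto_vec_nth[OF r(2), of j] by (simp add: z(2) coords_def o_def)
  show ?thesis
  proof (rule that[OF z(1) r(1)])
    show "(\<lambda>n. ch (y (r n) $ i) (y (r n) $ j)) \<longlonglongrightarrow> ch (z$i) (z$j)" for i j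
      using ch_tendsto[OF lim[of i] lim[of j]] by (simp add: x_def)
    show "(\<lambda>n. vol (y (r n) $ i) (y (r n) $ j) (y (r n) $ k)) \<longlonglongrightarrow> vol (z$i) (z$j) (z$k)" for i j k
      using vol_tendsto[OF lim[of i] lim[of j] lim[of k]] by (simp add: x_def)
  qed
qed

section \<open>No coinciding pair before collapse\<close>

lemma minimizing_sequence:
  fixes h :: "'a \<Rightarrow> real"
  assumes "S \<noteq> {}" "\<And>y. y \<in> S \<Longrightarrow> 0 \<le> h y"
  obtains y where "\<And>n::nat. y n \<in> S" "(\<lambda>n. h (y n)) \<longlonglongrightarrow> Inf (h ` S)" "\<And>n. h (y n) \<le> Inf (h ` S) + 1"
    "\<And>z. z \<in> S \<Longrightarrow> Inf (h ` S) \<le> h z"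
proof -
  have bdd: "bdd_below (h ` S)" using assms(2) by (auto intro!: bdd_belowI[of _ 0])
  have low: "Inf (h ` S) \<le> h z" if "z \<in> S" for z using that bdd by (simp add: cInf_lower)
  have "\<exists>y\<in>S. h y < Inf (h ` S) + 1 / real (Suc n)" for n
    using cInf_lessD[of "h ` S" "Inf (h ` S) + 1 / real (Suc n)"] assms(1) by auto
  then obtain y where y: "\<And>n. y n \<in> S" "\<And>n. h (y n) < Inf (h ` S) + 1 / real (Suc n)" by metis
  have "(\<lambda>n. h (y n)) \<longlonglongrightarrow> Inf (h ` S)"
  proof (rule tendsto_sandwich[of "\<lambda>n. Inf (h ` S)" _ _ "\<lambda>n. Inf (h ` S) + 1 / real (Suc n)"])
    show "(\<lambda>n. Inf (h ` S) + 1 / real (Suc n)) \<longlonglongrightarrow> Inf (h ` S)"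
      using tendsto_add[OF tendsto_const LIMSEQ_inverse_real_of_nat, of "Inf (h ` S)"] by (simp add: inverse_eq_divide)
    show "(\<lambda>n. Inf (h ` S)) \<longlonglongrightarrow> Inf (h ` S)" by simp
    show "\<forall>\<^sub>F n in sequentially. Inf (h ` S) \<le> h (y n)" using low y(1) by simp
    show "\<forall>\<^sub>F n in sequentially. h (y n) \<le> Inf (h ` S) + 1 / real (Suc n)"
      by (rule always_eventually) (intro allI less_imp_le y(2))
  qed
  moreover have "h (y n) \<le> Inf (h ` S) + 1" for n
  proof -
    have "1 / real (Suc n) \<le> 1" by simp
    then show ?thesis using y(2)[of n] by linarith
  qed
  ultimately show ?thesis using that y(1) low by blast
qed

lemma hdist_tendsto: "(\<lambda>n. ch (x n) (y n)) \<longlonglongrightarrow> ch a b \<Longrightarrow> (\<lambda>n. hdist (x n) (y n)) \<longlonglongrightarrow> hdist a b"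
  unfolding hdist_eq by (rule tendsto_arcosh_strong) (simp_all add: ch_ge_1)

lemma hdist_less_iff: "hdist a b < hdist c d \<longleftrightarrow> ch a b < ch c d"
  using cosh_real_nonneg_less_iff[of "hdist a b" "hdist c d"] by simp

lemma ch_gt_1: "a \<noteq> b \<Longrightarrow> 1 < ch a b"
  using ch_ge_1[of a b] ch_eq_1[of a b] by linarith

lemma hdist_pos: "a \<noteq> b \<Longrightarrow> 0 < hdist a b"
  using hdist_less_iff[of a a a b] ch_gt_1[of a b] hdist_eq[of a a] by simp

lemma lin_comb:
  assumes "J x = l *\<^sub>R J a + m *\<^sub>R J b"
  shows "ch p x = l * ch p a + m * ch p b" "vol p q x = l * vol p q a + m * vol p q b" "vol x p q = l * vol a p q + m * vol b p q"
proof -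
  have l: "phi_ch p (J x) = l * phi_ch p (J a) + m * phi_ch p (J b)"
    "phi_vol p q (J x) = l * phi_vol p q (J a) + m * phi_vol p q (J b)"
    unfolding assms by (simp_all only: linear_add[OF linear_phi(1)] linear_cmul[OF linear_phi(1)] linear_add[OF linear_phi(2)]
      linear_cmul[OF linear_phi(2)] real_scaleR_def)
  then show "ch p x = l * ch p a + m * ch p b" "vol x p q = l * vol a p q + m * vol b p q" by simp_all
  have r: "vol p q u = vol u p q" for u
    using vol_swap(2)[of p u q] vol_swap(1)[of p u q] by simp
  show "vol p q x = l * vol p q a + m * vol p q b" using l(2) by (simp add: r)
qed

definition perim :: "config \<Rightarrow> real"
  where "perim y = hdist (y$1) (y$2) + hdist (y$3) (y$4) + hdist (y$5) (y$6)"

abbreviation disc_of :: "config \<Rightarrow> real" where "disc_of y \<equiv> disc (cA y) (cB y) (cC y)"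

text \<open>Configurations in whose orbits lie the pinched ones.\<close>

definition collapsed :: "config \<Rightarrow> bool"
  where "collapsed y \<longleftrightarrow> y$1 = y$2 \<and> y$3 = y$4 \<and> y$5 = y$6"

lemma perim_nonneg: "0 \<le> perim y" by (simp add: perim_def)

lemma ch_le_perim: "cA y \<le> cosh (perim y)" "cB y \<le> cosh (perim y)" "cC y \<le> cosh (perim y)"
  unfolding cosh_hdist[symmetric] perim_def by (subst cosh_real_nonneg_le_iff; simp)+

definition rot2 where "rot2 y = rot (rot y)"

lemma rot2_nths: "rot2 y $ 1 = y$3" "rot2 y $ 2 = y$4" "rot2 y $ 3 = y$5" "rot2 y $ 4 = y$6" "rot2 y $ 5 = y$1" "rot2 y $ 6 = y$2"
  by (simp_all add: rot2_def rot_nths)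

lemma rot2_in: "inv_set K \<Longrightarrow> y \<in> K \<Longrightarrow> rot2 y \<in> K"
  unfolding rot2_def by (intro inv_setD(6))

lemma rot2_perim: "perim (rot2 y) = perim y" by (simp add: perim_def rot2_nths)

lemma rot2_disc: "disc_of (rot2 y) = disc_of y" by (simp add: rot2_nths disc_cycle)

lemma J_equal_pair: "y$1 = y$2 \<Longrightarrow> J (y$2) ** J (y$1) = - mat 1" by simp

lemma twist_135:
  "twist 1 y z \<Longrightarrow> z$3 = y$3 \<and> z$4 = y$4 \<and> z$5 = y$5 \<and> z$6 = y$6 \<and> J (z$2) ** J (z$1) = J (y$2) ** J (y$1) \<and> cA z = cA y \<and> vol x (z$1) (z$2) = vol x (y$1) (y$2)"
  "twist 3 y z \<Longrightarrow> z$1 = y$1 \<and> z$2 = y$2 \<and> z$5 = y$5 \<and> z$6 = y$6 \<and> J (z$4) ** J (z$3) = J (y$4) ** J (y$3) \<and> cB z = cB y \<and> vol x (z$3) (z$4) = vol x (y$3) (y$4)"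
  "twist 5 y z \<Longrightarrow> z$3 = y$3 \<and> z$4 = y$4 \<and> z$1 = y$1 \<and> z$2 = y$2 \<and> J (z$6) ** J (z$5) = J (y$6) ** J (y$5) \<and> cC z = cC y \<and> vol x (z$5) (z$6) = vol x (y$5) (y$6)"
  using twist_ch[of 1 y z] twist_ch[of 3 y z] twist_ch[of 5 y z] twist_vol[of 1 y z x] twist_vol[of 3 y z x] twist_vol[of 5 y z x]
  by (simp_all add: twist_def)

text \<open>If the first pair is a single point, the relation says \<open>J x4 ** J x3 = J x5 ** J x6\<close>: the other two
  pairs have the same axis and the same distance.\<close>

lemma degenerate_pair:
  assumes y: "negative y" "y$1 = y$2"
  shows "cC y = cB y" "vol (y$5) (y$3) (y$4) = 0" "vol x (y$5) (y$6) = - vol x (y$3) (y$4)"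
proof -
  show "cC y = cB y" using negative_trace[OF y(1)] unfolding trace4 by (simp add: y(2) ch_sym)
  show "vol (y$5) (y$3) (y$4) = 0" using negative_vol[OF y(1)] vol_swap(1)[of "y$5" "y$3" "y$4"] by (simp add: y(2))
  have "J (y$4) ** J (y$3) ** (J (y$2) ** J (y$1)) = - (J (y$5) ** J (y$6))"
    using negative_split(1)[OF y(1)] by (simp only: rassoc)
  then have "J (y$4) ** J (y$3) = J (y$5) ** J (y$6)"
    unfolding J_equal_pair[OF y(2)] by (simp only: matrix_mult_uminus matrix_mul_rid neg_equal_iff_equal)
  then have "vol x (y$3) (y$4) = vol x (y$6) (y$5)" by (simp only: vol_as_trace)
  then show "vol x (y$5) (y$6) = - vol x (y$3) (y$4)" using vol_swap(1)[of x "y$5" "y$6"] by simp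
qed

lemma sq_le_imp_le: "x\<^sup>2 \<le> q \<Longrightarrow> 1 \<le> x \<Longrightarrow> x \<le> (q::real)"
  using mult_left_mono[of 1 x x] by (simp add: power2_eq_square order_trans[of x "x * x"])

lemma twist_near_135:
  assumes K: "inv_set K" "y \<in> K"
  shows "1 < cA y \<Longrightarrow> \<exists>z\<in>K. twist 1 y z \<and> (ch p (z$1))\<^sup>2 \<le> (cA y + 1) / 2 + (vol p (y$1) (y$2))\<^sup>2 / (2 * (cA y - 1))"
    and "1 < cB y \<Longrightarrow> \<exists>z\<in>K. twist 3 y z \<and> (ch p (z$3))\<^sup>2 \<le> (cB y + 1) / 2 + (vol p (y$3) (y$4))\<^sup>2 / (2 * (cB y - 1))"
    and "1 < cC y \<Longrightarrow> \<exists>z\<in>K. twist 5 y z \<and> (ch p (z$5))\<^sup>2 \<le> (cC y + 1) / 2 + (vol p (y$5) (y$6))\<^sup>2 / (2 * (cC y - 1))"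
    and "1 < cA y \<Longrightarrow> \<exists>z\<in>K. twist 1 y z \<and> (ch p (z$2))\<^sup>2 \<le> (cA y + 1) / 2 + (vol p (y$1) (y$2))\<^sup>2 / (2 * (cA y - 1))"
proof -
  have e: "1 + 1 = (2::6)" "3 + 1 = (4::6)" "5 + 1 = (6::6)" by simp_all
  note t = twist_near[OF K refl _ refl]
  show "1 < cA y \<Longrightarrow> \<exists>z\<in>K. twist 1 y z \<and> (ch p (z$1))\<^sup>2 \<le> (cA y + 1) / 2 + (vol p (y$1) (y$2))\<^sup>2 / (2 * (cA y - 1))"
    by (rule t(1)[of 1, unfolded e])
  show "1 < cB y \<Longrightarrow> \<exists>z\<in>K. twist 3 y z \<and> (ch p (z$3))\<^sup>2 \<le> (cB y + 1) / 2 + (vol p (y$3) (y$4))\<^sup>2 / (2 * (cB y - 1))"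
    by (rule t(1)[of 3, unfolded e])
  show "1 < cC y \<Longrightarrow> \<exists>z\<in>K. twist 5 y z \<and> (ch p (z$5))\<^sup>2 \<le> (cC y + 1) / 2 + (vol p (y$5) (y$6))\<^sup>2 / (2 * (cC y - 1))"
    by (rule t(1)[of 5, unfolded e])
  show "1 < cA y \<Longrightarrow> \<exists>z\<in>K. twist 1 y z \<and> (ch p (z$2))\<^sup>2 \<le> (cA y + 1) / 2 + (vol p (y$1) (y$2))\<^sup>2 / (2 * (cA y - 1))"
    by (rule t(2)[of 1, unfolded e])
qed

text \<open>With \<open>x1 = x2\<close> the points \<open>x3\<close>, \<open>x4\<close>, \<open>x5\<close> lie on one line and leapfrogging acts as Euclid's algorithm
  on it: slide the pair 34 until \<open>x3\<close> is within half its distance from \<open>x5\<close>, and then make \<open>x3\<close>, \<open>x5\<close> the new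
  second pair.  So the smallest distance could only be 0, and the configuration would be collapsed.
  Minimisers exist because the distance of \<open>x1\<close> from the line, which is bounded through \<open>G\<close>, does not change.\<close>

lemma no_degenerate_pair:
  assumes K: "inv_set K" "closed (coords ` K)" and nf: "\<forall>y\<in>K. \<not> collapsed y" and y0: "y0 \<in> K"
  shows "y0$1 \<noteq> y0$2"
proof
  assume y012: "y0$1 = y0$2"
  have B1: "1 < cB y" if "y \<in> K" "y$1 = y$2" for y
  proof -
    have "y$3 \<noteq> y$4"
    proof
      assume "y$3 = y$4"
      then have "cC y = 1" using degenerate_pair(1)[OF inv_setD(1)[OF K(1) that(1)] that(2)] by simp
      with \<open>y$3 = y$4\<close> nf that show False by (simp add: collapsed_def)
    qed
    then show ?thesis by (rule ch_gt_1)
  qed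
  have sq1: "0 < (cB y)\<^sup>2 - 1" if "y \<in> K" "y$1 = y$2" for y
    using B1[OF that] by (simp add: one_less_power)
  define G where "G = (vol (y0$1) (y0$3) (y0$4))\<^sup>2 / ((cB y0)\<^sup>2 - 1)"
  have G0: "0 \<le> G" unfolding G_def using sq1[OF y0 y012] by simp
  \<comment> \<open>The quotient is the squared \<open>sinh\<close> of the distance of \<open>x1\<close> from the common axis of the other pairs.\<close>
  define S where "S = {y \<in> K. y$1 = y$2 \<and> (vol (y$1) (y$3) (y$4))\<^sup>2 \<le> G * ((cB y)\<^sup>2 - 1)}"
  have "y0 \<in> S" using y0 y012 sq1[OF y0 y012] by (simp add: S_def G_def)
  then have "S \<noteq> {}" by blast
  then obtain y where y: "\<And>n::nat. y n \<in> S" "(\<lambda>n. cB (y n)) \<longlonglongrightarrow> Inf (cB ` S)" "\<And>n. cB (y n) \<le> Inf (cB ` S) + 1"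
    "\<And>z. z \<in> S \<Longrightarrow> Inf (cB ` S) \<le> cB z"
    by (rule minimizing_sequence[of S cB]) (use ch_ge_1 in \<open>auto intro: order_trans[of 0 1]\<close>)
  define b where "b = Inf (cB ` S) + 1"
  \<comment> \<open>\<open>q\<close> bounds the right hand side of \<open>twist_near\<close>; the other point of a pair costs a factor \<open>2 * b\<close> by \<open>ch_le_mult\<close>.\<close>
  define q where "q = (b + 1) / 2 * (1 + G)"
  have b1: "1 \<le> b" using y(3)[of 0] ch_ge_1[of "y 0 $ 3" "y 0 $ 4"] by (simp add: b_def)
  have "1 * 1 \<le> (b + 1) / 2 * (1 + G)" by (rule mult_mono) (use b1 G0 in auto)
  then have q1: "1 \<le> q" by (simp add: q_def)
  have bq: "(B + 1) / 2 + f\<^sup>2 / (2 * (B - 1)) \<le> q" if "1 < B" "B \<le> b" "f\<^sup>2 \<le> G * (B\<^sup>2 - 1)" for B f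
  proof -
    have "f\<^sup>2 / (2 * (B - 1)) \<le> G * (B\<^sup>2 - 1) / (2 * (B - 1))"
      using that by (intro divide_right_mono) auto
    also have "G * (B\<^sup>2 - 1) = (G * (B + 1)) * (B - 1)" by (simp add: power2_eq_square algebra_simps)
    also have "(G * (B + 1)) * (B - 1) / (2 * (B - 1)) = (G * (B + 1)) / 2"
      by (rule nonzero_mult_divide_mult_cancel_right) (use that in simp)
    finally have "(B + 1) / 2 + f\<^sup>2 / (2 * (B - 1)) \<le> (B + 1) / 2 * (1 + G)" by (simp add: algebra_simps add_divide_distrib)
    also have "\<dots> \<le> q" unfolding q_def using that G0 by (intro mult_right_mono) auto
    finally show ?thesis .
  qed
  define M where "M = 2 * q * b"
  have M: "q \<le> M" "1 \<le> M"
  proof -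
    have "q * 1 \<le> q * (2 * b)" using q1 b1 by (intro mult_left_mono) auto
    then show "q \<le> M" by (simp add: M_def)
    then show "1 \<le> M" using q1 by linarith
  qed
  have "\<exists>w\<in>S. cB w = cB (y n) \<and> (\<forall>j. ch (w$1) (w$j) \<le> M)" for n
  proof -
    let ?y = "y n"
    let ?p = "?y$1"
    have Sy: "?y \<in> K" "?y$1 = ?y$2" "(vol ?p (?y$3) (?y$4))\<^sup>2 \<le> G * ((cB ?y)\<^sup>2 - 1)" using y(1)[of n] by (auto simp: S_def)
    have Bb: "1 < cB ?y" "cB ?y \<le> b" using B1[OF Sy(1,2)] y(3) by (simp_all add: b_def)
    obtain z where z: "z \<in> K" "twist 3 ?y z" "(ch ?p (z$3))\<^sup>2 \<le> (cB ?y + 1) / 2 + (vol ?p (?y$3) (?y$4))\<^sup>2 / (2 * (cB ?y - 1))"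
      using twist_near_135(2)[OF K(1) Sy(1) Bb(1), of ?p] by blast
    note tz = twist_135(2)[OF z(2)]
    have z12: "z$1 = z$2" "z$1 = ?p" using tz Sy(2) by metis+
    note dz = degenerate_pair[OF inv_setD(1)[OF K(1) z(1)] z12(1)]
    have C: "cC z = cB ?y" using dz(1) tz by simp
    have fz: "(vol ?p (z$5) (z$6))\<^sup>2 = (vol ?p (?y$3) (?y$4))\<^sup>2" using dz(3)[of ?p] tz by simp
    obtain w where w: "w \<in> K" "twist 5 z w" "(ch ?p (w$5))\<^sup>2 \<le> (cC z + 1) / 2 + (vol ?p (z$5) (z$6))\<^sup>2 / (2 * (cC z - 1))"
      using twist_near_135(3)[OF K(1) z(1), of ?p] Bb(1) unfolding C by blast
    note tw = twist_135(3)[OF w(2)]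
    have w1: "w$1 = ?p" "w$2 = ?p" "w$3 = z$3" "w$4 = z$4" using tw z12 by auto
    have c3: "ch ?p (w$3) \<le> q"
      unfolding w1(3) by (rule sq_le_imp_le[OF order_trans[OF z(3) bq[OF Bb Sy(3)]] ch_ge_1])
    have "(vol ?p (z$5) (z$6))\<^sup>2 \<le> G * ((cB ?y)\<^sup>2 - 1)" unfolding fz by (rule Sy(3))
    from bq[OF Bb this] have "(ch ?p (w$5))\<^sup>2 \<le> q" using w(3) unfolding C by (rule order_trans[rotated])
    then have c5: "ch ?p (w$5) \<le> q" by (rule sq_le_imp_le[OF _ ch_ge_1])
    have cBw: "cB w = cB ?y" unfolding w1 using tz by blast
    have cCw: "cC w = cB ?y" using tw C by metis
    have c46: "2 * x * u \<le> M" if "x \<le> q" "1 \<le> x" "u \<le> b" "1 \<le> u" for x u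
      unfolding M_def using that q1 b1 by (intro mult_mono) auto
    have "cB w \<le> b" "cC w \<le> b" using cBw cCw Bb by simp_all
    then have c4: "ch ?p (w$4) \<le> M" and c6: "ch ?p (w$6) \<le> M"
      using order_trans[OF ch_le_mult[of ?p "w$4" "w$3"] c46[OF c3 ch_ge_1 _ ch_ge_1]]
        order_trans[OF ch_le_mult[of ?p "w$6" "w$5"] c46[OF c5 ch_ge_1 _ ch_ge_1]] by blast+
    have c12: "ch ?p (w$1) \<le> M" "ch ?p (w$2) \<le> M" unfolding w1 using M by simp_all
    have c35: "ch ?p (w$3) \<le> M" "ch ?p (w$5) \<le> M" using c3 c5 M by simp_all
    have "vol ?p (w$3) (w$4) = vol ?p (?y$3) (?y$4)" unfolding w1 using tz by blast
    then have "(vol (w$1) (w$3) (w$4))\<^sup>2 \<le> G * ((cB w)\<^sup>2 - 1)" unfolding cBw w1(1) using Sy(3) by metis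
    moreover have "w$1 = w$2" by (simp only: w1)
    ultimately have "w \<in> S" using w(1) unfolding S_def by blast
    moreover have "ch (w$1) (w$j) \<le> M" for j
      unfolding w1(1) using exhaust_6[of j] c12 c35 c4 c6 by metis
    ultimately show ?thesis using cBw by blast
  qed
  then obtain w where w: "\<And>n. w n \<in> S" "\<And>n. cB (w n) = cB (y n)" "\<And>n j. ch (w n $ 1) (w n $ j) \<le> M" by metis
  have wK: "\<And>n. w n \<in> K" using w(1) by (simp add: S_def)
  obtain z r where z: "z \<in> K" "strict_mono (r :: nat \<Rightarrow> nat)"
    "\<And>i j. (\<lambda>n. ch (w (r n) $ i) (w (r n) $ j)) \<longlonglongrightarrow> ch (z$i) (z$j)"
    "\<And>i j k. (\<lambda>n. vol (w (r n) $ i) (w (r n) $ j) (w (r n) $ k)) \<longlonglongrightarrow> vol (z$i) (z$j) (z$k)"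
    by (rule compactness[OF K, of w 1 M]) (use wK w(3) in blast)+
  have "(\<lambda>n. cA (w (r n))) \<longlonglongrightarrow> 1" using w(1) by (simp add: S_def)
  then have "cA z = 1" using z(3)[of 1 2] LIMSEQ_unique by blast
  then have z12: "z$1 = z$2" by simp
  have "(\<lambda>n. cB (w (r n))) \<longlonglongrightarrow> Inf (cB ` S)"
    using LIMSEQ_subseq_LIMSEQ[OF y(2) z(2)] by (simp add: w(2) o_def)
  then have zB: "cB z = Inf (cB ` S)" using z(3)[of 3 4] LIMSEQ_unique by blast
  have zf: "(vol (z$1) (z$3) (z$4))\<^sup>2 \<le> G * ((cB z)\<^sup>2 - 1)"
  proof (rule LIMSEQ_le)
    show "(\<lambda>n. (vol (w (r n) $ 1) (w (r n) $ 3) (w (r n) $ 4))\<^sup>2) \<longlonglongrightarrow> (vol (z$1) (z$3) (z$4))\<^sup>2"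
      by (intro tendsto_intros z)
    show "(\<lambda>n. G * ((cB (w (r n)))\<^sup>2 - 1)) \<longlonglongrightarrow> G * ((cB z)\<^sup>2 - 1)"
      by (intro tendsto_intros z)
    show "\<exists>N. \<forall>n\<ge>N. (vol (w (r n) $ 1) (w (r n) $ 3) (w (r n) $ 4))\<^sup>2 \<le> G * ((cB (w (r n)))\<^sup>2 - 1)"
      using w(1) unfolding S_def by blast
  qed
  have Bz: "1 < cB z" by (rule B1[OF z(1) z12])
  have v0: "vol (z$5) (z$3) (z$4) = 0" by (rule degenerate_pair(2)[OF inv_setD(1)[OF K(1) z(1)] z12])
  obtain x where x: "x \<in> K" "twist 3 z x" "(ch (z$5) (x$3))\<^sup>2 \<le> (cB z + 1) / 2"
    using twist_near_135(2)[OF K(1) z(1) Bz, of "z$5"] unfolding v0 by auto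
  note tx = twist_135(2)[OF x(2)]
  have x1: "x$1 = z$1" "x$2 = z$2" "x$5 = z$5" and x2: "cB x = cB z"
    and x3: "\<And>p. vol p (x$3) (x$4) = vol p (z$3) (z$4)" using tx by blast+
  \<comment> \<open>The last step of Euclid's algorithm: \<open>x5\<close> becomes the fourth point.\<close>
  define u where "u = leapfrog 4 x"
  have u: "u \<in> K" unfolding u_def by (rule inv_setD(2)[OF K(1) x(1)])
  have un: "u$1 = z$1" "u$2 = z$2" "u$3 = x$3" "u$4 = z$5" by (simp_all only: u_def leapfrog_nth x1)
  have "x$3 \<noteq> x$4" using Bz x2 by auto
  moreover have "vol (z$5) (x$3) (x$4) = 0" unfolding x3 by (rule v0)
  ultimately obtain l m where lm: "J (z$5) = l *\<^sub>R J (x$3) + m *\<^sub>R J (x$4)" by (rule coplanar_span)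
  have c35: "ch (x$3) (z$5) = l + m * cB z" unfolding lin_comb(1)[OF lm, of "x$3"] x2 by simp
  have c45: "ch (x$4) (z$5) = l * cB z + m" unfolding lin_comb(1)[OF lm, of "x$4"] ch_sym[of "x$4" "x$3"] x2 by simp
  have c55: "l * (l + m * cB z) + m * (l * cB z + m) = 1"
    using lin_comb(1)[OF lm, of "z$5"] unfolding ch_sym[of "z$5" "x$3"] ch_sym[of "z$5" "x$4"] c35 c45 by simp
  have cBu: "cB u = l + m * cB z" unfolding un by (rule c35)
  have "(cB u)\<^sup>2 - 1 = m\<^sup>2 * ((cB z)\<^sup>2 - 1)"
    unfolding cBu using c55 by (simp add: power2_eq_square algebra_simps)
  moreover have "vol (u$1) (u$3) (u$4) = m * vol (z$1) (z$3) (z$4)"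
    unfolding un lin_comb(2)[OF lm, of "z$1" "x$3"] x3[symmetric] by simp
  ultimately have "(vol (u$1) (u$3) (u$4))\<^sup>2 \<le> G * ((cB u)\<^sup>2 - 1)"
    using mult_left_mono[OF zf, of "m\<^sup>2"] by (simp add: power_mult_distrib mult.left_commute)
  moreover have "u$1 = u$2" unfolding un by (rule z12)
  ultimately have "u \<in> S" using u unfolding S_def by blast
  then have "cB z \<le> cB u" using y(4) zB by simp
  then have "(cB z)\<^sup>2 \<le> (cB u)\<^sup>2" using Bz by (intro power_mono) auto
  also have "\<dots> \<le> (cB z + 1) / 2" using x(3) unfolding un ch_sym[of "z$5"] .
  also have "\<dots> < cB z" using Bz by simp
  also have "\<dots> < (cB z)\<^sup>2" using Bz by (simp add: power2_eq_square)
  finally show False .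
qed

text \<open>The other two pairs become the first one by rotating the indices.\<close>

lemma pairs_nondegenerate:
  assumes K: "inv_set K" "closed (coords ` K)" and nf: "\<forall>y\<in>K. \<not> collapsed y" and y: "y \<in> K"
  shows "1 < cA y" "1 < cB y" "1 < cC y"
proof -
  note n = no_degenerate_pair[OF K nf]
  have r: "rot2 y \<in> K" "rot2 (rot2 y) \<in> K" using y rot2_in[OF K(1)] by blast+
  show "1 < cA y" "1 < cB y" "1 < cC y"
    using n[OF y] n[OF r(1)] n[OF r(2)] by (simp_all add: rot2_nths ch_gt_1)
qed

section \<open>Shortening the longest pair\<close>

lemma disc_neg_iff: "disc A B C < 0 \<longleftrightarrow> \<bar>C - A * B\<bar> < sqrt ((A\<^sup>2 - 1) * (B\<^sup>2 - 1))" if "1 < A" "1 < B"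
proof -
  have X: "0 \<le> (A\<^sup>2 - 1) * (B\<^sup>2 - 1)" using that by (simp add: one_le_power)
  have "disc A B C < 0 \<longleftrightarrow> (C - A * B)\<^sup>2 < (A\<^sup>2 - 1) * (B\<^sup>2 - 1)" by (auto simp: disc_alt)
  also have "\<dots> \<longleftrightarrow> sqrt ((C - A * B)\<^sup>2) < sqrt ((A\<^sup>2 - 1) * (B\<^sup>2 - 1))" by (rule real_sqrt_less_iff[symmetric])
  also have "\<dots> \<longleftrightarrow> \<bar>C - A * B\<bar> < sqrt ((A\<^sup>2 - 1) * (B\<^sup>2 - 1))" by (simp only: real_sqrt_abs)
  finally show ?thesis .
qed

lemma flip_third_props:
  assumes K: "inv_set K" "y \<in> K"
  shows "flip_third y \<in> K" "cA (flip_third y) = cA y" "cB (flip_third y) = cB y" "cC (flip_third y) = 2 * cA y * cB y - cC y + 2 * (f5 y * f6 y)"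
proof -
  note m = flip_third_ch[OF inv_setD(1)[OF K] inv_setD(1)[OF K(1) flip_third_in[OF K]]]
  show "flip_third y \<in> K" "cA (flip_third y) = cA y" "cB (flip_third y) = cB y" by (rule flip_third_in[OF K] m)+
  show "cC (flip_third y) = 2 * cA y * cB y - cC y + 2 * (f5 y * f6 y)" unfolding m(3) by (simp only: mult.assoc)
qed

lemma perim_less:
  assumes "cA z = cA y" "cB z = cB y" "cC z < cC y" shows "perim z < perim y"
proof -
  have "hdist (z$1) (z$2) = hdist (y$1) (y$2)" "hdist (z$3) (z$4) = hdist (y$3) (y$4)"
    using assms by (simp_all add: hdist_eq)
  moreover have "hdist (z$5) (z$6) < hdist (y$5) (y$6)" using assms(3) by (simp add: hdist_less_iff)
  ultimately show ?thesis by (simp add: perim_def)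
qed

lemma twist5_same:
  assumes "twist 5 y z"
  shows "cA z = cA y" "cB z = cB y" "cC z = cC y" "z$1 = y$1" "z$2 = y$2" "z$3 = y$3" "z$4 = y$4" "perim z = perim y"
proof -
  note t = twist_135(3)[OF assms]
  show 1: "cC z = cC y" "z$1 = y$1" "z$2 = y$2" "z$3 = y$3" "z$4 = y$4" using t by blast+
  show "cA z = cA y" "cB z = cB y" by (simp_all only: 1)
  show "perim z = perim y" using 1(1) by (simp add: perim_def hdist_eq 1(2-))
qed

text \<open>The flip replaces the excess \<open>C - A * B\<close> by \<open>2 * f5 * f6\<close> minus the excess.  If this is smaller than
  \<open>sqrt ((A\<^sup>2 - 1) * (B\<^sup>2 - 1))\<close> in absolute value, the result is a triangle.\<close>

lemma flip_in_window:
  assumes K: "inv_set K" "y \<in> K" and AB: "1 < cA y" "1 < cB y"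
    and w: "\<bar>2 * (f5 y * f6 y) - (cC y - cA y * cB y)\<bar> < sqrt (((cA y)\<^sup>2 - 1) * ((cB y)\<^sup>2 - 1))"
    and D: "0 \<le> disc_of y" "cA y * cB y \<le> cC y"
  shows "\<exists>z\<in>K. disc_of z < 0 \<and> perim z < perim y"
proof -
  note m = flip_third_props[OF K]
  let ?X = "sqrt (((cA y)\<^sup>2 - 1) * ((cB y)\<^sup>2 - 1))"
  have "cC (flip_third y) - cA y * cB y = 2 * (f5 y * f6 y) - (cC y - cA y * cB y)" unfolding m by simp
  then have 1: "\<bar>cC (flip_third y) - cA y * cB y\<bar> < ?X" using w by simp
  then have "disc_of (flip_third y) < 0" unfolding m(2,3) using disc_neg_iff[OF AB] by blast
  moreover have "?X \<le> cC y - cA y * cB y"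
    using D disc_neg_iff[OF AB, of "cC y"] by linarith
  then have "cC (flip_third y) < cC y" using 1 by linarith
  then have "perim (flip_third y) < perim y" using perim_less[OF m(2,3)] by blast
  ultimately show ?thesis using m(1) by blast
qed

text \<open>For \<open>disc = 0\<close> the invariant of the recurrence vanishes, so sliding the third pair makes the signed
  heights a geometric sequence.  Their product is positive and gets as small as wanted.\<close>

lemma asymptotic_axes:
  assumes K: "inv_set K" "y \<in> K" and AB: "1 < cA y" "1 < cB y"
    and D: "disc_of y = 0" "cA y * cB y \<le> cC y" and f: "f5 y \<noteq> 0 \<or> f6 y \<noteq> 0"
  shows "\<exists>z\<in>K. disc_of z < 0 \<and> perim z < perim y"
proof -
  let ?C = "cC y"
  have "1 * 1 < cA y * cB y" by (rule mult_strict_mono) (use AB in auto)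
  then have C1: "1 < ?C" using D by simp
  define c where "c = arcosh ?C"
  have "y$5 \<noteq> y$6" using C1 by auto
  then have c: "0 < c" "cosh c = ?C" unfolding c_def by (simp_all add: ch_ge_1)
  have e: "2 * ?C * f5 y * f6 y = (f5 y)\<^sup>2 + (f6 y)\<^sup>2" using negative_disc[OF inv_setD(1)[OF K]] D by simp
  have ec: "exp c + exp (- c) = 2 * ?C" unfolding c(2)[symmetric] by (simp add: cosh_field_def)
  have "(f6 y - exp c * f5 y) * (f6 y - exp (- c) * f5 y) = (f6 y)\<^sup>2 - (exp c + exp (- c)) * f5 y * f6 y + (exp c * exp (- c)) * (f5 y)\<^sup>2"
    by (simp add: power2_eq_square algebra_simps)
  also have "exp c * exp (- c) = 1" by (simp add: exp_minus)
  finally have "(f6 y - exp c * f5 y) * (f6 y - exp (- c) * f5 y) = 0" using e ec by simp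
  then obtain t where t: "t = c \<or> t = - c" "f6 y = exp t * f5 y" by auto
  have f5: "f5 y \<noteq> 0" using f t by auto
  define s where "s n = f5 y * exp (t * real_of_int n)" for n :: int
  have et: "exp t + exp (- t) = 2 * ?C" using t(1) ec by auto
  have rec: "s (n + 1) = 2 * ?C * s n - s (n - 1)" for n
  proof -
    have "s (n + 1) + s (n - 1) = s n * (exp t + exp (- t))"
      unfolding s_def by (simp add: exp_add exp_minus algebra_simps exp_diff field_simps)
    then show ?thesis unfolding et by (simp add: algebra_simps)
  qed
  let ?X = "sqrt (((cA y)\<^sup>2 - 1) * ((cB y)\<^sup>2 - 1))"
  have X: "0 < ?X" using AB by (simp add: one_less_power)
  \<comment> \<open>The product of the heights at \<open>n\<close> is \<open>(f5 y)\<^sup>2 * exp (t * n + t * (n + 1))\<close>; it is below \<open>?X\<close> once the exponent is below \<open>b\<close>.\<close>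
  define b where "b = ln (?X / (f5 y)\<^sup>2)"
  have eb: "exp b = ?X / (f5 y)\<^sup>2" unfolding b_def using X f5 by (intro exp_ln) simp
  have t0: "t \<noteq> 0" "\<bar>t\<bar> = c" using t(1) c by auto
  obtain N :: nat where N: "\<bar>b\<bar> / c + 1 < real N" using reals_Archimedean2 by blast
  then have N2: "\<bar>b\<bar> < c * (real N - 1)" using c by (simp add: field_simps)
  have N1: "1 < real N" using N c(1) by (smt (verit) divide_nonneg_pos abs_ge_zero)
  \<comment> \<open>Both choices make the exponent \<open>c * (1 - 2 * N)\<close>.\<close>
  define n :: int where "n = (if t > 0 then - int N else int N - 1)"
  have tn: "t * real_of_int n + t * (real_of_int n + 1) < b"
  proof -
    have "t * real_of_int n + t * (real_of_int n + 1) = c * (1 - 2 * real N)"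
      using t(1) c(1) unfolding n_def by (auto simp: algebra_simps)
    also have "\<dots> \<le> c * (1 - real N)" using c(1) by simp
    also have "\<dots> < b" using N2 by (simp add: algebra_simps)
    finally show ?thesis .
  qed
  have ss: "s n * s (n + 1) = (f5 y)\<^sup>2 * exp (t * real_of_int n + t * (real_of_int n + 1))"
    unfolding s_def by (simp add: exp_add power2_eq_square)
  have ss0: "0 < s n * s (n + 1)" unfolding ss using f5 by simp
  have "s n * s (n + 1) < (f5 y)\<^sup>2 * exp b" unfolding ss using f5 tn by simp
  then have ss1: "s n * s (n + 1) < ?X" unfolding eb using f5 by simp
  have i: "5 + 1 = (6::6)" by simp
  obtain z where z: "z \<in> K" "twist 5 y z" "f5 z = s n" "f6 z = s (n + 1)"
  proof -
    have "\<exists>z\<in>K. twist 5 y z \<and> phi_vol (y$1) (y$2) (J (z$5)) = s n \<and> phi_vol (y$1) (y$2) (J (z$(5+1))) = s (n + 1)"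
      by (rule twist_seq[OF K linear_phi(2)]) (use rec in \<open>simp_all add: i s_def t(2)\<close>)
    then obtain z where z: "z \<in> K" "twist 5 y z" "phi_vol (y$1) (y$2) (J (z$5)) = s n" "phi_vol (y$1) (y$2) (J (z$6)) = s (n + 1)"
      unfolding i by blast
    note same = twist5_same[OF z(2)]
    show ?thesis by (rule that[OF z(1,2)]) (use z(3,4) in \<open>simp_all add: same\<close>)
  qed
  note same = twist5_same[OF z(2)]
  have EX: "?C - cA y * cB y = ?X"
  proof -
    have "(?C - cA y * cB y)\<^sup>2 = ((cA y)\<^sup>2 - 1) * ((cB y)\<^sup>2 - 1)" using D by (simp add: disc_alt)
    then show ?thesis using D by (simp add: real_sqrt_unique)
  qed
  have "\<exists>u\<in>K. disc_of u < 0 \<and> perim u < perim z"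
  proof (rule flip_in_window[OF K(1) z(1)])
    show "1 < cA z" "1 < cB z" "0 \<le> disc_of z" "cA z * cB z \<le> cC z" unfolding same(1-3) using AB D by simp_all
    show "\<bar>2 * (f5 z * f6 z) - (cC z - cA z * cB z)\<bar> < sqrt (((cA z)\<^sup>2 - 1) * ((cB z)\<^sup>2 - 1))"
      unfolding same(1-3) EX z(3,4) using ss0 ss1 by linarith
  qed
  then show ?thesis unfolding same(8) .
qed

text \<open>Here \<open>f\<close> and \<open>f'\<close> are the heights of a pair lying on both sides of the lowest point of its axis.\<close>

lemma centred_bounds:
  fixes C f f' D :: real
  assumes C: "1 < C" and D: "D = 2 * C * f * f' - f\<^sup>2 - f'\<^sup>2" and f: "0 < f" "0 < f'" "f \<le> C * f'" "f' \<le> C * f"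
  shows "(C\<^sup>2 - 1) * (f * f') \<le> C * D" "D \<le> 2 * (C - 1) * (f * f')" "f\<^sup>2 * (C\<^sup>2 - 1) \<le> C\<^sup>2 * D" "f'\<^sup>2 * (C\<^sup>2 - 1) \<le> C\<^sup>2 * D"
proof -
  have "0 \<le> (C * f' - f) * (C * f - f')" using f by simp
  then show 1: "(C\<^sup>2 - 1) * (f * f') \<le> C * D" unfolding D by (simp add: power2_eq_square algebra_simps)
  have "0 \<le> (f - f')\<^sup>2" by simp
  then show "D \<le> 2 * (C - 1) * (f * f')" unfolding D by (simp add: power2_eq_square algebra_simps)
  have C2: "0 < C\<^sup>2 - 1" using C by (simp add: one_less_power)
  have 2: "C * ((C\<^sup>2 - 1) * (f * f')) \<le> C\<^sup>2 * D" using mult_left_mono[OF 1, of C] C by (simp add: power2_eq_square)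
  have "f * f \<le> f * (C * f')" "f' * f' \<le> f' * (C * f)" using f by (simp_all add: mult_left_mono)
  then have "f\<^sup>2 \<le> C * (f * f')" "f'\<^sup>2 \<le> C * (f * f')" by (simp_all add: power2_eq_square mult_ac)
  then have "f\<^sup>2 * (C\<^sup>2 - 1) \<le> (C * (f * f')) * (C\<^sup>2 - 1)" "f'\<^sup>2 * (C\<^sup>2 - 1) \<le> (C * (f * f')) * (C\<^sup>2 - 1)"
    using C2 by (intro mult_right_mono; simp)+
  with 2 show "f\<^sup>2 * (C\<^sup>2 - 1) \<le> C\<^sup>2 * D" "f'\<^sup>2 * (C\<^sup>2 - 1) \<le> C\<^sup>2 * D" by (simp_all add: algebra_simps)
qed

text \<open>The two heights have the same sign; exchanging \<open>x1\<close> and \<open>x2\<close> makes it positive.\<close>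

lemma signed_vol:
  assumes y: "negative y" "1 < cC y" "0 < disc_of y"
  obtains a b and e :: real where "e = 1 \<or> e = -1" "\<And>p. vol p a b = e * vol p (y$1) (y$2)" "0 < vol (y$5) a b"
    "disc_of y = 2 * cC y * vol (y$5) a b * vol (y$6) a b - (vol (y$5) a b)\<^sup>2 - (vol (y$6) a b)\<^sup>2"
proof -
  have "0 < 2 * cC y * f5 y * f6 y"
    using negative_disc[OF y(1)] y(3) zero_le_power2[of "f5 y"] zero_le_power2[of "f6 y"] by linarith
  then have f: "f5 y \<noteq> 0" by auto
  show ?thesis
  proof (cases "0 < f5 y")
    case True
    show ?thesis by (rule that[of 1 "y$1" "y$2"]) (use True negative_disc[OF y(1)] in simp_all)
  next
    case False
    have v: "vol p (y$2) (y$1) = - vol p (y$1) (y$2)" for p by (rule vol_swap(1))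
    show ?thesis by (rule that[of "-1" "y$2" "y$1"]) (use False f negative_disc[OF y(1)] in \<open>simp_all add: v\<close>)
  qed
qed

text \<open>Slide the third pair such that the lowest point of its axis over the first axis is between its points.\<close>

lemma twist_centred:
  assumes K: "inv_set K" "y \<in> K" and C: "1 < cC y" and D: "0 \<le> disc_of y" "disc_of y = 0 \<Longrightarrow> f5 y = 0 \<and> f6 y = 0"
  shows "\<exists>z\<in>K. twist 5 y z \<and> ((cC y)\<^sup>2 - 1) * (f5 z * f6 z) \<le> cC y * disc_of y \<and> disc_of y \<le> 2 * (cC y - 1) * (f5 z * f6 z) \<and>
     (f5 z)\<^sup>2 * ((cC y)\<^sup>2 - 1) \<le> (cC y)\<^sup>2 * disc_of y \<and> (f6 z)\<^sup>2 * ((cC y)\<^sup>2 - 1) \<le> (cC y)\<^sup>2 * disc_of y"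
proof (cases "disc_of y = 0")
  case True
  have "twist 5 y y" by (simp add: twist_def)
  then show ?thesis using D(2)[OF True] True K(2) by (intro bexI[of _ y]) auto
next
  case False
  then have D0: "0 < disc_of y" using D by simp
  let ?C = "cC y"
  obtain a b and e :: real where e: "e = 1 \<or> e = -1" and v: "\<And>p. vol p a b = e * vol p (y$1) (y$2)" and vpos: "0 < vol (y$5) a b"
    and vI: "disc_of y = 2 * ?C * vol (y$5) a b * vol (y$6) a b - (vol (y$5) a b)\<^sup>2 - (vol (y$6) a b)\<^sup>2"
    by (rule signed_vol[OF inv_setD(1)[OF K] C D0]) (assumption | rule that)+
  have i: "5 + 1 = (6::6)" by simp
  have I: "disc_of y = 2 * ?C * phi_vol a b (J (y$5)) * phi_vol a b (J (y$6)) - (phi_vol a b (J (y$5)))\<^sup>2 - (phi_vol a b (J (y$6)))\<^sup>2"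
    unfolding phi_simps by (rule vI)
  have pos: "0 < phi_vol a b (J (y$5))" unfolding phi_simps by (rule vpos)
  have "\<exists>z\<in>K. twist 5 y z \<and> 0 < phi_vol a b (J (z$5)) \<and> 0 < phi_vol a b (J (z$6)) \<and>
      phi_vol a b (J (z$5)) \<le> ?C * phi_vol a b (J (z$6)) \<and> phi_vol a b (J (z$6)) \<le> ?C * phi_vol a b (J (z$5))"
  proof -
    have "A = cC y \<Longrightarrow> \<exists>z\<in>K. twist 5 y z \<and> 0 < phi_vol a b (J (z$5)) \<and> 0 < phi_vol a b (J (z$6)) \<and>
      phi_vol a b (J (z$5)) \<le> A * phi_vol a b (J (z$6)) \<and> phi_vol a b (J (z$6)) \<le> A * phi_vol a b (J (z$5))" for A
      using twist_min(3)[of K y "phi_vol a b" A 5 "disc_of y"] K linear_phi(2)[of a b] C pos I D0 unfolding i by metis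
    then show ?thesis by blast
  qed
  then obtain z where z: "z \<in> K" "twist 5 y z" "0 < vol (z$5) a b" "0 < vol (z$6) a b" "vol (z$5) a b \<le> ?C * vol (z$6) a b" "vol (z$6) a b \<le> ?C * vol (z$5) a b"
    unfolding phi_simps by blast
  note same = twist5_same[OF z(2)]
  have "disc_of y = 2 * ?C * f5 z * f6 z - (f5 z)\<^sup>2 - (f6 z)\<^sup>2"
    using negative_disc[OF inv_setD(1)[OF K(1) z(1)]] unfolding same(1-3) .
  then have DZ: "disc_of y = 2 * ?C * vol (z$5) a b * vol (z$6) a b - (vol (z$5) a b)\<^sup>2 - (vol (z$6) a b)\<^sup>2"
    unfolding v same by (insert e, (elim disjE; simp)+)
  have p: "vol (z$5) a b * vol (z$6) a b = f5 z * f6 z" "(vol (z$5) a b)\<^sup>2 = (f5 z)\<^sup>2" "(vol (z$6) a b)\<^sup>2 = (f6 z)\<^sup>2"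
    unfolding v same by (insert e, (elim disjE; simp)+)
  show ?thesis
    using centred_bounds[OF C DZ z(3-6)] z(1,2) unfolding p by blast
qed

section \<open>Reaching a triangle\<close>

lemma perim_tendsto:
  assumes "\<And>i j. (\<lambda>n. ch (y n $ i) (y n $ j)) \<longlonglongrightarrow> ch (z$i) (z$j)"
  shows "(\<lambda>n. perim (y n)) \<longlonglongrightarrow> perim z"
  unfolding perim_def by (intro tendsto_add hdist_tendsto assms)

lemma perim_cong: "cA z = cA y \<Longrightarrow> cB z = cB y \<Longrightarrow> cC z = cC y \<Longrightarrow> perim z = perim y"
  by (simp add: perim_def hdist_eq)

text \<open>The third pair is too long for a triangle.  The quotient of \<open>C - A * B\<close> by \<open>sqrt ((A\<^sup>2 - 1) * (B\<^sup>2 -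
  1))\<close> is the hyperbolic cosine of the distance between the axes of the first two pairs, so the last condition
  bounds that distance.\<close>

definition long_third :: "real \<Rightarrow> real \<Rightarrow> config \<Rightarrow> bool"
  where "long_third G m y \<longleftrightarrow> perim y \<le> m \<and> cA y * cB y \<le> cC y \<and> 0 \<le> disc_of y \<and>
     (cC y - cA y * cB y)\<^sup>2 \<le> G * (((cA y)\<^sup>2 - 1) * ((cB y)\<^sup>2 - 1))"

text \<open>By sliding, all points are brought near \<open>x5\<close>: the third pair is centred, hence its height over the other
  two axes is bounded in terms of the distance between them, and then the other pairs are slid towards \<open>x5\<close>.\<close>

lemma long_third_bounded:
  assumes K: "inv_set K" "y \<in> K" and g: "1 < cA y" "1 < cB y" and G: "0 \<le> G" and y: "long_third G m y"
    and as: "disc_of y = 0 \<Longrightarrow> f5 y = 0 \<and> f6 y = 0"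
  defines "b \<equiv> cosh m" defines "M \<equiv> 2 * ((b + 1) / 2 * (1 + b\<^sup>2 * G)) * b"
  shows "\<exists>w\<in>K. cA w = cA y \<and> cB w = cB y \<and> cC w = cC y \<and> (\<forall>j. ch (w$5) (w$j) \<le> M)"
proof -
  have "1 * 1 < cA y * cB y" by (rule mult_strict_mono) (use g in auto)
  then have C1: "1 < cC y" using y by (simp add: long_third_def)
  have CB: "cA y \<le> cC y" "cB y \<le> cC y"
  proof -
    have "cA y * 1 \<le> cA y * cB y" "1 * cB y \<le> cA y * cB y" using g by (intro mult_mono; simp)+
    then show "cA y \<le> cC y" "cB y \<le> cC y" using y by (simp_all add: long_third_def)
  qed
  have Cb: "cC y \<le> b"
  proof -
    have "cosh (perim y) \<le> cosh m" by (subst cosh_real_nonneg_le_iff) (use y perim_nonneg[of y] in \<open>auto simp: long_third_def\<close>)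
    then show ?thesis using ch_le_perim(3)[of y] by (simp add: b_def)
  qed
  have b1: "1 \<le> b" by (simp add: b_def cosh_real_ge_1)
  \<comment> \<open>\<open>q\<close> bounds the right hand side of \<open>twist_near\<close> for centred pairs; the other point of a pair costs a factor \<open>2 * b\<close>.\<close>
  define q where "q = (b + 1) / 2 * (1 + b\<^sup>2 * G)"
  have "1 * 1 \<le> (b + 1) / 2 * (1 + b\<^sup>2 * G)" by (rule mult_mono) (use b1 G in auto)
  then have q1: "1 \<le> q" by (simp add: q_def)
  have M: "M = 2 * q * b" by (simp add: M_def q_def)
  obtain z where z: "z \<in> K" "twist 5 y z" "(f5 z)\<^sup>2 * ((cC y)\<^sup>2 - 1) \<le> (cC y)\<^sup>2 * disc_of y" "(f6 z)\<^sup>2 * ((cC y)\<^sup>2 - 1) \<le> (cC y)\<^sup>2 * disc_of y"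
    using twist_centred[OF K C1 _ as] y unfolding long_third_def by blast
  note same = twist5_same[OF z(2)]
  have "disc_of y \<le> (cC y - cA y * cB y)\<^sup>2" unfolding disc_alt using g by (simp add: one_le_power)
  also have "\<dots> \<le> G * (((cA y)\<^sup>2 - 1) * ((cB y)\<^sup>2 - 1))" using y by (simp add: long_third_def)
  finally have DG: "disc_of y \<le> G * (((cA y)\<^sup>2 - 1) * ((cB y)\<^sup>2 - 1))" .
  have bound: "(A + 1) / 2 + f\<^sup>2 / (2 * (A - 1)) \<le> q"
    if A: "1 < A" "A \<le> cC y" and B: "1 < B" "B \<le> cC y" and D: "disc_of y \<le> G * ((A\<^sup>2 - 1) * (B\<^sup>2 - 1))"
      and f: "f\<^sup>2 * ((cC y)\<^sup>2 - 1) \<le> (cC y)\<^sup>2 * disc_of y" for A B f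
  proof -
    have CC: "0 < (cC y)\<^sup>2 - 1" using C1 by (simp add: one_less_power)
    have "f\<^sup>2 * ((cC y)\<^sup>2 - 1) \<le> (cC y)\<^sup>2 * (G * ((A\<^sup>2 - 1) * (B\<^sup>2 - 1)))"
      by (rule order_trans[OF f mult_left_mono[OF D]]) simp
    also have "\<dots> = ((cC y)\<^sup>2 * G * (A\<^sup>2 - 1)) * (B\<^sup>2 - 1)" by (simp add: algebra_simps)
    also have "\<dots> \<le> ((cC y)\<^sup>2 * G * (A\<^sup>2 - 1)) * ((cC y)\<^sup>2 - 1)"
      using B G A by (intro mult_left_mono) (auto intro!: mult_nonneg_nonneg power_mono simp: one_le_power)
    finally have 1: "f\<^sup>2 \<le> (cC y)\<^sup>2 * G * (A\<^sup>2 - 1)" using CC by simp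
    have "(cC y)\<^sup>2 * G * (A\<^sup>2 - 1) \<le> b\<^sup>2 * G * (A\<^sup>2 - 1)"
      using Cb C1 G A by (intro mult_right_mono power_mono) (auto simp: one_le_power)
    with 1 have 2: "f\<^sup>2 \<le> b\<^sup>2 * G * (A\<^sup>2 - 1)" by simp
    have "f\<^sup>2 / (2 * (A - 1)) \<le> (b\<^sup>2 * G * (A\<^sup>2 - 1)) / (2 * (A - 1))"
      using 2 A by (intro divide_right_mono) auto
    also have "b\<^sup>2 * G * (A\<^sup>2 - 1) = (b\<^sup>2 * G * (A + 1)) * (A - 1)" by (simp add: power2_eq_square algebra_simps)
    also have "(b\<^sup>2 * G * (A + 1)) * (A - 1) / (2 * (A - 1)) = (b\<^sup>2 * G * (A + 1)) / 2"
      by (rule nonzero_mult_divide_mult_cancel_right) (use A in simp)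
    finally have "(A + 1) / 2 + f\<^sup>2 / (2 * (A - 1)) \<le> (A + 1) / 2 + (b\<^sup>2 * G * (A + 1)) / 2" by simp
    also have "\<dots> = (A + 1) / 2 * (1 + b\<^sup>2 * G)" by (simp add: field_simps)
    also have "\<dots> \<le> q" unfolding q_def using A Cb G by (intro mult_right_mono) auto
    finally show ?thesis .
  qed
  let ?p = "z$5"
  have gz: "1 < cA z" "1 < cB z" unfolding same using g .
  have q5: "(cA z + 1) / 2 + (vol ?p (z$1) (z$2))\<^sup>2 / (2 * (cA z - 1)) \<le> q"
    unfolding same(1) by (rule bound[OF g(1) CB(1) g(2) CB(2) DG z(3)])
  have "vol ?p (z$3) (z$4) = - f6 z"
    using negative_vol[OF inv_setD(1)[OF K(1) z(1)]] vol_swap(1)[of ?p "z$3" "z$4"] by simp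
  then have "(vol ?p (z$3) (z$4))\<^sup>2 * ((cC y)\<^sup>2 - 1) \<le> (cC y)\<^sup>2 * disc_of y" using z(4) by simp
  then have q6: "(cB z + 1) / 2 + (vol ?p (z$3) (z$4))\<^sup>2 / (2 * (cB z - 1)) \<le> q"
    unfolding same(2) by (rule bound[OF g(2) CB(2) g(1) CB(1), rotated]) (use DG in \<open>simp add: mult.commute\<close>)
  obtain x where x: "x \<in> K" "twist 1 z x" "(ch ?p (x$1))\<^sup>2 \<le> (cA z + 1) / 2 + (vol ?p (z$1) (z$2))\<^sup>2 / (2 * (cA z - 1))"
    using twist_near_135(1)[OF K(1) z(1) gz(1), of ?p] by blast
  have x1: "x$3 = z$3" "x$4 = z$4" "x$5 = z$5" "x$6 = z$6" "cA x = cA z" using twist_135(1)[OF x(2)] by blast+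
  have gx: "1 < cB x" unfolding x1 by (rule gz(2))
  obtain w where w: "w \<in> K" "twist 3 x w" "(ch ?p (w$3))\<^sup>2 \<le> (cB x + 1) / 2 + (vol ?p (x$3) (x$4))\<^sup>2 / (2 * (cB x - 1))"
    using twist_near_135(2)[OF K(1) x(1) gx, of ?p] by blast
  have w1: "w$1 = x$1" "w$2 = x$2" "w$5 = x$5" "w$6 = x$6" "cB w = cB x" using twist_135(2)[OF w(2)] by blast+
  have A: "cA w = cA y" unfolding w1 x1 same ..
  have B: "cB w = cB y" unfolding w1(5) x1 same ..
  have C: "cC w = cC y" unfolding w1 x1 same ..
  have p: "w$5 = ?p" by (simp only: w1 x1)
  have c1: "ch ?p (w$1) \<le> q" unfolding w1 by (rule sq_le_imp_le[OF order_trans[OF x(3) q5] ch_ge_1])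
  have c3: "ch ?p (w$3) \<le> q" by (rule sq_le_imp_le[OF order_trans[OF w(3)[unfolded x1] q6] ch_ge_1])
  have mm: "2 * s * t \<le> M" if "s \<le> q" "1 \<le> s" "t \<le> b" "1 \<le> t" for s t
    unfolding M using that q1 b1 by (intro mult_mono) auto
  have AB: "cA w \<le> b" "cB w \<le> b" using A B CB Cb by linarith+
  have c2: "ch ?p (w$2) \<le> M"
    by (rule order_trans[OF ch_le_mult[of ?p "w$2" "w$1"] mm[OF c1 ch_ge_1 AB(1) ch_ge_1]])
  have c4: "ch ?p (w$4) \<le> M"
    by (rule order_trans[OF ch_le_mult[of ?p "w$4" "w$3"] mm[OF c3 ch_ge_1 AB(2) ch_ge_1]])
  have qM: "q \<le> M" "b \<le> M" "1 \<le> M"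
    using mm[OF order_refl q1 b1 order_refl] mm[of 1 b] mm[of 1 1] q1 b1 by auto
  have c6: "ch ?p (w$6) \<le> M" using C Cb qM(2) unfolding p[symmetric] by linarith
  have c5: "ch ?p (w$5) \<le> M" unfolding p using qM by simp
  have "ch (w$5) (w$j) \<le> M" for j
    unfolding p using exhaust_6[of j] order_trans[OF c1 qM(1)] order_trans[OF c3 qM(1)] c2 c4 c5 c6 by metis
  then show ?thesis using w(1) A B C by blast
qed

text \<open>Rotating the indices by two makes any of the three pairs the third one.\<close>

lemma rotate_longest:
  assumes K: "inv_set K" "y \<in> K" and g: "1 < cA y" "1 < cB y" "1 < cC y" and D: "0 \<le> disc_of y"
  shows "\<exists>z\<in>{y, rot2 y, rot2 (rot2 y)}. z \<in> K \<and> perim z = perim y \<and> disc_of z = disc_of y \<and> cA z * cB z \<le> cC z"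
proof -
  have r: "rot2 y \<in> K" "rot2 (rot2 y) \<in> K" using K rot2_in by blast+
  have e: "perim (rot2 (rot2 y)) = perim y" "disc_of (rot2 (rot2 y)) = disc_of y" by (simp_all only: rot2_perim rot2_disc)
  consider "cA y * cB y \<le> cC y" | "cB y * cC y \<le> cA y" | "cC y * cA y \<le> cB y"
    using disc_nonneg_cases[OF g D] by blast
  then show ?thesis
  proof cases
    case 1 then show ?thesis using K by blast
  next
    case 2
    then have "cA (rot2 y) * cB (rot2 y) \<le> cC (rot2 y)" by (simp only: rot2_nths)
    then show ?thesis using r(1) rot2_perim rot2_disc by blast
  next
    case 3
    then have "cA (rot2 (rot2 y)) * cB (rot2 (rot2 y)) \<le> cC (rot2 (rot2 y))" by (simp only: rot2_nths)
    then show ?thesis using r(2) e by blast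
  qed
qed

text \<open>After centring, a flip shortens the third pair.  Either this gives a triangle, or again one of the pairs
  is too long, and the three cases are which one.  In each case the distance between the two shorter axes has
  not grown.\<close>

lemma flip_preserves_long_third:
  assumes K: "inv_set K" "z \<in> K" and g: "1 < cA z" "1 < cB z" "1 < cC z" and G: "0 \<le> G" and y: "long_third G m z"
    and as: "disc_of z = 0 \<Longrightarrow> f5 z = 0 \<and> f6 z = 0"
    and gK: "\<And>u. u \<in> K \<Longrightarrow> 1 < cC u"
  shows "\<exists>u\<in>K. perim u < perim z \<and> (disc_of u < 0 \<or> long_third G m u)"
proof -
  have z: "perim z \<le> m" "cA z * cB z \<le> cC z" "0 \<le> disc_of z" "(cC z - cA z * cB z)\<^sup>2 \<le> G * (((cA z)\<^sup>2 - 1) * ((cB z)\<^sup>2 - 1))"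
    using y by (simp_all add: long_third_def)
  obtain x where x: "x \<in> K" "twist 5 z x" and h: "((cC z)\<^sup>2 - 1) * (f5 x * f6 x) \<le> cC z * disc_of z" "disc_of z \<le> 2 * (cC z - 1) * (f5 x * f6 x)"
    using twist_centred[OF K g(3) z(3) as] by blast
  note same = twist5_same[OF x(2)]
  define u where "u = flip_third x"
  define A B C C' where ABC: "A = cA z" "B = cB z" "C = cC z" "C' = cC u"
  note m = flip_third_props[OF K(1) x(1), folded u_def]
  have uA: "cA u = A" "cB u = B" unfolding m ABC by (rule same)+
  have C'eq: "C' = 2 * A * B - C + 2 * (f5 x * f6 x)" unfolding ABC m(4) same(1-3) ..
  have g': "1 < A" "1 < B" "1 < C" "1 < C'" using g gK[OF m(1)] by (simp_all add: ABC)
  have C'C: "C' < C" unfolding C'eq using flip_shortens[OF g'(1,2)] z(2) h(1) by (simp add: ABC)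
  have F: "perim u < perim z" by (rule perim_less) (use uA C'C in \<open>simp_all add: ABC\<close>)
  have low: "(A - B)\<^sup>2 \<le> (C' - 1) * (C - 1)"
    using flip_lower_bound[OF g'(3)] h(2) unfolding C'eq by (simp add: ABC)
  show ?thesis
  proof (cases "disc A B C' < 0")
    case True
    then have "disc_of u < 0" by (simp add: uA ABC(4)[symmetric])
    then show ?thesis using m(1) F by blast
  next
    case False
    then have D': "0 \<le> disc A B C'" by simp
    have r: "rot2 u \<in> K" "rot2 (rot2 u) \<in> K" using m(1) rot2_in[OF K(1)] by blast+
    have zG: "(C - A * B)\<^sup>2 \<le> G * ((A\<^sup>2 - 1) * (B\<^sup>2 - 1))" and zC: "A * B \<le> C" using z by (simp_all add: ABC)
    have sq: "0 < A\<^sup>2 - 1" "0 < B\<^sup>2 - 1" "0 < C'\<^sup>2 - 1" using g' by (simp_all add: one_less_power)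
    consider "A * B \<le> C'" | "B * C' \<le> A" | "C' * A \<le> B"
      using disc_nonneg_cases[OF g'(1,2,4) D'] by blast
    then show ?thesis
    proof cases
      case 1
      have "(C' - A * B)\<^sup>2 \<le> (C - A * B)\<^sup>2" using 1 C'C by (intro power_mono) auto
      also note zG
      finally have "long_third G m u"
        using 1 F z(1) D' unfolding long_third_def uA ABC(4)[symmetric] by simp
      then show ?thesis using m(1) F by blast
    next
      case 2
      have "B * 1 \<le> B * C'" using g' by (intro mult_left_mono) auto
      then have BA: "B \<le> A" using 2 by simp
      have D2: "0 \<le> disc B C' A" using D' by (simp add: disc_def algebra_simps)
      have "(A - B * C')\<^sup>2 * (A\<^sup>2 - 1) \<le> (C - B * A)\<^sup>2 * (C'\<^sup>2 - 1)"
        by (rule excess_ratio_transfer[OF g'(2) BA _ g'(3,4) 2 D2]) (use zC low in \<open>simp_all add: mult.commute power2_commute\<close>)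
      also have "\<dots> \<le> (G * ((A\<^sup>2 - 1) * (B\<^sup>2 - 1))) * (C'\<^sup>2 - 1)"
        using zG sq by (intro mult_right_mono) (simp_all add: mult.commute)
      also have "\<dots> = (G * ((B\<^sup>2 - 1) * (C'\<^sup>2 - 1))) * (A\<^sup>2 - 1)" by (simp add: algebra_simps)
      finally have "(A - B * C')\<^sup>2 \<le> G * ((B\<^sup>2 - 1) * (C'\<^sup>2 - 1))" using sq(1) by simp
      moreover have "perim (rot2 u) = perim u" by (rule rot2_perim)
      ultimately have "long_third G m (rot2 u)"
        using 2 F z(1) D2 unfolding long_third_def rot2_nths uA ABC(4)[symmetric] by simp
      then show ?thesis using r(1) F rot2_perim[of u] by (intro bexI[of _ "rot2 u"]) simp_all
    next
      case 3
      have "1 * A \<le> C' * A" using g' by (intro mult_right_mono) auto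
      then have AB: "A \<le> B" using 3 by simp
      have D2: "0 \<le> disc A C' B" using D' by (simp add: disc_def algebra_simps)
      have "(B - A * C')\<^sup>2 * (B\<^sup>2 - 1) \<le> (C - A * B)\<^sup>2 * (C'\<^sup>2 - 1)"
        by (rule excess_ratio_transfer[OF g'(1) AB zC g'(3,4) _ D2 low]) (use 3 in \<open>simp add: mult.commute\<close>)
      also have "\<dots> \<le> (G * ((A\<^sup>2 - 1) * (B\<^sup>2 - 1))) * (C'\<^sup>2 - 1)"
        using zG sq by (intro mult_right_mono) simp_all
      also have "\<dots> = (G * ((C'\<^sup>2 - 1) * (A\<^sup>2 - 1))) * (B\<^sup>2 - 1)" by (simp add: algebra_simps)
      finally have "(B - C' * A)\<^sup>2 \<le> G * ((C'\<^sup>2 - 1) * (A\<^sup>2 - 1))" using sq(2) by (simp add: mult.commute)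
      moreover have "0 \<le> disc C' A B" using D' by (simp add: disc_def algebra_simps)
      moreover have FFe: "perim (rot2 (rot2 u)) = perim u" by (simp only: rot2_perim)
      ultimately have "long_third G m (rot2 (rot2 u))"
        using 3 F z(1) unfolding long_third_def rot2_nths uA ABC(4)[symmetric] by simp
      then show ?thesis using r(2) F FFe by (intro bexI[of _ "rot2 (rot2 u)"]) simp_all
    qed
  qed
qed

text \<open>A minimum of \<open>perim\<close> among the configurations with a long third pair exists by \<open>long_third_bounded\<close> and
  would contradict \<open>flip_preserves_long_third\<close>.\<close>

lemma triangle_below:
  assumes K: "inv_set K" "closed (coords ` K)" and nf: "\<forall>y\<in>K. \<not> collapsed y" and y0: "y0 \<in> K" "0 \<le> disc_of y0"
  shows "\<exists>y\<in>K. disc_of y < 0 \<and> perim y < perim y0"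
proof (rule ccontr)
  assume "\<not> (\<exists>y\<in>K. disc_of y < 0 \<and> perim y < perim y0)"
  then have N: "0 \<le> disc_of y" if "y \<in> K" "perim y < perim y0" for y using that by (meson not_le)
  note g = pairs_nondegenerate[OF K nf]
  define m where "m = perim y0"
  obtain y1 where y1: "y1 \<in> K" "perim y1 = perim y0" "disc_of y1 = disc_of y0" "cA y1 * cB y1 \<le> cC y1"
    using rotate_longest[OF K(1) y0(1) g[OF y0(1)] y0(2)] by blast
  define G where "G = (cC y1 - cA y1 * cB y1)\<^sup>2 / (((cA y1)\<^sup>2 - 1) * ((cB y1)\<^sup>2 - 1))"
  have X1: "0 < ((cA y1)\<^sup>2 - 1) * ((cB y1)\<^sup>2 - 1)" using g[OF y1(1)] by (simp add: one_less_power)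
  have G0: "0 \<le> G" unfolding G_def using X1 by (intro divide_nonneg_pos) auto
  have "G * (((cA y1)\<^sup>2 - 1) * ((cB y1)\<^sup>2 - 1)) = (cC y1 - cA y1 * cB y1)\<^sup>2"
    unfolding G_def by (rule nonzero_eq_divide_eq[THEN iffD1, OF _ refl]) (rule less_imp_neq[OF X1, symmetric])
  then have L1: "long_third G m y1" unfolding long_third_def using y1 y0(2) by (simp add: m_def)
  define S where "S = {y \<in> K. long_third G m y}"
  have "S \<noteq> {}" using L1 y1 by (auto simp: S_def)
  then obtain y where y: "\<And>n::nat. y n \<in> S" "(\<lambda>n. perim (y n)) \<longlonglongrightarrow> Inf (perim ` S)" "\<And>z. z \<in> S \<Longrightarrow> Inf (perim ` S) \<le> perim z"
    by (rule minimizing_sequence[of S perim]) (use perim_nonneg in auto)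
  have as: "f5 z = 0 \<and> f6 z = 0" if z: "z \<in> S" "disc_of z = 0" for z
  proof (rule ccontr)
    assume "\<not> (f5 z = 0 \<and> f6 z = 0)"
    then have f: "f5 z \<noteq> 0 \<or> f6 z \<noteq> 0" by blast
    have zz: "z \<in> K" "long_third G m z" using z by (simp_all add: S_def)
    have "\<exists>u\<in>K. disc_of u < 0 \<and> perim u < perim z"
      by (rule asymptotic_axes[OF K(1) zz(1) g(1,2)[OF zz(1)] z(2) _ f]) (use zz(2) in \<open>simp add: long_third_def\<close>)
    then obtain u where u: "u \<in> K" "disc_of u < 0" "perim u < perim z" by blast
    have "perim z \<le> perim y0" using zz(2) by (simp add: long_third_def m_def)
    then show False using N[OF u(1)] u by simp
  qed
  define M where "M = 2 * ((cosh m + 1) / 2 * (1 + (cosh m)\<^sup>2 * G)) * cosh m"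
  have "\<exists>w\<in>K. cA w = cA (y n) \<and> cB w = cB (y n) \<and> cC w = cC (y n) \<and> (\<forall>j. ch (w$5) (w$j) \<le> M)" for n
  proof -
    have yn: "y n \<in> K" "long_third G m (y n)" using y(1)[of n] by (simp_all add: S_def)
    show ?thesis unfolding M_def
      by (rule long_third_bounded[OF K(1) yn(1) g(1,2)[OF yn(1)] G0 yn(2) as[OF y(1)]])
  qed
  then obtain w where w: "\<And>n. w n \<in> K" "\<And>n. cA (w n) = cA (y n)" "\<And>n. cB (w n) = cB (y n)" "\<And>n. cC (w n) = cC (y n)"
    "\<And>n j. ch (w n $ 5) (w n $ j) \<le> M" by metis
  obtain z r where z: "z \<in> K" "strict_mono (r :: nat \<Rightarrow> nat)"
    "\<And>i j. (\<lambda>n. ch (w (r n) $ i) (w (r n) $ j)) \<longlonglongrightarrow> ch (z$i) (z$j)"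
    by (rule compactness[OF K, of w 5 M]) (use w in blast)+
  have wF: "perim (w n) = perim (y n)" for n by (rule perim_cong) (simp_all add: w)
  have wS: "long_third G m (w n)" for n using y(1)[of n] unfolding S_def long_third_def by (simp add: w wF)
  have "(\<lambda>n. perim (w (r n))) \<longlonglongrightarrow> Inf (perim ` S)"
    using LIMSEQ_subseq_LIMSEQ[OF y(2) z(2)] by (simp add: wF o_def)
  then have zF: "perim z = Inf (perim ` S)" using perim_tendsto[OF z(3)] LIMSEQ_unique by blast
  have zS: "long_third G m z"
  proof -
    have 1: "perim z \<le> m"
      by (rule LIMSEQ_le_const2[OF perim_tendsto[OF z(3)]]) (use wS in \<open>auto simp: long_third_def\<close>)
    have 2: "cA z * cB z \<le> cC z"
      by (rule LIMSEQ_le[OF tendsto_mult[OF z(3) z(3)] z(3)]) (use wS in \<open>auto simp: long_third_def\<close>)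
    have 3: "0 \<le> disc_of z"
    proof (rule LIMSEQ_le_const)
      show "(\<lambda>n. disc_of (w (r n))) \<longlonglongrightarrow> disc_of z" unfolding disc_def by (intro tendsto_intros z)
    qed (use wS in \<open>auto simp: long_third_def\<close>)
    have 4: "(cC z - cA z * cB z)\<^sup>2 \<le> G * (((cA z)\<^sup>2 - 1) * ((cB z)\<^sup>2 - 1))"
    proof (rule LIMSEQ_le)
      show "(\<lambda>n. (cC (w (r n)) - cA (w (r n)) * cB (w (r n)))\<^sup>2) \<longlonglongrightarrow> (cC z - cA z * cB z)\<^sup>2"
        by (intro tendsto_intros z)
      show "(\<lambda>n. G * (((cA (w (r n)))\<^sup>2 - 1) * ((cB (w (r n)))\<^sup>2 - 1))) \<longlonglongrightarrow> G * (((cA z)\<^sup>2 - 1) * ((cB z)\<^sup>2 - 1))"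
        by (intro tendsto_intros z)
    qed (use wS in \<open>auto simp: long_third_def\<close>)
    show ?thesis unfolding long_third_def using 1 2 3 4 by blast
  qed
  then have zinS: "z \<in> S" using z(1) by (simp add: S_def)
  obtain u where u: "u \<in> K" "perim u < perim z" "disc_of u < 0 \<or> long_third G m u"
    using flip_preserves_long_third[OF K(1) z(1) g[OF z(1)] G0 zS as[OF zinS] g(3)] by blast
  have "perim z \<le> perim y0" using zS by (simp add: long_third_def m_def)
  then have "0 \<le> disc_of u" using N[OF u(1)] u(2) by simp
  then have "u \<in> S" using u by (simp add: S_def)
  then show False using y(3) u(2) zF by fastforce
qed

section \<open>Pairs at the vertices of a triangle\<close>

lemma det_commutator:
  "det (A ** B - B ** A) = 4 * det A * det B - det B * (trace A)\<^sup>2 - det A * (trace B)\<^sup>2 - (trace (B ** A))\<^sup>2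
     + trace A * trace B * trace (B ** A)" for A B :: "real^2^2"
proof -
  define a b c d where A: "a = A$1$1" "b = A$1$2" "c = A$2$1" "d = A$2$2"
  define a' b' c' d' where B: "a' = B$1$1" "b' = B$1$2" "c' = B$2$1" "d' = B$2$2"
  show ?thesis
    by (simp add: det_2 trace2 matrix_matrix_mult_def sum_2 A[symmetric] B[symmetric]) algebra
qed

lemma scaled_det_trace: "det (c *\<^sub>R N) = c\<^sup>2 * det N" "trace ((c *\<^sub>R N) ** A) = c * trace (N ** A)" "trace (c *\<^sub>R N) = c * trace N" for N A :: "real^2^2"
  by (simp_all add: mat2 power2_eq_square algebra_simps)

lemma trace_commutator: "trace ((A ** B - B ** A) ** A) = 0" "trace ((A ** B - B ** A) ** B) = 0" "trace (A ** B - B ** A) = 0"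
  for A B :: "real^2^2"
  by (simp_all add: mat2 algebra_simps)

text \<open>The commutator of the two translations is traceless and orthogonal to both; its determinant is \<open>- 4 *
  disc\<close>, so it is a multiple of a half turn, around the intersection of the two axes.  The relation puts the
  third axis through the other two vertices.\<close>

lemma triangle_vertices:
  assumes y: "negative y" "disc_of y < 0"
  obtains Q1 Q2 Q3 where "J (y$2) ** J (y$1) = J Q2 ** J Q1" "J (y$4) ** J (y$3) = J Q3 ** J Q2" "J (y$6) ** J (y$5) = J Q1 ** J Q3"
proof -
  note s = J_sq J_sq_left matrix_mult_uminus matrix_mul_lid matrix_mul_rid minus_minus
  define A B where A: "A = - (J (y$2) ** J (y$1))" and B: "B = - (J (y$4) ** J (y$3))"
  have t: "trace A = 2 * cA y" "trace B = 2 * cB y"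
    unfolding A B ch_trace trace_minus trace_mul_sym[of "J (y$2)"] trace_mul_sym[of "J (y$4)"] by simp_all
  have "B ** A = J (y$4) ** J (y$3) ** J (y$2) ** J (y$1)" unfolding A B by (simp only: matrix_mult_uminus rassoc minus_minus)
  then have tBA: "trace (B ** A) = 2 * cC y" using negative_trace[OF y(1)] by simp
  have d: "det A = 1" "det B = 1" unfolding A B det_uminus_2 det_mul by simp_all
  define e where "e = sqrt (- 4 * disc_of y)"
  have e: "0 < e" "e\<^sup>2 = - 4 * disc_of y" using y(2) by (simp_all add: e_def)
  \<comment> \<open>The common perpendicular of the two axes in Minkowski space, normalised.\<close>
  define M where "M = (1 / e) *\<^sub>R (A ** B - B ** A)"
  have "det M = det (A ** B - B ** A) / e\<^sup>2" unfolding M_def scaled_det_trace by (simp add: power_divide)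
  also have "det (A ** B - B ** A) = - 4 * disc_of y"
    unfolding det_commutator d t tBA disc_def by (simp add: power2_eq_square algebra_simps)
  finally have dM: "det M = 1" using e y(2) by simp
  have tM: "trace M = 0" unfolding M_def scaled_det_trace trace_commutator by simp
  obtain Q2 where Q2: "J Q2 = M \<or> J Q2 = - M" using J_surj_pm[OF tM dM] by blast
  have "trace (M ** A) = 0" "trace (M ** B) = 0"
    unfolding M_def scaled_det_trace trace_commutator by simp_all
  then have tQ: "trace (J Q2 ** A) = 0" "trace (J Q2 ** B) = 0"
    using Q2 by (auto simp: trace_minus)
  have cpos: "0 < cA y" "0 < cB y" using ch_ge_1[of "y$1" "y$2"] ch_ge_1[of "y$3" "y$4"] by linarith+
  have "det (J Q2 ** A) = 1" by (simp add: det_mul d)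
  moreover have "trace (J Q2 ** (J Q2 ** A)) < 0" using cpos by (simp add: trace_minus t)
  ultimately obtain Q1 where Q1: "J Q1 = J Q2 ** A" using J_surj_ch[OF tQ(1)] by blast
  have "trace (B ** J Q2) = 0" using tQ(2) trace_mul_sym[of B "J Q2"] by simp
  moreover have "det (B ** J Q2) = 1" by (simp add: det_mul d)
  moreover have "trace (J Q2 ** (B ** J Q2)) < 0"
  proof -
    have "trace (J Q2 ** (B ** J Q2)) = trace (B ** J Q2 ** J Q2)" by (rule trace_mul_sym)
    also have "B ** J Q2 ** J Q2 = - B" by (simp only: rassoc s)
    finally show ?thesis using cpos by (simp add: trace_minus t)
  qed
  ultimately obtain Q3 where Q3: "J Q3 = B ** J Q2" using J_surj_ch by blast
  have 1: "J Q2 ** J Q1 = J (y$2) ** J (y$1)" unfolding Q1 by (simp only: s A)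
  have 2: "J Q3 ** J Q2 = J (y$4) ** J (y$3)" unfolding Q3 by (simp only: rassoc s B)
  have "J (y$6) ** (J (y$5) ** ((J (y$4) ** J (y$3)) ** (J (y$2) ** J (y$1)))) = - mat 1"
    using y(1) unfolding negative_iff by (simp only: rassoc)
  then have "J (y$6) ** (J (y$5) ** ((J Q3 ** J Q2) ** (J Q2 ** J Q1))) ** (J Q1 ** J Q3) = - mat 1 ** (J Q1 ** J Q3)"
    unfolding 1 2 by simp
  then have "- (J (y$6) ** J (y$5)) = - (J Q1 ** J Q3)"
    by (simp only: rassoc s)
  then have 3: "J (y$6) ** J (y$5) = J Q1 ** J Q3" by (simp only: neg_equal_iff_equal)
  show ?thesis by (rule that[OF 1[symmetric] 2[symmetric] 3])
qed

text \<open>Two pairs with the same product of half turns differ by a slide along the common axis.\<close>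

lemma pair_ch: "J b ** J a = J Q ** J P \<Longrightarrow> ch Q b = ch P a \<and> ch a b = ch P Q"
proof -
  note s = J_sq J_sq_left matrix_mult_uminus matrix_mul_lid matrix_mul_rid minus_minus
  assume e: "J b ** J a = J Q ** J P"
  then have "J Q ** ((J b ** J a) ** J a) = J Q ** ((J Q ** J P) ** J a)" by simp
  then have "- (J Q ** J b) = - (J P ** J a)" by (simp only: rassoc s)
  then have 1: "J Q ** J b = J P ** J a" by (simp only: neg_equal_iff_equal)
  have "trace (J a ** J b) = trace (J P ** J Q)"
    unfolding trace_mul_sym[of "J a"] trace_mul_sym[of "J P"] e ..
  then show ?thesis unfolding ch_trace 1 by simp
qed

text \<open>Both pairs lie on the axis of the translation \<open>J b ** J a\<close>.\<close>

lemma vol_axis: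
  assumes "J b ** J a = J Q ** J P"
  shows "vol Q a b = 0" "vol P a b = 0" "vol a P Q = 0" "vol b P Q = 0"
proof -
  note s = J_sq J_sq_left matrix_mult_uminus matrix_mul_lid matrix_mul_rid minus_minus
  show "vol Q a b = 0" unfolding vol_as_trace assms by (simp add: trace_minus)
  have "trace (J P ** (J Q ** J P)) = trace ((J Q ** J P) ** J P)" by (rule trace_mul_sym)
  then show "vol P a b = 0" unfolding vol_as_trace assms by (simp only: rassoc s trace_minus trace_J)
  have "trace (J a ** (J b ** J a)) = trace ((J b ** J a) ** J a)" by (rule trace_mul_sym)
  then show "vol a P Q = 0" unfolding vol_as_trace assms[symmetric] by (simp only: rassoc s trace_minus trace_J)
  show "vol b P Q = 0" unfolding vol_as_trace assms[symmetric] by (simp add: trace_minus)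
qed

lemma disc_neg_gt_1:
  assumes "disc A B C < 0" "1 \<le> A" "1 \<le> B" shows "1 < A \<and> 1 < B"
proof (rule ccontr)
  assume "\<not> (1 < A \<and> 1 < B)"
  then have "A = 1 \<or> B = 1" using assms by auto
  then have "0 \<le> disc A B C" unfolding disc_alt by auto
  then show False using assms by simp
qed

lemma disc_neg_pairs: "disc_of y < 0 \<Longrightarrow> 1 < cA y \<and> 1 < cB y \<and> 1 < cC y"
  using disc_neg_gt_1[of "cA y" "cB y" "cC y"] disc_neg_gt_1[of "cB y" "cC y" "cA y"]
    ch_ge_1[of "y$1" "y$2"] ch_ge_1[of "y$3" "y$4"] ch_ge_1[of "y$5" "y$6"] by (simp only: disc_cycle simp_thms)

text \<open>The last point and the first one are not compared; their distance is bounded by the triangle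
  inequality.\<close>

definition links :: "real \<Rightarrow> config \<Rightarrow> bool"
  where "links e y \<longleftrightarrow> hdist (y$1) (y$2) \<le> e \<and> hdist (y$2) (y$3) \<le> e \<and> hdist (y$3) (y$4) \<le> e \<and>
     hdist (y$4) (y$5) \<le> e \<and> hdist (y$5) (y$6) \<le> e"

lemma links_mono: "links e y \<Longrightarrow> e \<le> e' \<Longrightarrow> links e' y"
  by (auto simp: links_def)

lemma links_from_first:
  assumes "links e y" shows "hdist (y$1) (y$j) \<le> 5 * e"
proof -
  let ?d = "\<lambda>i j. hdist (y$i) (y$j)"
  have l: "?d 1 2 \<le> e" "?d 2 3 \<le> e" "?d 3 4 \<le> e" "?d 4 5 \<le> e" "?d 5 6 \<le> e" using assms by (auto simp: links_def)
  have e: "0 \<le> e" using l(1) hdist_nonneg[of "y$1" "y$2"] by linarith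
  have "?d 1 1 = 0" by (simp add: hdist_eq)
  moreover have "?d 1 3 \<le> 2 * e" using hdist_triangle[of "y$1" "y$3" "y$2"] l by linarith
  moreover from this have "?d 1 4 \<le> 3 * e" using hdist_triangle[of "y$1" "y$4" "y$3"] l by linarith
  moreover from this have "?d 1 5 \<le> 4 * e" using hdist_triangle[of "y$1" "y$5" "y$4"] l by linarith
  moreover from this have "?d 1 6 \<le> 5 * e" using hdist_triangle[of "y$1" "y$6" "y$5"] l by linarith
  ultimately show ?thesis using l(1) e exhaust_6[of j] by (elim disjE; hypsubst) linarith+
qed

text \<open>The pairs lie on the sides of the triangle \<open>Q1\<close>, \<open>Q2\<close>, \<open>Q3\<close>; the points \<open>x2\<close> and \<open>x3\<close> are within half of
  their pair distances from \<open>Q2\<close>, and \<open>x5\<close> from \<open>Q3\<close>.\<close>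

definition placed :: "config \<Rightarrow> h2 \<Rightarrow> h2 \<Rightarrow> h2 \<Rightarrow> bool"
  where "placed z Q1 Q2 Q3 \<longleftrightarrow> J (z$2) ** J (z$1) = J Q2 ** J Q1 \<and> J (z$4) ** J (z$3) = J Q3 ** J Q2 \<and> J (z$6) ** J (z$5) = J Q1 ** J Q3
    \<and> (ch Q2 (z$2))\<^sup>2 \<le> (cA z + 1) / 2 \<and> (ch Q2 (z$3))\<^sup>2 \<le> (cB z + 1) / 2 \<and> (ch Q3 (z$5))\<^sup>2 \<le> (cC z + 1) / 2"

lemma place_near_vertices:
  assumes K: "inv_set K" "y \<in> K" and D: "disc_of y < 0"
  shows "\<exists>z\<in>K. cA z = cA y \<and> cB z = cB y \<and> cC z = cC y \<and> (\<exists>Q1 Q2 Q3. placed z Q1 Q2 Q3)"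
proof -
  obtain Q1 Q2 Q3 where Q: "J (y$2) ** J (y$1) = J Q2 ** J Q1" "J (y$4) ** J (y$3) = J Q3 ** J Q2" "J (y$6) ** J (y$5) = J Q1 ** J Q3"
    by (rule triangle_vertices[OF inv_setD(1)[OF K] D])
  have g: "1 < cA y" "1 < cB y" "1 < cC y" using disc_neg_pairs[OF D] by blast+
  obtain x where x: "x \<in> K" "twist 1 y x" "(ch Q2 (x$2))\<^sup>2 \<le> (cA y + 1) / 2"
    using twist_near_135(4)[OF K g(1), of Q2] unfolding vol_axis(1)[OF Q(1)] by auto
  have x1: "x$3 = y$3" "x$4 = y$4" "x$5 = y$5" "x$6 = y$6" "cA x = cA y" "J (x$2) ** J (x$1) = J Q2 ** J Q1"
    using twist_135(1)[OF x(2)] Q(1) by metis+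
  have gx: "1 < cB x" unfolding x1 by (rule g)
  have Qx: "J (x$4) ** J (x$3) = J Q3 ** J Q2" unfolding x1 by (rule Q)
  obtain w where w: "w \<in> K" "twist 3 x w" "(ch Q2 (w$3))\<^sup>2 \<le> (cB x + 1) / 2"
    using twist_near_135(2)[OF K(1) x(1) gx, of Q2] unfolding vol_axis(2)[OF Qx] by auto
  have w1: "w$1 = x$1" "w$2 = x$2" "w$5 = x$5" "w$6 = x$6" "cB w = cB x" "J (w$4) ** J (w$3) = J Q3 ** J Q2"
    using twist_135(2)[OF w(2)] Qx by metis+
  have gw: "1 < cC w" unfolding w1 x1 by (rule g)
  have Qw: "J (w$6) ** J (w$5) = J Q1 ** J Q3" unfolding w1 x1 by (rule Q)
  obtain v where v: "v \<in> K" "twist 5 w v" "(ch Q3 (v$5))\<^sup>2 \<le> (cC w + 1) / 2"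
    using twist_near_135(3)[OF K(1) w(1) gw, of Q3] unfolding vol_axis(2)[OF Qw] by auto
  have v1: "v$1 = w$1" "v$2 = w$2" "v$3 = w$3" "v$4 = w$4" "cC v = cC w" "J (v$6) ** J (v$5) = J Q1 ** J Q3"
    using twist_135(3)[OF v(2)] Qw by metis+
  have c: "cA v = cA y" "cB v = cB y" "cC v = cC y"
    unfolding v1 w1(1-5) x1(1-5) by (rule refl)+
  have "placed v Q1 Q2 Q3"
    unfolding placed_def
  proof (intro conjI)
    show "J (v$2) ** J (v$1) = J Q2 ** J Q1" unfolding v1 w1 by (rule x1(6))
    show "J (v$4) ** J (v$3) = J Q3 ** J Q2" unfolding v1 by (rule w1(6))
    show "J (v$6) ** J (v$5) = J Q1 ** J Q3" by (rule v1(6))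
    show "(ch Q2 (v$2))\<^sup>2 \<le> (cA v + 1) / 2" unfolding c unfolding v1 w1 by (rule x(3))
    show "(ch Q2 (v$3))\<^sup>2 \<le> (cB v + 1) / 2" unfolding c using w(3) unfolding v1 x1 .
    show "(ch Q3 (v$5))\<^sup>2 \<le> (cC v + 1) / 2" using v(3) unfolding v1(5) .
  qed
  then show ?thesis using v(1) c by blast
qed

lemma hdist_half: "(ch Q b)\<^sup>2 \<le> (ch x y + 1) / 2 \<Longrightarrow> hdist Q b \<le> hdist x y / 2"
proof -
  assume "(ch Q b)\<^sup>2 \<le> (ch x y + 1) / 2"
  then have "(cosh (hdist Q b))\<^sup>2 \<le> (cosh (hdist x y / 2))\<^sup>2" by (simp add: cosh_half_sq)
  then have "cosh (hdist Q b) \<le> cosh (hdist x y / 2)" by (rule power2_le_imp_le) simp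
  then show ?thesis by (subst (asm) cosh_real_nonneg_le_iff) auto
qed

text \<open>As a pair is a translate of a side, \<open>x1\<close> is as far from \<open>Q1\<close> as \<open>x2\<close> is from \<open>Q2\<close>, and likewise for the
  other sides.\<close>

lemma placed_hdist:
  assumes "placed z Q1 Q2 Q3"
  shows "hdist (z$2) Q2 \<le> hdist (z$1) (z$2) / 2" "hdist Q2 (z$3) \<le> hdist (z$3) (z$4) / 2"
    "hdist (z$4) Q3 \<le> hdist (z$3) (z$4) / 2" "hdist Q3 (z$5) \<le> hdist (z$5) (z$6) / 2"
    "hdist (z$6) Q1 \<le> hdist (z$5) (z$6) / 2" "hdist Q1 (z$1) \<le> hdist (z$1) (z$2) / 2"
proof -
  have p: "J (z$2) ** J (z$1) = J Q2 ** J Q1" "J (z$4) ** J (z$3) = J Q3 ** J Q2" "J (z$6) ** J (z$5) = J Q1 ** J Q3"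
    "(ch Q2 (z$2))\<^sup>2 \<le> (cA z + 1) / 2" "(ch Q2 (z$3))\<^sup>2 \<le> (cB z + 1) / 2" "(ch Q3 (z$5))\<^sup>2 \<le> (cC z + 1) / 2"
    using assms unfolding placed_def by blast+
  have e: "ch Q2 (z$2) = ch Q1 (z$1)" "ch Q3 (z$4) = ch Q2 (z$3)" "ch Q1 (z$6) = ch Q3 (z$5)"
    using pair_ch[OF p(1)] pair_ch[OF p(2)] pair_ch[OF p(3)] by blast+
  note h = hdist_half[OF p(4)] hdist_half[OF p(5)] hdist_half[OF p(6)]
  show "hdist (z$2) Q2 \<le> hdist (z$1) (z$2) / 2" "hdist Q2 (z$3) \<le> hdist (z$3) (z$4) / 2"
    "hdist Q3 (z$5) \<le> hdist (z$5) (z$6) / 2" using h by (simp_all only: hdist_sym[of "z$2"])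
  have h2: "hdist Q1 (z$1) = hdist Q2 (z$2)" "hdist Q3 (z$4) = hdist Q2 (z$3)" "hdist Q1 (z$6) = hdist Q3 (z$5)"
    unfolding hdist_eq e by (rule refl)+
  show "hdist Q1 (z$1) \<le> hdist (z$1) (z$2) / 2" "hdist (z$4) Q3 \<le> hdist (z$3) (z$4) / 2" "hdist (z$6) Q1 \<le> hdist (z$5) (z$6) / 2"
    unfolding hdist_sym[of "z$4"] hdist_sym[of "z$6" Q1] h2 by (rule h)+
qed

lemma placed_links:
  assumes "placed z Q1 Q2 Q3" shows "links (perim z) z"
proof -
  note p = placed_hdist[OF assms]
  note n = hdist_nonneg[of "z$1" "z$2"] hdist_nonneg[of "z$3" "z$4"] hdist_nonneg[of "z$5" "z$6"]
  have "hdist (z$2) (z$3) \<le> perim z" using hdist_triangle[of "z$2" "z$3" Q2] p n unfolding perim_def by linarith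
  moreover have "hdist (z$4) (z$5) \<le> perim z" using hdist_triangle[of "z$4" "z$5" Q3] p n unfolding perim_def by linarith
  moreover have "hdist (z$1) (z$2) \<le> perim z" "hdist (z$3) (z$4) \<le> perim z" "hdist (z$5) (z$6) \<le> perim z" using n unfolding perim_def by linarith+
  ultimately show ?thesis by (simp add: links_def)
qed

text \<open>The new pairs 23, 45, 61 are joined through the vertices by paths of total length at most \<open>perim\<close>.  At
  \<open>Q2\<close> the path is not straight, as the triangle is not degenerate; if one of the points is \<open>Q2\<close> itself, half
  a side is saved.\<close>

lemma rot_shortens_placed:
  assumes z: "placed z Q1 Q2 Q3" and D: "disc_of z < 0"
  shows "perim (rot z) < perim z"
proof -
  have p: "J (z$2) ** J (z$1) = J Q2 ** J Q1" "J (z$4) ** J (z$3) = J Q3 ** J Q2" "J (z$6) ** J (z$5) = J Q1 ** J Q3"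
    using z unfolding placed_def by blast+
  have g: "1 < cA z" "1 < cB z" using disc_neg_pairs[OF D] by blast+
  have cQ: "ch Q1 Q2 = cA z" "ch Q2 Q3 = cB z" "ch Q3 Q1 = cC z"
    using pair_ch[OF p(1)] pair_ch[OF p(2)] pair_ch[OF p(3)] by simp_all
  have "(vol Q1 Q2 Q3)\<^sup>2 = - disc_of z" unfolding vol_gram ch_sym[of Q1 Q3] cQ disc_def by simp
  then have v: "vol Q1 Q2 Q3 \<noteq> 0" using D by auto
  note ph = placed_hdist[OF z]
  have pos: "0 < hdist (z$1) (z$2)" "0 < hdist (z$3) (z$4)" using g by (auto intro!: hdist_pos)
  have "hdist (z$2) (z$3) < hdist (z$1) (z$2) / 2 + hdist (z$3) (z$4) / 2"
  proof (cases "z$2 = Q2 \<or> z$3 = Q2")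
    case True
    then show ?thesis using ph(1,2) pos by auto
  next
    case False
    have Q12: "Q1 \<noteq> Q2" "Q2 \<noteq> Q3" using cQ g by auto
    have unit: "m = 1" if "J x = m *\<^sub>R J q" for m x q
    proof -
      have "J x = m *\<^sub>R J q + 0 *\<^sub>R J q" using that by simp
      note l = lin_comb(1)[OF this]
      have "ch q x = m" using l[of q] by simp
      moreover have "1 = m * ch x q" using l[of x] by simp
      ultimately have "m * m = 1" by (simp add: ch_sym)
      moreover have "1 \<le> m" using \<open>ch q x = m\<close> ch_ge_1[of q x] by simp
      ultimately show "m = 1" using mult_left_mono[of 1 m m] by simp
    qed
    obtain l m where lm: "J (z$2) = l *\<^sub>R J Q1 + m *\<^sub>R J Q2" by (rule coplanar_span[OF Q12(1) vol_axis(4)[OF p(1)]])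
    obtain l' m' where lm': "J (z$3) = l' *\<^sub>R J Q2 + m' *\<^sub>R J Q3" by (rule coplanar_span[OF Q12(2) vol_axis(3)[OF p(2)]])
    have "l \<noteq> 0"
    proof
      assume "l = 0"
      then have "J (z$2) = m *\<^sub>R J Q2" using lm by simp
      then have "J (z$2) = J Q2" using unit by fastforce
      then show False using False by (simp add: J_inject)
    qed
    moreover have "m' \<noteq> 0"
    proof
      assume "m' = 0"
      then have "J (z$3) = l' *\<^sub>R J Q2" using lm' by simp
      then have "J (z$3) = J Q2" using unit by fastforce
      then show False using False by (simp add: J_inject)
    qed
    moreover have "vol (z$2) Q2 (z$3) = l * (m' * vol Q1 Q2 Q3)"
      unfolding lin_comb(3)[OF lm] lin_comb(2)[OF lm'] by simp
    ultimately have "vol (z$2) Q2 (z$3) \<noteq> 0" using v by simp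
    then show ?thesis using hdist_triangle_strict[of "z$2" Q2 "z$3"] ph(1,2) by linarith
  qed
  moreover have "hdist (z$4) (z$5) \<le> hdist (z$3) (z$4) / 2 + hdist (z$5) (z$6) / 2"
    using hdist_triangle[of "z$4" "z$5" Q3] ph by linarith
  moreover have "hdist (z$6) (z$1) \<le> hdist (z$5) (z$6) / 2 + hdist (z$1) (z$2) / 2"
    using hdist_triangle[of "z$6" "z$1" Q1] ph by linarith
  ultimately show ?thesis unfolding perim_def rot_nths by linarith
qed

lemma hdist_le_imp_ch: "hdist x y \<le> R \<Longrightarrow> ch x y \<le> cosh R"
  using cosh_real_nonneg_le_iff[of "hdist x y" R] hdist_nonneg[of x y] by simp

text \<open>Otherwise \<open>perim\<close> attains its minimum on the configurations with a triangle, and either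
  \<open>rot_shortens_placed\<close> or \<open>triangle_below\<close> goes below it.\<close>

theorem closed_inv_set_collapses:
  assumes K: "inv_set K" "closed (coords ` K)" and ne: "K \<noteq> {}"
  shows "\<exists>y\<in>K. collapsed y"
proof (rule ccontr)
  assume "\<not> (\<exists>y\<in>K. collapsed y)"
  then have nf: "\<forall>y\<in>K. \<not> collapsed y" by blast
  note tb = triangle_below[OF K nf]
  define T where "T = {y \<in> K. disc_of y < 0}"
  have "T \<noteq> {}"
  proof -
    obtain y where y: "y \<in> K" using ne by blast
    show ?thesis using tb[OF y] y by (cases "disc_of y < 0") (auto simp: T_def)
  qed
  then obtain y where y: "\<And>n::nat. y n \<in> T" "(\<lambda>n. perim (y n)) \<longlonglongrightarrow> Inf (perim ` T)" "\<And>n. perim (y n) \<le> Inf (perim ` T) + 1"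
    "\<And>z. z \<in> T \<Longrightarrow> Inf (perim ` T) \<le> perim z"
    by (rule minimizing_sequence[of T perim]) (use perim_nonneg in auto)
  have "\<exists>w\<in>K. cA w = cA (y n) \<and> cB w = cB (y n) \<and> cC w = cC (y n) \<and> (\<exists>Q1 Q2 Q3. placed w Q1 Q2 Q3)" for n
    by (rule place_near_vertices[OF K(1)]) (use y(1)[of n] in \<open>simp_all add: T_def\<close>)
  then obtain w where w: "\<And>n. w n \<in> K" "\<And>n. cA (w n) = cA (y n)" "\<And>n. cB (w n) = cB (y n)" "\<And>n. cC (w n) = cC (y n)"
    "\<And>n. \<exists>Q1 Q2 Q3. placed (w n) Q1 Q2 Q3" by metis
  have wF: "perim (w n) = perim (y n)" for n by (rule perim_cong) (simp_all add: w)
  define R where "R = Inf (perim ` T) + 1"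
  have wb: "ch (w n $ 1) (w n $ j) \<le> cosh (5 * R)" for n j
  proof (rule hdist_le_imp_ch)
    obtain Q1 Q2 Q3 where "placed (w n) Q1 Q2 Q3" using w(5) by blast
    then have "links (perim (w n)) (w n)" by (rule placed_links)
    moreover have "perim (w n) \<le> R" using y(3)[of n] by (simp add: wF R_def)
    ultimately show "hdist (w n $ 1) (w n $ j) \<le> 5 * R" by (rule links_from_first[OF links_mono])
  qed
  obtain z r where z: "z \<in> K" "strict_mono (r :: nat \<Rightarrow> nat)"
    "\<And>i j. (\<lambda>n. ch (w (r n) $ i) (w (r n) $ j)) \<longlonglongrightarrow> ch (z$i) (z$j)"
    by (rule compactness[OF K, of w 1 "cosh (5 * R)"]) (use w(1) wb in blast)+
  have "(\<lambda>n. perim (w (r n))) \<longlonglongrightarrow> Inf (perim ` T)"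
    using LIMSEQ_subseq_LIMSEQ[OF y(2) z(2)] by (simp add: wF o_def)
  then have zF: "perim z = Inf (perim ` T)" using perim_tendsto[OF z(3)] LIMSEQ_unique by blast
  have no: "\<not> perim u < perim z" if uK: "u \<in> K" for u
  proof
    assume u: "perim u < perim z"
    show False
    proof (cases "disc_of u < 0")
      case True
      then show False using y(4)[of u] uK u zF by (simp add: T_def)
    next
      case False
      then obtain v where "v \<in> K" "disc_of v < 0" "perim v < perim u" using tb[OF uK] by force
      then show False using y(4)[of v] u zF by (simp add: T_def)
    qed
  qed
  show False
  proof (cases "disc_of z < 0")
    case True
    obtain x Q1 Q2 Q3 where x: "x \<in> K" "cA x = cA z" "cB x = cB z" "cC x = cC z" "placed x Q1 Q2 Q3"
      using place_near_vertices[OF K(1) z(1) True] by blast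
    have "disc_of x < 0" using True by (simp add: x)
    then have "perim (rot x) < perim x" by (rule rot_shortens_placed[OF x(5)])
    also have "perim x = perim z" by (rule perim_cong) (simp_all add: x)
    finally show False using no[OF inv_setD(6)[OF K(1) x(1)]] by blast
  next
    case False
    then show False using tb[OF z(1)] no by force
  qed
qed

section \<open>Short chains near a collapsed configuration\<close>

text \<open>Place the pairs at the vertices of the triangle.\<close>

lemma triangle_links:
  assumes K: "inv_set K" "y \<in> K" and D: "disc_of y < 0"
  shows "\<exists>z\<in>K. links (perim y) z"
proof -
  obtain z Q1 Q2 Q3 where z: "z \<in> K" "cA z = cA y" "cB z = cB y" "cC z = cC y" "placed z Q1 Q2 Q3"
    using place_near_vertices[OF K D] by blast
  have "perim z = perim y" by (rule perim_cong) (simp_all add: z)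
  then have "links (perim y) z" using placed_links[OF z(5)] by simp
  then show ?thesis using z(1) by blast
qed

text \<open>For \<open>disc = 0\<close> and zero heights all axes pass through \<open>x5\<close>, and the first two pairs are slid there.\<close>

lemma collinear_links:
  assumes K: "inv_set K" "y \<in> K" and g: "1 < cA y" "1 < cB y" and f: "f5 y = 0" "f6 y = 0"
  shows "\<exists>z\<in>K. links (2 * perim y) z"
proof -
  let ?p = "y$5"
  obtain x where x: "x \<in> K" "twist 1 y x" "(ch ?p (x$2))\<^sup>2 \<le> (cA y + 1) / 2"
    using twist_near_135(4)[OF K g(1), of ?p] unfolding f by auto
  have x1: "x$3 = y$3" "x$4 = y$4" "x$5 = y$5" "x$6 = y$6" "cA x = cA y" using twist_135(1)[OF x(2)] by blast+
  have gx: "1 < cB x" unfolding x1 by (rule g)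
  have "vol ?p (y$4) (y$3) = 0" using negative_vol[OF inv_setD(1)[OF K]] f by simp
  then have v: "vol ?p (x$3) (x$4) = 0" unfolding x1 using vol_swap(1)[of ?p "y$3" "y$4"] by simp
  obtain w where w: "w \<in> K" "twist 3 x w" "(ch ?p (w$3))\<^sup>2 \<le> (cB x + 1) / 2"
    using twist_near_135(2)[OF K(1) x(1) gx, of ?p] unfolding v by auto
  have w1: "w$1 = x$1" "w$2 = x$2" "w$5 = x$5" "w$6 = x$6" "cB w = cB x" using twist_135(2)[OF w(2)] by blast+
  have h1: "hdist (w$1) (w$2) = hdist (y$1) (y$2)" unfolding w1 hdist_eq x1 ..
  have h3: "hdist (w$3) (w$4) = hdist (y$3) (y$4)" unfolding hdist_eq w1(5) x1 ..
  have h5: "hdist (w$5) (w$6) = hdist (y$5) (y$6)" unfolding w1 x1 ..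
  have p: "w$5 = ?p" unfolding w1 x1 ..
  have "(ch ?p (w$2))\<^sup>2 \<le> (cA y + 1) / 2" unfolding w1 by (rule x(3))
  from hdist_half[OF this] have n2: "hdist ?p (w$2) \<le> hdist (y$1) (y$2) / 2" .
  have "(ch ?p (w$3))\<^sup>2 \<le> (cB y + 1) / 2" using w(3) unfolding x1 .
  from hdist_half[OF this] have n3: "hdist ?p (w$3) \<le> hdist (y$3) (y$4) / 2" .
  note n = hdist_nonneg[of "y$1" "y$2"] hdist_nonneg[of "y$3" "y$4"] hdist_nonneg[of "y$5" "y$6"]
  have "hdist (w$2) (w$3) \<le> 2 * perim y"
    using hdist_triangle[of "w$2" "w$3" ?p] hdist_sym[of "w$2" ?p] n2 n3 n unfolding perim_def distrib_left by linarith
  moreover have "hdist (w$4) (w$5) \<le> 2 * perim y"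
    using hdist_triangle[of "w$4" "w$5" "w$3"] hdist_sym[of "w$4" "w$3"] hdist_sym[of "w$3" ?p] h3 n3 n unfolding perim_def p distrib_left by linarith
  moreover have "hdist (w$1) (w$2) \<le> 2 * perim y" "hdist (w$3) (w$4) \<le> 2 * perim y" "hdist (w$5) (w$6) \<le> 2 * perim y"
    unfolding h1 h3 h5 using n unfolding perim_def distrib_left by linarith+
  ultimately show ?thesis using w(1) unfolding links_def by blast
qed

text \<open>The third pair is slid into the window where a flip gives a triangle.  Its step is the pair distance;
  \<open>G\<close> bounds the hyperbolic cosine of the distance between the first two axes, and the smaller the pair
  distance, the larger this bound may be.\<close>

lemma links_from_excess:
  assumes K: "inv_set K" "y \<in> K" and g: "1 < cA y" "1 < cB y" "cA y * cB y \<le> cC y" and D: "0 \<le> disc_of y"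
    and G: "cC y - cA y * cB y \<le> G * sqrt (((cA y)\<^sup>2 - 1) * ((cB y)\<^sup>2 - 1))" "exp (2 * hdist (y$5) (y$6)) * (G - 1) < G + 1"
  shows "\<exists>z\<in>K. links (2 * perim y) z"
proof (cases "disc_of y = 0")
  case True
  show ?thesis
  proof (cases "f5 y = 0 \<and> f6 y = 0")
    case True
    then show ?thesis using collinear_links[OF K g(1,2)] by blast
  next
    case False
    then obtain z where z: "z \<in> K" "disc_of z < 0" "perim z < perim y" using asymptotic_axes[OF K g(1,2) True g(3)] by blast
    obtain u where u: "u \<in> K" "links (perim z) u" using triangle_links[OF K(1) z(1,2)] by blast
    have "perim z \<le> 2 * perim y" using z(3) perim_nonneg[of y] by linarith
    then show ?thesis using links_mono[OF u(2)] u(1) by blast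
  qed
next
  case False
  then have D0: "0 < disc_of y" using D by simp
  let ?C = "cC y"
  let ?X = "sqrt (((cA y)\<^sup>2 - 1) * ((cB y)\<^sup>2 - 1))"
  have X: "0 < ?X" using g by (simp add: one_less_power)
  have X2: "?X\<^sup>2 = ((cA y)\<^sup>2 - 1) * ((cB y)\<^sup>2 - 1)" using g by (simp add: one_le_power)
  have "1 * 1 < cA y * cB y" by (rule mult_strict_mono) (use g in auto)
  then have C1: "1 < ?C" using g(3) by simp
  have "?X\<^sup>2 < (?C - cA y * cB y)\<^sup>2" using D0 unfolding X2 disc_alt by simp
  then have XE: "?X < ?C - cA y * cB y" by (rule power2_less_imp_less) (use g(3) in simp)
  obtain a b and e :: real where e: "e = 1 \<or> e = -1" and v: "\<And>p. vol p a b = e * vol p (y$1) (y$2)" and vpos: "0 < vol (y$5) a b"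
    and vI: "disc_of y = 2 * ?C * vol (y$5) a b * vol (y$6) a b - (vol (y$5) a b)\<^sup>2 - (vol (y$6) a b)\<^sup>2"
    by (rule signed_vol[OF inv_setD(1)[OF K] C1 D0]) (assumption | rule that)+
  have i: "5 + 1 = (6::6)" by simp
  have I: "disc_of y = 2 * ?C * phi_vol a b (J (y$5)) * phi_vol a b (J (y$6)) - (phi_vol a b (J (y$5)))\<^sup>2 - (phi_vol a b (J (y$6)))\<^sup>2"
    unfolding phi_simps by (rule vI)
  have pos: "0 < phi_vol a b (J (y$5))" unfolding phi_simps by (rule vpos)
  have "\<exists>c k s. 0 < c \<and> ?C = cosh c \<and> 0 < k \<and> k\<^sup>2 * (?C\<^sup>2 - 1) = disc_of y \<and>
    (\<forall>n::int. \<exists>z\<in>K. twist 5 y z \<and> phi_vol a b (J (z$5)) = k * cosh (c * (s + real_of_int n)) \<and>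
       phi_vol a b (J (z$(5+1))) = k * cosh (c * (s + real_of_int n + 1)))"
  proof (rule twist_cosh[of K y "phi_vol a b" ?C 5 "disc_of y", OF K linear_phi(2) _ C1 pos])
    show "?C = ch (y$5) (y$(5+1))" unfolding i ..
    show "disc_of y = 2 * ?C * phi_vol a b (J (y$5)) * phi_vol a b (J (y$(5+1))) - (phi_vol a b (J (y$5)))\<^sup>2 - (phi_vol a b (J (y$(5+1))))\<^sup>2"
      unfolding i by (rule I)
    show "0 < disc_of y" by (rule D0)
  qed blast
  then obtain c k s where c: "0 < c" "?C = cosh c" and k: "0 < k" "k\<^sup>2 * (?C\<^sup>2 - 1) = disc_of y"
    and ex: "\<And>n::int. \<exists>z\<in>K. twist 5 y z \<and> vol (z$5) a b = k * cosh (c * (s + real_of_int n)) \<and>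
       vol (z$6) a b = k * cosh (c * (s + real_of_int n + 1))" unfolding i phi_simps by blast
  define m where "m = - \<lceil>s\<rceil>"
  have m: "-1 \<le> s + real_of_int m" "s + real_of_int m \<le> 0" unfolding m_def by (simp_all) linarith+
  have "cosh (hdist (y$5) (y$6)) = cosh c" using c by simp
  then have hc: "hdist (y$5) (y$6) = c"
    using cosh_real_nonneg_le_iff[of "hdist (y$5) (y$6)" c] cosh_real_nonneg_le_iff[of c "hdist (y$5) (y$6)"] c(1) by simp
  obtain n :: nat where n: "\<bar>2 * (k * cosh (c * (s + real_of_int m + real n))) * (k * cosh (c * (s + real_of_int m + real n + 1))) - (?C - cA y * cB y)\<bar> < ?X"
    using cosh_product_enters_window[OF c g(1,2) X X2 refl XE k G(1) G(2)[unfolded hc] m] by blast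
  obtain z where z: "z \<in> K" "twist 5 y z" "vol (z$5) a b = k * cosh (c * (s + real_of_int m + real n))"
    "vol (z$6) a b = k * cosh (c * (s + real_of_int m + real n + 1))"
    using ex[of "m + int n"] by (auto simp: add.assoc)
  note same = twist5_same[OF z(2)]
  have p: "f5 z * f6 z = vol (z$5) a b * vol (z$6) a b" unfolding v same by (insert e, (elim disjE; simp)+)
  have "\<exists>u\<in>K. disc_of u < 0 \<and> perim u < perim z"
  proof (rule flip_in_window[OF K(1) z(1)])
    show "1 < cA z" "1 < cB z" "0 \<le> disc_of z" "cA z * cB z \<le> cC z" unfolding same(1-3) using g D by simp_all
    show "\<bar>2 * (f5 z * f6 z) - (cC z - cA z * cB z)\<bar> < sqrt (((cA z)\<^sup>2 - 1) * ((cB z)\<^sup>2 - 1))"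
      unfolding p unfolding same(1-3) z(3,4) using n by (simp add: mult.assoc)
  qed
  then obtain u where u: "u \<in> K" "disc_of u < 0" "perim u < perim y" unfolding same(8) by blast
  obtain u' where u': "u' \<in> K" "links (perim u) u'" using triangle_links[OF K(1) u(1,2)] by blast
  have "perim u \<le> 2 * perim y" using u(3) perim_nonneg[of y] by linarith
  then show ?thesis using links_mono[OF u'(2)] u'(1) by blast
qed

lemma vol_le: "(vol x y z)\<^sup>2 \<le> ((ch y z)\<^sup>2 - 1) * ((ch x y)\<^sup>2 - 1)"
proof -
  have "(vol x y z)\<^sup>2 = ((ch y z)\<^sup>2 - 1) * ((ch x y)\<^sup>2 - 1) - (ch x z - ch x y * ch y z)\<^sup>2"
    unfolding vol_gram by (simp add: power2_eq_square algebra_simps)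
  then show ?thesis by simp
qed

text \<open>The distance between the two axes is at most that of the points \<open>x1\<close> and \<open>x3\<close> on them.\<close>

lemma excess_le:
  assumes "negative y" "ch (y$1) (y$3) \<le> R"
  shows "cC y - cA y * cB y \<le> R * sqrt (((cA y)\<^sup>2 - 1) * ((cB y)\<^sup>2 - 1))"
proof -
  let ?A = "cA y" and ?B = "cB y" and ?U = "ch (y$1) (y$3)"
  define e where "e = ch (y$3) (y$1) * ch (y$4) (y$2) - ch (y$3) (y$2) * ch (y$4) (y$1)"
  have "cC y - ?A * ?B = - e"
    using negative_trace[OF assms(1)] unfolding trace4 e_def ch_sym[of "y$3" "y$1"] ch_sym[of "y$4" "y$2"] ch_sym[of "y$4" "y$1"] ch_sym[of "y$3" "y$2"] ch_sym[of "y$4" "y$3"] ch_sym[of "y$2" "y$1"] by (simp add: algebra_simps)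
  then have e2: "(cC y - ?A * ?B)\<^sup>2 = e\<^sup>2" by simp
  define f1 f2 where "f1 = vol (y$1) (y$3) (y$4)" and "f2 = vol (y$2) (y$3) (y$4)"
  have "(?B\<^sup>2 - 1) * (?A\<^sup>2 - 1) - e\<^sup>2 = f1\<^sup>2 + f2\<^sup>2 - 2 * ?A * f1 * f2"
    using gram4[of "y$3" "y$4" "y$1" "y$2"] by (simp add: e_def f1_def f2_def)
  also have "\<dots> = (f2 - ?A * f1)\<^sup>2 - (?A\<^sup>2 - 1) * f1\<^sup>2" by (simp add: power2_eq_square algebra_simps)
  also have "\<dots> \<ge> - ((?A\<^sup>2 - 1) * f1\<^sup>2)" by simp
  finally have 1: "e\<^sup>2 \<le> (?A\<^sup>2 - 1) * (?B\<^sup>2 - 1 + f1\<^sup>2)" by (simp add: algebra_simps)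
  have A0: "0 \<le> ?A\<^sup>2 - 1" "0 \<le> ?B\<^sup>2 - 1" using ch_ge_1 by (simp_all add: one_le_power)
  have "f1\<^sup>2 \<le> (?B\<^sup>2 - 1) * (?U\<^sup>2 - 1)" unfolding f1_def by (rule vol_le)
  then have "?B\<^sup>2 - 1 + f1\<^sup>2 \<le> (?B\<^sup>2 - 1) * ?U\<^sup>2" by (simp add: algebra_simps)
  also have "\<dots> \<le> (?B\<^sup>2 - 1) * R\<^sup>2"
    using A0 assms(2) ch_ge_1[of "y$1" "y$3"] by (intro mult_left_mono power_mono) auto
  finally have "(?A\<^sup>2 - 1) * (?B\<^sup>2 - 1 + f1\<^sup>2) \<le> (?A\<^sup>2 - 1) * ((?B\<^sup>2 - 1) * R\<^sup>2)" using A0 by (intro mult_left_mono)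
  with 1 e2 have 2: "(cC y - ?A * ?B)\<^sup>2 \<le> R\<^sup>2 * ((?A\<^sup>2 - 1) * (?B\<^sup>2 - 1))" by (simp add: algebra_simps)
  have R: "0 \<le> R" using assms(2) ch_ge_1[of "y$1" "y$3"] by linarith
  have "sqrt ((cC y - ?A * ?B)\<^sup>2) \<le> sqrt (R\<^sup>2 * ((?A\<^sup>2 - 1) * (?B\<^sup>2 - 1)))" using 2 by (rule real_sqrt_le_mono)
  then have "\<bar>cC y - ?A * ?B\<bar> \<le> R * sqrt ((?A\<^sup>2 - 1) * (?B\<^sup>2 - 1))"
    using R by (simp add: real_sqrt_mult)
  then show ?thesis by linarith
qed

lemma generic_links:
  assumes K: "inv_set K" "y \<in> K" and g: "1 < cA y" "1 < cB y" "1 < cC y"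
    and R: "\<And>i j. ch (y$i) (y$j) \<le> R" "exp (2 * perim y) * (R - 1) < R + 1"
  shows "\<exists>z\<in>K. links (2 * perim y) z"
proof (cases "disc_of y < 0")
  case True
  obtain z where z: "z \<in> K" "links (perim y) z" using triangle_links[OF K True] by blast
  have "perim y \<le> 2 * perim y" using perim_nonneg[of y] by linarith
  then show ?thesis using links_mono[OF z(2)] z(1) by blast
next
  case False
  then have D: "0 \<le> disc_of y" by simp
  obtain z where z: "z \<in> {y, rot2 y, rot2 (rot2 y)}" "z \<in> K" "perim z = perim y" "disc_of z = disc_of y" "cA z * cB z \<le> cC z"
    using rotate_longest[OF K g D] by blast
  have gz: "1 < cA z" "1 < cB z" using z(1) g by (auto simp: rot2_nths)
  have Rz: "ch (z$1) (z$3) \<le> R" using z(1) R(1) by (auto simp: rot2_nths)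
  have R1: "0 \<le> R - 1" using R(1)[of 1 1] by simp
  have "hdist (z$5) (z$6) \<le> perim z" unfolding perim_def by simp
  then have "hdist (z$5) (z$6) \<le> perim y" unfolding z(3) .
  then have "exp (2 * hdist (z$5) (z$6)) * (R - 1) \<le> exp (2 * perim y) * (R - 1)" using R1 by (intro mult_right_mono) auto
  then have "exp (2 * hdist (z$5) (z$6)) * (R - 1) < R + 1" using R(2) by linarith
  then show ?thesis
    using links_from_excess[OF K(1) z(2) gz z(5) _ excess_le[OF inv_setD(1)[OF K(1) z(2)] Rz]] D unfolding z(3,4) by blast
qed

text \<open>If \<open>x1 = x2\<close>, the other two pairs have the same length and axis.  Renumbering makes the point the third
  pair, and a flip then separates it into two points, to which \<open>links_from_excess\<close> applies.\<close>

lemma degenerate_links: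
  assumes K: "inv_set K" "y \<in> K" and y12: "y$1 = y$2" and nf: "\<not> collapsed y" and R: "\<And>i j. ch (y$i) (y$j) \<le> R"
    and e: "0 < e" "exp (2 * e) * ((1 + 2 * R\<^sup>2) - 1) < (1 + 2 * R\<^sup>2) + 1"
    and small: "perim y \<le> e" "1 + 2 * (1 + R\<^sup>2) * ((cosh (perim y))\<^sup>2 - 1) \<le> cosh e"
  shows "\<exists>z\<in>K. links (6 * e) z"
proof -
  define u where "u = rot2 y"
  have u: "u \<in> K" unfolding u_def by (rule rot2_in[OF K])
  have BC: "cC y = cB y" by (rule degenerate_pair(1)[OF inv_setD(1)[OF K] y12])
  define A where "A = cB y"
  have "y$3 \<noteq> y$4"
  proof
    assume "y$3 = y$4"
    then have "cC y = 1" using BC by simp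
    then show False using \<open>y$3 = y$4\<close> y12 nf by (simp add: collapsed_def)
  qed
  then have A1: "1 < A" unfolding A_def by (rule ch_gt_1)
  have un: "cA u = A" "cB u = A" "cC u = 1" unfolding u_def rot2_nths A_def BC y12 by simp_all
  have u56: "u$5 = u$6" unfolding u_def rot2_nths by (rule y12)
  define f where "f = f5 u"
  have f6: "f6 u = f" unfolding f_def u56 ..
  have f2: "f\<^sup>2 \<le> (A\<^sup>2 - 1) * R\<^sup>2"
  proof -
    have "f\<^sup>2 \<le> ((cA u)\<^sup>2 - 1) * ((ch (u$5) (u$1))\<^sup>2 - 1)" unfolding f_def by (rule vol_le)
    also have "\<dots> \<le> (A\<^sup>2 - 1) * R\<^sup>2"
    proof -
      have "ch (u$5) (u$1) \<le> R" unfolding u_def rot2_nths by (rule R)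
      then have "(ch (u$5) (u$1))\<^sup>2 \<le> R\<^sup>2" using ch_ge_1[of "u$5" "u$1"] by (intro power_mono) auto
      then show ?thesis unfolding un using A1 by (intro mult_left_mono) (auto simp: one_le_power)
    qed
    finally show ?thesis .
  qed
  define v where "v = flip_third u"
  \<comment> \<open>As \<open>x5 = x6\<close>, the flipped value of \<open>C\<close> is \<open>2 * A\<^sup>2 - 1 + 2 * f\<^sup>2\<close>, which exceeds \<open>A * A\<close>.\<close>
  note m = flip_third_props[OF K(1) u, folded v_def]
  have vn: "cA v = A" "cB v = A" "cC v = 2 * A\<^sup>2 - 1 + 2 * f\<^sup>2"
    using m(2-4) unfolding un f6 f_def[symmetric] by (simp_all add: power2_eq_square)
  have A2: "0 < A\<^sup>2 - 1" using A1 by (simp add: one_less_power)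
  have X: "sqrt (((cA v)\<^sup>2 - 1) * ((cB v)\<^sup>2 - 1)) = A\<^sup>2 - 1" unfolding vn using A2 by simp
  have dv: "cC v - cA v * cB v = (A\<^sup>2 - 1) + 2 * f\<^sup>2" unfolding vn by (simp add: power2_eq_square)
  have AF: "A \<le> cosh (perim y)" unfolding A_def by (rule ch_le_perim(2))
  have AF2: "A\<^sup>2 \<le> (cosh (perim y))\<^sup>2" using AF A1 by (intro power_mono) auto
  have "cC v \<le> 1 + 2 * (1 + R\<^sup>2) * (A\<^sup>2 - 1)" unfolding vn using f2 by (simp add: algebra_simps)
  also have "\<dots> \<le> 1 + 2 * (1 + R\<^sup>2) * ((cosh (perim y))\<^sup>2 - 1)" using AF2 by (intro add_left_mono mult_left_mono) auto
  also have "\<dots> \<le> cosh e" by (rule small(2))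
  finally have "cosh (hdist (v$5) (v$6)) \<le> cosh e" by simp
  then have h5: "hdist (v$5) (v$6) \<le> e" by (subst (asm) cosh_real_nonneg_le_iff) (use e in auto)
  have h1: "hdist (v$1) (v$2) \<le> e" "hdist (v$3) (v$4) \<le> e"
  proof -
    have "hdist (v$1) (v$2) = hdist (y$3) (y$4)" "hdist (v$3) (v$4) = hdist (y$3) (y$4)" unfolding hdist_eq vn A_def by simp_all
    moreover have "hdist (y$3) (y$4) \<le> perim y" unfolding perim_def by simp
    ultimately show "hdist (v$1) (v$2) \<le> e" "hdist (v$3) (v$4) \<le> e" using small(1) by linarith+
  qed
  have Fv: "perim v \<le> 3 * e" using h1 h5 unfolding perim_def by linarith
  have "\<exists>z\<in>K. links (2 * perim v) z"
  proof (rule links_from_excess[OF K(1) m(1)])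
    show "1 < cA v" "1 < cB v" unfolding vn by (rule A1)+
    show "cA v * cB v \<le> cC v" using dv A2 zero_le_power2[of f] by linarith
    show "0 \<le> disc_of v" unfolding disc_alt dv unfolding vn using A2 power_mono[of "A\<^sup>2 - 1" "(A\<^sup>2 - 1) + 2 * f\<^sup>2" 2]
      by (simp add: power2_eq_square)
    show "cC v - cA v * cB v \<le> (1 + 2 * R\<^sup>2) * sqrt (((cA v)\<^sup>2 - 1) * ((cB v)\<^sup>2 - 1))"
      unfolding X dv using f2 by (simp add: algebra_simps)
    have "exp (2 * hdist (v$5) (v$6)) * ((1 + 2 * R\<^sup>2) - 1) \<le> exp (2 * e) * ((1 + 2 * R\<^sup>2) - 1)"
      using h5 by (intro mult_right_mono) auto
    then show "exp (2 * hdist (v$5) (v$6)) * ((1 + 2 * R\<^sup>2) - 1) < (1 + 2 * R\<^sup>2) + 1" using e(2) by linarith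
  qed
  then obtain z where z: "z \<in> K" "links (2 * perim v) z" by blast
  have "2 * perim v \<le> 6 * e" using Fv by simp
  then show ?thesis using links_mono[OF z(2)] z(1) by blast
qed

text \<open>The invariant set approaches \<open>w\<close> with bounded mutual distances (at most \<open>arcosh R\<close>) while \<open>perim\<close> tends
  to 0, so finally \<open>exp (2 * perim)\<close> is below the bound that \<open>links_from_excess\<close> requires for \<open>G\<close>.\<close>

theorem collapse_in_closure_links:
  assumes K: "inv_set K" and nf: "\<forall>y\<in>K. \<not> collapsed y" and w: "collapsed w" "coords w \<in> closure (coords ` K)" and e: "0 < e"
  shows "\<exists>z\<in>K. links e z"
proof -
  obtain s where s: "\<And>n. s n \<in> coords ` K" "s \<longlonglongrightarrow> coords w" using w(2) unfolding closure_sequential by blast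
  then have "\<forall>n. \<exists>y. y \<in> K \<and> s n = coords y" by blast
  then obtain y where y: "\<And>n. y n \<in> K" "\<And>n. s n = coords (y n)" by metis
  have lim: "(\<lambda>n. J (y n $ j)) \<longlonglongrightarrow> J (w$j)" for j
    using tendsto_vec_nth[OF s(2), of j] by (simp add: y(2) coords_def)
  have chl: "(\<lambda>n. ch (y n $ i) (y n $ j)) \<longlonglongrightarrow> ch (w$i) (w$j)" for i j by (rule ch_tendsto[OF lim lim])
  define R where "R = 1 + (\<Sum>i\<in>UNIV. \<Sum>j\<in>UNIV. ch (w$i) (w$j))"
  have c0: "0 \<le> ch a b" for a b using ch_ge_1[of a b] by linarith
  have Rw: "ch (w$i) (w$j) < R" for i j
  proof -
    have "ch (w$i) (w$j) \<le> (\<Sum>j\<in>UNIV. ch (w$i) (w$j))"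
      by (rule member_le_sum[of j UNIV "\<lambda>j. ch (w$i) (w$j)"]) (use c0 in auto)
    also have "\<dots> \<le> (\<Sum>i\<in>UNIV. \<Sum>j\<in>UNIV. ch (w$i) (w$j))"
      by (rule member_le_sum[of i UNIV "\<lambda>i. \<Sum>j\<in>UNIV. ch (w$i) (w$j)"]) (use c0 in \<open>auto intro: sum_nonneg\<close>)
    finally show ?thesis by (simp add: R_def)
  qed
  have "\<forall>\<^sub>F n in sequentially. \<forall>i\<in>UNIV. \<forall>j\<in>UNIV. ch (y n $ i) (y n $ j) < R"
    by (intro eventually_ball_finite ballI finite) (rule order_tendstoD(2)[OF chl Rw])
  then have evR: "\<forall>\<^sub>F n in sequentially. \<forall>i j. ch (y n $ i) (y n $ j) < R" by simp
  have R1: "1 < R" using Rw[of 1 1] by simp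
  \<comment> \<open>\<open>G\<close> is the bound that arises in the degenerate case; it exceeds \<open>R\<close>.\<close>
  define G where "G = 1 + 2 * R\<^sup>2"
  have RG: "R \<le> G" using R1 unfolding G_def by (smt (verit) power2_eq_square mult_le_cancel_left1)
  have G1: "1 < G" using R1 RG by linarith
  \<comment> \<open>The second term makes steps of length up to \<open>d\<close> small enough for the window; the factor 6 is lost in \<open>degenerate_links\<close>.\<close>
  define d where "d = min (e / 6) (ln ((G + 1) / (G - 1)) / 4)"
  have q1: "1 < (G + 1) / (G - 1)" using G1 by simp
  have d: "0 < d" "d \<le> e / 6" unfolding d_def using e q1 by (auto simp: ln_gt_zero)
  have expd: "exp (2 * d) * (G - 1) < G + 1"
  proof -
    have "0 < ln ((G + 1) / (G - 1))" by (rule ln_gt_zero[OF q1])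
    then have "2 * d < ln ((G + 1) / (G - 1))" unfolding d_def by linarith
    then have "exp (2 * d) < exp (ln ((G + 1) / (G - 1)))" by simp
    also have "\<dots> = (G + 1) / (G - 1)" by (rule exp_ln) (use q1 in linarith)
    finally show ?thesis using G1 by (simp add: pos_less_divide_eq)
  qed
  have "perim w = 0" using w(1) by (simp add: collapsed_def perim_def hdist_eq)
  then have Fl: "(\<lambda>n. perim (y n)) \<longlonglongrightarrow> 0" using perim_tendsto[of y w] chl by simp
  have evF: "\<forall>\<^sub>F n in sequentially. perim (y n) < d" by (rule order_tendstoD(2)[OF Fl d(1)])
  have ct: "(\<lambda>n. cosh (perim (y n))) \<longlonglongrightarrow> cosh 0"
    by (intro tendsto_cosh Fl)
  have "(\<lambda>n. 1 + 2 * (1 + R\<^sup>2) * ((cosh (perim (y n)))\<^sup>2 - 1)) \<longlonglongrightarrow> 1 + 2 * (1 + R\<^sup>2) * ((cosh 0)\<^sup>2 - 1)"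
    by (intro tendsto_intros ct)
  then have tc: "(\<lambda>n. 1 + 2 * (1 + R\<^sup>2) * ((cosh (perim (y n)))\<^sup>2 - 1)) \<longlonglongrightarrow> 1" by simp
  have "cosh 0 < cosh d" by (subst cosh_real_nonneg_less_iff) (use d in auto)
  then have "\<forall>\<^sub>F n in sequentially. 1 + 2 * (1 + R\<^sup>2) * ((cosh (perim (y n)))\<^sup>2 - 1) < cosh d"
    by (intro order_tendstoD(2)[OF tc]) simp
  with evR evF have "\<forall>\<^sub>F n in sequentially. (\<forall>i j. ch (y n $ i) (y n $ j) < R) \<and> perim (y n) < d \<and> 1 + 2 * (1 + R\<^sup>2) * ((cosh (perim (y n)))\<^sup>2 - 1) < cosh d"
    by eventually_elim blast
  then obtain n where n: "\<And>i j. ch (y n $ i) (y n $ j) < R" "perim (y n) < d" "1 + 2 * (1 + R\<^sup>2) * ((cosh (perim (y n)))\<^sup>2 - 1) < cosh d"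
    using eventually_happens'[OF sequentially_bot] by blast
  define x where "x = y n"
  have x: "x \<in> K" "\<not> collapsed x" "\<And>i j. ch (x$i) (x$j) \<le> R" "perim x \<le> d" "1 + 2 * (1 + R\<^sup>2) * ((cosh (perim x))\<^sup>2 - 1) \<le> cosh d"
    using y(1)[of n] nf n unfolding x_def by (auto intro: less_imp_le)
  have dl: "\<exists>z\<in>K. links (6 * d) z" if "u \<in> {x, rot2 x, rot2 (rot2 x)}" "u$1 = u$2" for u
  proof -
    have 1: "u \<in> K" using that(1) x(1) rot2_in[OF K] by auto
    have 2: "\<not> collapsed u" using 1 nf by blast
    have 3: "ch (u$i) (u$j) \<le> R" for i j using that(1) x(3) by (auto simp: rot2_def rot_nth)
    have 4: "perim u = perim x" using that(1) by (auto simp: rot2_perim)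
    show ?thesis
      by (rule degenerate_links[OF K 1 that(2) 2 3 d(1)]) (use x(4,5) expd in \<open>simp_all add: 4 G_def\<close>)
  qed
  have "\<exists>z\<in>K. links (6 * d) z"
  proof (cases "x$1 = x$2 \<or> x$3 = x$4 \<or> x$5 = x$6")
    case True
    then show ?thesis using dl[of x] dl[of "rot2 x"] dl[of "rot2 (rot2 x)"] by (auto simp: rot2_nths)
  next
    case False
    then have g: "1 < cA x" "1 < cB x" "1 < cC x" by (auto intro: ch_gt_1)
    have "exp (2 * perim x) * (G - 1) \<le> exp (2 * d) * (G - 1)" using x(4) G1 by (intro mult_right_mono) auto
    then have "exp (2 * perim x) * (G - 1) < G + 1" using expd by linarith
    then obtain z where z: "z \<in> K" "links (2 * perim x) z"
      using generic_links[OF K x(1) g, of G] order_trans[OF x(3) RG] by blast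
    have "2 * perim x \<le> 6 * d" using x(4) d(1) by simp
    then show ?thesis using links_mono[OF z(2)] z(1) by blast
  qed
  then obtain z where z: "z \<in> K" "links (6 * d) z" by blast
  have "6 * d \<le> e" using d(2) by simp
  then show ?thesis using links_mono[OF z(2)] z(1) by blast
qed

section \<open>The action of the mapping class group\<close>

lemma rot6: "rot (rot (rot (rot (rot (rot y))))) = y"
  by (rule config_eqI) (simp_all only: rot_nths)

lemma negative_rot_iff: "negative (rot y) \<longleftrightarrow> negative y"
  using negative_rot[of y] negative_rot[OF negative_rot[OF negative_rot[OF negative_rot[OF negative_rot[of "rot y"]]]]] unfolding rot6 by blast

text \<open>For the first move the product is visibly unchanged; the others are conjugate to it by the rotation of
  the indices.\<close>

lemma negative_leapfrog: "negative (leapfrog i y) \<longleftrightarrow> negative y"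
proof -
  have 1: "negative (leapfrog 1 y) \<longleftrightarrow> negative y" for y
    unfolding negative_iff leapfrog_nth J_half_turn
    by (simp only: rassoc J_sq J_sq_left matrix_mult_uminus matrix_mul_lid matrix_mul_rid minus_minus)
  have step: "negative (leapfrog (i + 1) y) \<longleftrightarrow> negative y" if "\<And>y. negative (leapfrog i y) \<longleftrightarrow> negative y" for i y
    using that[of "rot y"] unfolding leapfrog_rot negative_rot_iff .
  have 2: "negative (leapfrog 2 y) \<longleftrightarrow> negative y" for y using step[OF 1] by simp
  have 3: "negative (leapfrog 3 y) \<longleftrightarrow> negative y" for y using step[OF 2] by simp
  have 4: "negative (leapfrog 4 y) \<longleftrightarrow> negative y" for y using step[OF 3] by simp
  have 5: "negative (leapfrog 5 y) \<longleftrightarrow> negative y" for y using step[OF 4] by simp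
  have "(5 + 1 :: 6) = 6" by simp
  then have 6: "negative (leapfrog 6 y) \<longleftrightarrow> negative y" for y using step[OF 5] by metis
  show ?thesis using exhaust_6[of i] by (elim disjE) (simp_all only: 1 2 3 4 5 6)
qed

lemma negative_unleap: "negative (unleap i y) \<longleftrightarrow> negative y"
  using negative_leapfrog[of i "unleap i y"] by simp

lemma negative_transport: "negative y \<Longrightarrow> negative (transport g y)"
proof -
  assume y: "negative y"
  obtain G H where GH: "G ** H = mat 1" "H ** G = mat 1" "\<And>z. J (g \<bullet>\<^sub>H z) = G ** J z ** H" by (rule J_act) blast
  show ?thesis using y unfolding negative_def transport_nth GH(3) conj_mult[OF GH(2)]
    by (simp add: GH(1))
qed

lemma leapfrog_elt_surj: "leapfrog_elt i ` Sex = Sex"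
  using leapfrog_elt_Bij[of i] by (simp add: BijGroup_def Bij_def bij_betw_def)

lemma Sex_unleap: "y \<in> Sex \<Longrightarrow> unleap i y \<in> Sex"
proof -
  assume "y \<in> Sex"
  then obtain z where "z \<in> Sex" "y = leapfrog i z" using leapfrog_elt_surj[of i] by (auto simp: leapfrog_elt_def)
  then show ?thesis by simp
qed

lemma transport_mult: "transport (g * h) y = transport g (transport h y)"
  by (simp add: vec_eq_iff psl_act_mult)

lemma transport_one [simp]: "transport 1 y = y"
  by (simp add: vec_eq_iff)

lemma Sex_transport: "y \<in> Sex \<Longrightarrow> transport g y \<in> Sex"
proof -
  assume y: "y \<in> Sex"
  obtain G H where GH: "G ** H = mat 1" "H ** G = mat 1" "\<And>z. J (g \<bullet>\<^sub>H z) = G ** J z ** H" by (rule J_act) blast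
  show ?thesis using y negative_transport[of y g] unfolding Sex_iff transport_nth GH(3) conj_mult[OF GH(2)]
    by (auto simp add: GH(1))
qed

abbreviation "SexGroup \<equiv> BijGroup Sex"

interpretation SexG: group SexGroup by (rule group_BijGroup)

lemma leapfrog_elt_carrier: "leapfrog_elt i \<in> carrier SexGroup"
  by (rule leapfrog_elt_Bij)

lemma mult_apply: "f \<in> carrier SexGroup \<Longrightarrow> g \<in> carrier SexGroup \<Longrightarrow> y \<in> Sex \<Longrightarrow> (f \<otimes>\<^bsub>SexGroup\<^esub> g) y = f (g y)"
  by (simp add: BijGroup_def compose_def)

lemma one_apply: "y \<in> Sex \<Longrightarrow> \<one>\<^bsub>SexGroup\<^esub> y = y"
  by (simp add: BijGroup_def)

lemma carrier_apply: "f \<in> carrier SexGroup \<Longrightarrow> y \<in> Sex \<Longrightarrow> f y \<in> Sex"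
  by (auto simp: BijGroup_def Bij_def bij_betw_def)

lemma leapfrog_elt_apply: "y \<in> Sex \<Longrightarrow> leapfrog_elt i y = leapfrog i y"
  by (simp add: leapfrog_elt_def)

lemma inv_leapfrog_elt_apply:
  assumes y: "y \<in> Sex" shows "(inv\<^bsub>SexGroup\<^esub> (leapfrog_elt i)) y = unleap i y"
proof -
  have "(inv\<^bsub>SexGroup\<^esub> (leapfrog_elt i)) (leapfrog_elt i (unleap i y)) = unleap i y"
    using mult_apply[of "inv\<^bsub>SexGroup\<^esub> (leapfrog_elt i)" "leapfrog_elt i" "unleap i y"] Sex_unleap[OF y, of i]
    by (simp add: leapfrog_elt_carrier SexG.l_inv one_apply)
  then show ?thesis using leapfrog_elt_apply[OF Sex_unleap[OF y]] by simp
qed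

lemma Mod_So_carrier: "\<gamma> \<in> Mod_So \<Longrightarrow> \<gamma> \<in> carrier SexGroup"
  unfolding Mod_So_def using SexG.generate_in_carrier[of "range leapfrog_elt"] leapfrog_elt_carrier by blast

lemma Mod_So_leapfrog: "leapfrog_elt i \<in> Mod_So"
  unfolding Mod_So_def by (rule generate.incl) simp

lemma Mod_So_inv_leapfrog: "inv\<^bsub>SexGroup\<^esub> (leapfrog_elt i) \<in> Mod_So"
  unfolding Mod_So_def by (rule generate.inv) simp

lemma Mod_So_mult: "\<gamma> \<in> Mod_So \<Longrightarrow> \<delta> \<in> Mod_So \<Longrightarrow> \<gamma> \<otimes>\<^bsub>SexGroup\<^esub> \<delta> \<in> Mod_So"
  unfolding Mod_So_def by (rule generate.eng)

lemma Mod_So_one: "\<one>\<^bsub>SexGroup\<^esub> \<in> Mod_So"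
  unfolding Mod_So_def by (rule generate.one)

lemma Mod_So_inv: "\<gamma> \<in> Mod_So \<Longrightarrow> inv\<^bsub>SexGroup\<^esub> \<gamma> \<in> Mod_So"
  unfolding Mod_So_def by (rule SexG.generate_m_inv_closed) (auto simp: leapfrog_elt_carrier)

lemma Mod_So_closed:
  assumes "\<gamma> \<in> Mod_So" and S: "S \<subseteq> Sex" "\<And>y i. y \<in> S \<Longrightarrow> leapfrog i y \<in> S" "\<And>y i. y \<in> S \<Longrightarrow> unleap i y \<in> S" and "y \<in> S"
  shows "\<gamma> y \<in> S"
  using assms(1,5) unfolding Mod_So_def
proof (induction arbitrary: y rule: generate.induct)
  case one
  then show ?case using S(1) by (auto simp: one_apply)
next
  case (incl h)
  then show ?case using S(1,2) by (auto simp: leapfrog_elt_apply)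
next
  case (inv h)
  then show ?case using S(1,3) by (auto simp: inv_leapfrog_elt_apply)
next
  case (eng f g)
  have "f \<in> carrier SexGroup" "g \<in> carrier SexGroup" using Mod_So_carrier eng.hyps unfolding Mod_So_def by blast+
  then show ?case using eng S(1) by (auto simp: mult_apply)
qed

lemma Mod_So_transport:
  assumes "\<gamma> \<in> Mod_So" "y \<in> Sex" shows "\<gamma> (transport g y) = transport g (\<gamma> y)"
  using assms unfolding Mod_So_def
proof (induction arbitrary: y rule: generate.induct)
  case one
  then show ?case by (simp add: one_apply Sex_transport)
next
  case (incl h)
  then show ?case by (auto simp: leapfrog_elt_apply Sex_transport leapfrog_transport)
next
  case (inv h)
  then show ?case by (auto simp: inv_leapfrog_elt_apply Sex_transport unleap_transport)
next
  case (eng f g')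
  have c: "f \<in> carrier SexGroup" "g' \<in> carrier SexGroup" using Mod_So_carrier eng.hyps unfolding Mod_So_def by blast+
  then show ?case using eng by (simp add: mult_apply Sex_transport carrier_apply)
qed

lemma negative_orbit:
  assumes "\<gamma> \<in> Mod_So" "negative c" shows "negative (\<gamma> c)"
proof -
  have "\<gamma> c \<in> {z. negative z}"
    by (rule Mod_So_closed[OF assms(1)]) (use assms(2) in \<open>auto simp: negative_leapfrog negative_unleap Sex_iff\<close>)
  then show ?thesis by simp
qed

definition orbit :: "config \<Rightarrow> config set"
  where "orbit c = {transport g (\<gamma> c) |g \<gamma>. \<gamma> \<in> Mod_So}"

lemma orbit_inv_set:
  assumes c: "negative c"
  shows "inv_set (orbit c)"
  unfolding inv_set_def
proof (intro ballI conjI allI)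
  fix y assume "y \<in> orbit c"
  then obtain g \<gamma> where y: "y = transport g (\<gamma> c)" "\<gamma> \<in> Mod_So" by (auto simp: orbit_def)
  have cS: "c \<in> Sex" using c by (simp add: Sex_iff)
  show "negative y" unfolding y(1) by (rule negative_transport[OF negative_orbit[OF y(2) c]])
  have gc: "\<gamma> \<in> carrier SexGroup" by (rule Mod_So_carrier[OF y(2)])
  have gS: "\<gamma> c \<in> Sex" by (rule carrier_apply[OF gc cS])
  fix i
  have "leapfrog i y = transport g ((leapfrog_elt i \<otimes>\<^bsub>SexGroup\<^esub> \<gamma>) c)"
    by (simp add: y(1) leapfrog_transport mult_apply[OF leapfrog_elt_carrier gc cS] leapfrog_elt_apply[OF gS])
  then show "leapfrog i y \<in> orbit c" using Mod_So_mult[OF Mod_So_leapfrog y(2)] unfolding orbit_def by blast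
  have "unleap i y = transport g ((inv\<^bsub>SexGroup\<^esub> (leapfrog_elt i) \<otimes>\<^bsub>SexGroup\<^esub> \<gamma>) c)"
    by (simp add: y(1) unleap_transport mult_apply[OF SexG.inv_closed[OF leapfrog_elt_carrier] gc cS] inv_leapfrog_elt_apply[OF gS])
  then show "unleap i y \<in> orbit c" using Mod_So_mult[OF Mod_So_inv_leapfrog y(2)] unfolding orbit_def by blast
next
  fix y h assume "y \<in> orbit c"
  then obtain g \<gamma> where y: "y = transport g (\<gamma> c)" "\<gamma> \<in> Mod_So" by (auto simp: orbit_def)
  then have "transport h y = transport (h * g) (\<gamma> c)" by (simp add: transport_mult)
  then show "transport h y \<in> orbit c" using y(2) unfolding orbit_def by blast
qed

lemma collapsed_transport: "collapsed (transport g y) \<Longrightarrow> collapsed y"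
proof -
  have "g \<bullet>\<^sub>H a = g \<bullet>\<^sub>H b \<Longrightarrow> a = b" for a b
    using ch_act[of g a b] ch_eq_1[of a b] by (metis ch_refl)
  then show "collapsed (transport g y) \<Longrightarrow> collapsed y" by (auto simp: collapsed_def)
qed

lemma orbit_not_collapsed:
  assumes c: "c \<in> Sex" "\<not> pinched c" and y: "y \<in> orbit c"
  shows "\<not> collapsed y"
proof
  assume "collapsed y"
  obtain g \<gamma> where y: "y = transport g (\<gamma> c)" "\<gamma> \<in> Mod_So" using y by (auto simp: orbit_def)
  have fl: "collapsed (\<gamma> c)" using \<open>collapsed y\<close> unfolding y(1) by (rule collapsed_transport)
  note gc = Mod_So_carrier[OF y(2)]
  have "c = (inv\<^bsub>SexGroup\<^esub> \<gamma>) (\<gamma> c)"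
    using mult_apply[of "inv\<^bsub>SexGroup\<^esub> \<gamma>" \<gamma> c] c(1) gc by (simp add: SexG.l_inv one_apply)
  then have "pinched c" unfolding pinched_def using Mod_So_inv[OF y(2)] carrier_apply[OF gc c(1)] fl[unfolded collapsed_def] by blast
  then show False using c(2) by blast
qed

section \<open>The closure of an orbit\<close>

lemma mult_tendsto:
  fixes A B :: "nat \<Rightarrow> real^2^2"
  assumes "A \<longlonglongrightarrow> a" "B \<longlonglongrightarrow> b"
  shows "(\<lambda>n. A n ** B n) \<longlonglongrightarrow> a ** b"
  unfolding matrix_matrix_mult_def by (intro tendsto_intros assms)

text \<open>The limit has trace 0 and determinant 1, and then its lower left entry cannot be 0.\<close>

lemma closure_coords:
  assumes "M \<in> closure (coords ` S)" obtains z where "M = coords z"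
proof -
  obtain s where s: "\<And>n. s n \<in> coords ` S" "s \<longlonglongrightarrow> M" using assms unfolding closure_sequential by blast
  have "\<exists>z. J z = M $ j" for j
  proof -
    have lim: "(\<lambda>n. s n $ j) \<longlonglongrightarrow> M $ j" by (intro tendsto_intros s(2))
    have ent: "(\<lambda>n. s n $ j $ a $ b) \<longlonglongrightarrow> M $ j $ a $ b" for a b by (intro tendsto_intros s(2))
    have sJ: "\<exists>z. s n $ j = J z" for n using s(1)[of n] by (auto simp: coords_def)
    have "trace (s n $ j) = 0" "det (s n $ j) = 1" "0 \<le> s n $ j $ 2 $ 1" for n
    proof -
      obtain z where z: "s n $ j = J z" using sJ by blast
      show "trace (s n $ j) = 0" "det (s n $ j) = 1" unfolding z by simp_all
      show "0 \<le> s n $ j $ 2 $ 1" unfolding z by (rule J_coords[of z]) simp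
    qed note p = this
    have t: "trace (M $ j) = 0"
    proof (rule LIMSEQ_unique)
      show "(\<lambda>n. trace (s n $ j)) \<longlonglongrightarrow> trace (M $ j)" unfolding trace2 by (intro tendsto_intros ent)
      show "(\<lambda>n. trace (s n $ j)) \<longlonglongrightarrow> 0" unfolding p(1) by simp
    qed
    have d: "det (M $ j) = 1"
    proof (rule LIMSEQ_unique)
      show "(\<lambda>n. det (s n $ j)) \<longlonglongrightarrow> det (M $ j)" unfolding det_2 by (intro tendsto_intros ent)
      show "(\<lambda>n. det (s n $ j)) \<longlonglongrightarrow> 1" unfolding p(2) by simp
    qed
    have "0 \<le> M $ j $ 2 $ 1" by (rule LIMSEQ_le_const[OF ent]) (use p(3) in blast)
    moreover have "M $ j $ 2 $ 1 \<noteq> 0"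
    proof
      assume "M $ j $ 2 $ 1 = 0"
      then have "M $ j $ 1 $ 1 * M $ j $ 2 $ 2 = 1" using d by (simp add: det_2)
      moreover have "M $ j $ 2 $ 2 = - M $ j $ 1 $ 1" using t by (simp add: trace2)
      ultimately have "- (M $ j $ 1 $ 1)\<^sup>2 = 1" by (simp add: power2_eq_square)
      then show False using zero_le_power2[of "M $ j $ 1 $ 1"] by linarith
    qed
    ultimately have "0 < M $ j $ 2 $ 1" by simp
    then show ?thesis using J_surj[OF t d] by blast
  qed
  then obtain f where "\<And>j. J (f j) = M $ j" by metis
  then have "M = coords (\<chi> j. f j)" by (simp add: vec_eq_iff coords_def)
  then show ?thesis by (rule that)
qed

text \<open>The closure of \<open>S\<close> as a set of configurations.\<close>

definition lim_set :: "config set \<Rightarrow> config set"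
  where "lim_set S = {z. coords z \<in> closure (coords ` S)}"

lemma closed_lim_set: "closed (coords ` lim_set S)"
proof -
  have "coords ` lim_set S = closure (coords ` S)"
  proof (intro equalityI subsetI)
    fix M assume M: "M \<in> closure (coords ` S)"
    then obtain z where z: "M = coords z" by (rule closure_coords)
    have "z \<in> lim_set S" using M unfolding z by (simp add: lim_set_def)
    then show "M \<in> coords ` lim_set S" unfolding z by blast
  qed (auto simp: lim_set_def)
  then show ?thesis by simp
qed

lemma lim_set_seq: "z \<in> lim_set S \<longleftrightarrow> (\<exists>y. (\<forall>n. y n \<in> S) \<and> (\<forall>j. (\<lambda>n. J (y n $ j)) \<longlonglongrightarrow> J (z $ j)))"
proof
  assume "z \<in> lim_set S"
  then obtain s where s: "\<And>n. s n \<in> coords ` S" "s \<longlonglongrightarrow> coords z" unfolding lim_set_def closure_sequential by blast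
  then have "\<forall>n. \<exists>y. y \<in> S \<and> s n = coords y" by blast
  then obtain y where y: "\<And>n. y n \<in> S" "\<And>n. s n = coords (y n)" by metis
  have "(\<lambda>n. J (y n $ j)) \<longlonglongrightarrow> J (z$j)" for j
    using tendsto_vec_nth[OF s(2), of j] by (simp add: y(2) coords_def)
  then show "\<exists>y. (\<forall>n. y n \<in> S) \<and> (\<forall>j. (\<lambda>n. J (y n $ j)) \<longlonglongrightarrow> J (z $ j))" using y(1) by blast
next
  assume "\<exists>y. (\<forall>n. y n \<in> S) \<and> (\<forall>j. (\<lambda>n. J (y n $ j)) \<longlonglongrightarrow> J (z $ j))"
  then obtain y where y: "\<And>n. y n \<in> S" "\<And>j. (\<lambda>n. J (y n $ j)) \<longlonglongrightarrow> J (z $ j)" by blast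
  have "(\<lambda>n. coords (y n)) \<longlonglongrightarrow> coords z" unfolding coords_def by (intro tendsto_vec_lambda y(2))
  then show "z \<in> lim_set S" unfolding lim_set_def closure_sequential mem_Collect_eq
    by (intro exI[of _ "\<lambda>n. coords (y n)"]) (use y(1) in blast)
qed

lemma lim_set_map:
  assumes "\<And>y z j. (\<And>j. (\<lambda>n. J (y n $ j)) \<longlonglongrightarrow> J (z $ j)) \<Longrightarrow> (\<lambda>n. J (f (y n) $ j)) \<longlonglongrightarrow> J (f z $ j)"
    and "\<And>y. y \<in> S \<Longrightarrow> f y \<in> S" and z: "z \<in> lim_set S"
  shows "f z \<in> lim_set S"
proof -
  obtain y where y: "\<And>n. y n \<in> S" "\<And>j. (\<lambda>n. J (y n $ j)) \<longlonglongrightarrow> J (z $ j)" using z unfolding lim_set_seq by blast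
  show ?thesis unfolding lim_set_seq
    by (rule exI[of _ "\<lambda>n. f (y n)"]) (use assms(1)[OF y(2)] assms(2)[OF y(1)] in blast)
qed

text \<open>In the matrix coordinates the moves and the isometries are products, hence continuous.\<close>

lemma lim_set_inv:
  assumes S: "inv_set S" shows "inv_set (lim_set S)"
  unfolding inv_set_def
proof (intro ballI conjI allI)
  fix z assume z: "z \<in> lim_set S"
  then obtain y where y: "\<And>n. y n \<in> S" "\<And>j. (\<lambda>n. J (y n $ j)) \<longlonglongrightarrow> J (z $ j)" unfolding lim_set_seq by blast
  show "negative z"
    unfolding negative_def
  proof (rule LIMSEQ_unique)
    show "(\<lambda>n. J (y n$6) ** J (y n$5) ** J (y n$4) ** J (y n$3) ** J (y n$2) ** J (y n$1)) \<longlonglongrightarrow>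
      J (z$6) ** J (z$5) ** J (z$4) ** J (z$3) ** J (z$2) ** J (z$1)" by (intro mult_tendsto y(2))
    show "(\<lambda>n. J (y n$6) ** J (y n$5) ** J (y n$4) ** J (y n$3) ** J (y n$2) ** J (y n$1)) \<longlonglongrightarrow> - mat 1"
      unfolding inv_setD(1)[OF S y(1), unfolded negative_def] by simp
  qed
  show "leapfrog i z \<in> lim_set S" for i
  proof (rule lim_set_map[OF _ _ z])
    show "(\<lambda>n. J (leapfrog i (y n) $ j)) \<longlonglongrightarrow> J (leapfrog i z $ j)" if "\<And>j. (\<lambda>n. J (y n $ j)) \<longlonglongrightarrow> J (z $ j)" for y z j
      using that by (auto simp: leapfrog_def J_half_turn intro!: tendsto_minus mult_tendsto)
  qed (rule inv_setD(2)[OF S])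
  show "unleap i z \<in> lim_set S" for i
  proof (rule lim_set_map[OF _ _ z])
    show "(\<lambda>n. J (unleap i (y n) $ j)) \<longlonglongrightarrow> J (unleap i z $ j)" if "\<And>j. (\<lambda>n. J (y n $ j)) \<longlonglongrightarrow> J (z $ j)" for y z j
      using that by (auto simp: unleap_def J_half_turn intro!: tendsto_minus mult_tendsto)
  qed (rule inv_setD(3)[OF S])
  show "transport g z \<in> lim_set S" for g
  proof (rule lim_set_map[OF _ _ z])
    obtain G H where GH: "\<And>z. J (g \<bullet>\<^sub>H z) = G ** J z ** H" by (rule J_act) blast
    show "(\<lambda>n. J (transport g (y n) $ j)) \<longlonglongrightarrow> J (transport g z $ j)" if "\<And>j. (\<lambda>n. J (y n $ j)) \<longlonglongrightarrow> J (z $ j)" for y z j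
      unfolding transport_nth GH by (intro mult_tendsto tendsto_const that)
  qed (rule inv_setD(4)[OF S])
qed

lemma links_transport: "links e (transport g y) \<longleftrightarrow> links e y"
  by (simp add: links_def hdist_eq)

theorem small_links:
  assumes c: "negative c" "\<not> pinched c" and e: "0 < e"
  shows "\<exists>\<gamma>\<in>Mod_So. links e (\<gamma> c)"
proof -
  have cS: "c \<in> Sex" using c by (simp add: Sex_iff)
  note O = orbit_inv_set[OF c(1)]
  have "transport 1 (\<one>\<^bsub>SexGroup\<^esub> c) \<in> orbit c" unfolding orbit_def using Mod_So_one by blast
  then have "lim_set (orbit c) \<noteq> {}" unfolding lim_set_def using closure_subset by blast
  then obtain w where w: "w \<in> lim_set (orbit c)" "collapsed w"
    using closed_inv_set_collapses[OF lim_set_inv[OF O] closed_lim_set] by blast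
  have "\<forall>y\<in>orbit c. \<not> collapsed y" using orbit_not_collapsed[OF cS c(2)] by blast
  from collapse_in_closure_links[OF O this w(2) w(1)[unfolded lim_set_def mem_Collect_eq] e]
  obtain z where z: "z \<in> orbit c" "links e z" by blast
  then obtain g \<gamma> where "z = transport g (\<gamma> c)" "\<gamma> \<in> Mod_So" by (auto simp: orbit_def)
  then show ?thesis using z(2) by (auto simp: links_transport)
qed

section \<open>The component of the singular class\<close>

lemma continuous_of_h2: "continuous_on UNIV of_h2"
  unfolding continuous_on_open_vimage[OF open_UNIV]
proof (intro allI impI)
  fix U :: "complex set" assume U: "open U"
  have r: "of_h2 ` (of_h2 -` U) = U \<inter> {z. 0 < Im z}"
    unfolding image_vimage_eq type_definition.Rep_range[OF type_definition_h2] ..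
  show "open (of_h2 -` U \<inter> UNIV)"
    unfolding open_h2_def Int_UNIV_right r by (rule open_Int[OF U open_halfspace_Im_gt])
qed

lemma continuous_J_nth: "continuous_on UNIV (\<lambda>y :: config. J (y $ i) $ a $ b)"
proof -
  have c: "continuous_on UNIV (\<lambda>y :: config. of_h2 (y $ i))"
    by (rule continuous_on_compose2[OF continuous_of_h2]) (auto intro: continuous_on_component)
  have re: "continuous_on UNIV (\<lambda>y :: config. Re (of_h2 (y $ i)))" and im: "continuous_on UNIV (\<lambda>y :: config. Im (of_h2 (y $ i)))"
    by (rule continuous_on_Re[OF c], rule continuous_on_Im[OF c])
  have nz: "\<forall>y\<in>UNIV. Im (of_h2 (y $ i)) \<noteq> 0" for i by (metis Im_of_h2 less_irrefl)
  have "a = 1 \<or> a = 2" "b = 1 \<or> b = 2" using exhaust_2 by blast+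
  moreover have "continuous_on UNIV (\<lambda>y :: config. J (y $ i) $ 1 $ 1)"
    unfolding J_def half_turn_matrix_def by simp (rule continuous_on_divide[OF re im nz])
  moreover have "continuous_on UNIV (\<lambda>y :: config. J (y $ i) $ 1 $ 2)"
    unfolding J_def half_turn_matrix_def
    by simp (rule continuous_on_minus[OF continuous_on_divide[OF continuous_on_add[OF continuous_on_power[OF re] continuous_on_power[OF im]] im nz]])
  moreover have "continuous_on UNIV (\<lambda>y :: config. J (y $ i) $ 2 $ 1)"
    unfolding J_def half_turn_matrix_def by simp (rule continuous_on_divide[OF continuous_on_const im nz])
  moreover have "continuous_on UNIV (\<lambda>y :: config. J (y $ i) $ 2 $ 2)"
    unfolding J_def half_turn_matrix_def by simp (rule continuous_on_minus[OF continuous_on_divide[OF re im nz]])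
  ultimately show ?thesis by (elim disjE) simp_all
qed

text \<open>This entry is \<open>-1\<close> or \<open>1\<close> on \<open>Sex\<close>, so that its sign separates the negative configurations from the
  others.\<close>

definition product_entry :: "config \<Rightarrow> real"
  where "product_entry y = (J (y$6) ** J (y$5) ** J (y$4) ** J (y$3) ** J (y$2) ** J (y$1)) $ 1 $ 1"

lemma continuous_product_entry: "continuous_on UNIV product_entry"
  unfolding product_entry_def matrix_matrix_mult_def sum_2
  by (simp only: vec_lambda_beta) (intro continuous_on_add continuous_on_mult continuous_J_nth)

lemma product_entry_negative: "negative y \<Longrightarrow> product_entry y = -1"
  by (simp add: negative_def product_entry_def mat_def)

lemma product_entry_pos: "y \<in> Sex \<Longrightarrow> \<not> negative y \<Longrightarrow> product_entry y = 1"
  by (simp add: Sex_iff product_entry_def mat_def)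

lemma transport_inverse: obtains h where "\<And>y. transport h (transport g y) = y"
proof -
  obtain h where "h * g = 1"
  proof -
    have "\<exists>h. h * g = 1"
    proof (transfer, clarsimp simp: psl_rel_def)
      fix G :: "real^2^2" assume d: "det G = 1"
      have "adj2 G ** G = mat 1" using d by (simp add: adj2_def mat2 algebra_simps)
      moreover have "det (adj2 G) = 1" using d by (simp add: adj2_def mat2 algebra_simps)
      ultimately show "\<exists>H. det H = 1 \<and> det (H ** G) = 1 \<and> (H ** G = mat 1 \<or> H ** G = - mat 1)"
        using d by (auto simp: det_mul)
    qed
    then show ?thesis using that by blast
  qed
  then have "transport h (transport g y) = y" for y by (simp flip: transport_mult)
  then show ?thesis by (rule that)
qed

lemma iso_class_eq: "y \<in> iso_class x \<Longrightarrow> iso_class y = iso_class x"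
proof -
  assume "y \<in> iso_class x"
  then obtain g where y: "y = transport g x" by (auto simp: iso_class_transport)
  obtain h where h: "\<And>z. transport h (transport g z) = z" by (rule transport_inverse[where g = g]) blast
  show ?thesis
  proof (intro equalityI subsetI)
    fix z assume "z \<in> iso_class y"
    then show "z \<in> iso_class x" unfolding y iso_class_transport by (auto simp flip: transport_mult)
  next
    fix z assume "z \<in> iso_class x"
    then obtain k where "z = transport k x" by (auto simp: iso_class_transport)
    then have "z = transport (k * h) y" using h[of x] by (simp add: y transport_mult)
    then show "z \<in> iso_class y" by (auto simp: iso_class_transport)
  qed
qed

lemma self_iso_class: "y \<in> iso_class y"
  unfolding iso_class_transport by (rule range_eqI[of _ _ 1]) simp

lemma topspace_X: "topspace X_top = iso_class ` Sex"
  using quotient_map_iso_class by (auto simp: quotient_map_def)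

text \<open>A condition read off from the continuous \<open>product_entry\<close> and invariant under isometries defines an open
  set of classes.\<close>

lemma openin_sign:
  assumes "\<And>y. y \<in> Sex \<Longrightarrow> P y \<longleftrightarrow> product_entry y \<in> U" "open U" "\<And>y g. P y \<Longrightarrow> P (transport g y)"
  shows "openin X_top (iso_class ` {y \<in> Sex. P y})"
proof -
  have "{x \<in> Sex. iso_class x \<in> iso_class ` {y \<in> Sex. P y}} = {x \<in> Sex. P x}"
  proof (intro equalityI subsetI)
    fix x assume "x \<in> {x \<in> Sex. iso_class x \<in> iso_class ` {y \<in> Sex. P y}}"
    then obtain y where "x \<in> Sex" "P y" "iso_class x = iso_class y" by auto
    then obtain g where "x = transport g y" using self_iso_class[of x] by (auto simp: iso_class_transport)
    then show "x \<in> {x \<in> Sex. P x}" using \<open>x \<in> Sex\<close> \<open>P y\<close> assms(3) by blast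
  qed auto
  also have "\<dots> = Sex \<inter> product_entry -` U" using assms(1) by auto
  finally have e: "{x \<in> Sex. iso_class x \<in> iso_class ` {y \<in> Sex. P y}} = Sex \<inter> product_entry -` U" .
  have "open (product_entry -` U)" using continuous_product_entry assms(2) by (simp add: continuous_on_open_vimage)
  then show ?thesis unfolding openin_X_top e by (auto simp: openin_open)
qed

lemma negative_singular: "negative (\<chi> i. p)"
  unfolding negative_iff by (simp del: matrix_mul_assoc add: J_sq_left)

text \<open>The negative classes and the others are disjoint open sets covering \<open>X_top\<close>, and the singular class is
  negative.\<close>

lemma X0_negative:
  assumes x: "x \<in> X0" "c \<in> x"
  shows "negative c" "x = iso_class c"
proof -
  define A where "A = iso_class ` {y \<in> Sex. negative y}"
  define B where "B = iso_class ` {y \<in> Sex. \<not> negative y}"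
  have NN: "negative (transport g y) \<Longrightarrow> negative y" for g y by (rule transport_inverse[where g = g]) (metis negative_transport)
  have A: "openin X_top A" unfolding A_def
    by (rule openin_sign[of _ "{..<0}"]) (auto simp: product_entry_negative negative_transport dest: product_entry_pos)
  have B: "openin X_top B" unfolding B_def
    by (rule openin_sign[of _ "{0<..}"]) (auto simp: product_entry_negative dest: product_entry_pos NN)
  have disj: "A \<inter> B = {}"
  proof (rule ccontr)
    assume "A \<inter> B \<noteq> {}"
    then obtain y z where "negative y" "\<not> negative z" "iso_class z = iso_class y" by (auto simp: A_def B_def)
    then obtain g where "z = transport g y" using self_iso_class[of z] by (auto simp: iso_class_transport)
    then show False using \<open>negative y\<close> \<open>\<not> negative z\<close> negative_transport by blast
  qed
  have AB: "topspace X_top \<subseteq> A \<union> B" unfolding topspace_X A_def B_def by auto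
  have s: "singular_class \<in> A" unfolding A_def iso_class_singular[symmetric, of h2_i]
    using negative_singular[of h2_i] Sex_iff by blast
  have "connected_component_of X_top singular_class x" using x(1) by (simp add: X0_def)
  then obtain T where T: "connectedin X_top T" "singular_class \<in> T" "x \<in> T" unfolding connected_component_of_def by blast
  have TA: "T \<subseteq> topspace X_top" using T(1) by (simp add: connectedin_def)
  have "x \<in> A"
  proof (rule ccontr)
    assume "x \<notin> A"
    then have "x \<in> B" using AB TA T(3) by blast
    then show False using T A B disj AB TA s unfolding connectedin by blast
  qed
  then obtain y where y: "x = iso_class y" "negative y" by (auto simp: A_def)
  then show "x = iso_class c" using iso_class_eq x(2) by blast
  obtain g where "c = transport g y" using x(2) y(1) by (auto simp: iso_class_transport)
  then show "negative c" using y(2) negative_transport by blast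
qed

section \<open>Convergence to the singular class\<close>

lemma h2_tendsto:
  assumes "(\<lambda>n. of_h2 (z n)) \<longlonglongrightarrow> of_h2 p" shows "z \<longlonglongrightarrow> p"
proof (rule topological_tendstoI)
  fix S :: "h2 set" assume S: "open S" "p \<in> S"
  have "\<forall>\<^sub>F n in sequentially. of_h2 (z n) \<in> of_h2 ` S"
    by (rule topological_tendstoD[OF assms]) (use S in \<open>auto simp: open_h2_def\<close>)
  then show "\<forall>\<^sub>F n in sequentially. z n \<in> S" by (auto elim!: eventually_mono simp: of_h2_inject)
qed

text \<open>In the half plane, the squared Euclidean distance from \<open>\<i>\<close> is \<open>2 * Im z * (ch h2_i z - 1)\<close>, and \<open>Im z\<close>
  is at most \<open>2 * ch h2_i z\<close>.\<close>

lemma ch_tendsto_1: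
  assumes "(\<lambda>n. ch h2_i (z n)) \<longlonglongrightarrow> 1" shows "z \<longlonglongrightarrow> h2_i"
proof (rule h2_tendsto)
  have i: "of_h2 h2_i = \<i>" unfolding h2_i_def by (simp add: Abs_h2_inverse)
  have b: "(cmod (of_h2 w - \<i>))\<^sup>2 \<le> 4 * ch h2_i w * (ch h2_i w - 1)" for w
  proof -
    let ?y = "Im (of_h2 w)" and ?c = "ch h2_i w"
    have y: "0 < ?y" by simp
    have e: "(cmod (of_h2 w - \<i>))\<^sup>2 = 2 * ?y * (?c - 1)"
      unfolding ch_def i using less_imp_neq[OF y] by (simp add: norm_minus_commute)
    have "(?y - 1)\<^sup>2 \<le> (cmod (of_h2 w - \<i>))\<^sup>2" unfolding cmod_power2 by simp
    then have "?y\<^sup>2 + 1 \<le> 2 * ?y * ?c" unfolding e by (simp add: power2_eq_square algebra_simps)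
    then have "?y * ?y \<le> ?y * (2 * ?c)" unfolding power2_eq_square mult.left_commute[of ?y 2 ?c] mult.assoc by linarith
    then have "?y \<le> 2 * ?c" by (rule mult_left_le_imp_le) (rule y)
    then have "2 * ?y * (?c - 1) \<le> 2 * (2 * ?c) * (?c - 1)"
      using ch_ge_1[of h2_i w] by (intro mult_right_mono) auto
    then show ?thesis unfolding e by simp
  qed
  have "(\<lambda>n. 4 * ch h2_i (z n) * (ch h2_i (z n) - 1)) \<longlonglongrightarrow> 4 * 1 * (1 - 1)" by (intro tendsto_intros assms)
  then have "(\<lambda>n. 4 * ch h2_i (z n) * (ch h2_i (z n) - 1)) \<longlonglongrightarrow> 0" by simp
  then have "(\<lambda>n. (cmod (of_h2 (z n) - \<i>))\<^sup>2) \<longlonglongrightarrow> 0"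
    by (rule Lim_null_comparison[rotated]) (use b in \<open>auto intro!: always_eventually\<close>)
  then have "(\<lambda>n. sqrt ((cmod (of_h2 (z n) - \<i>))\<^sup>2)) \<longlonglongrightarrow> sqrt 0" by (rule tendsto_real_sqrt)
  then show "(\<lambda>n. of_h2 (z n)) \<longlonglongrightarrow> of_h2 h2_i" unfolding i by (simp add: tendsto_norm_zero_iff LIM_zero_iff)
qed

text \<open>Move the first vertices to \<open>h2_i\<close>; the other vertices then converge to it.\<close>

lemma limitin_singular:
  assumes y: "\<And>n. y n \<in> Sex" "\<And>n. links (e n) (y n)" and e: "e \<longlonglongrightarrow> 0"
  shows "limitin X_top (\<lambda>n. iso_class (y n)) singular_class sequentially"
  unfolding limitin_def
proof (intro conjI allI impI)
  have s: "singular_class = iso_class (\<chi> i. h2_i)" by (rule iso_class_singular[symmetric])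
  have sS: "(\<chi> i. h2_i) \<in> Sex" using negative_singular Sex_iff by blast
  show "singular_class \<in> topspace X_top" unfolding topspace_X s using sS by blast
  fix U assume U: "openin X_top U \<and> singular_class \<in> U"
  then obtain T where T: "open T" "{x \<in> Sex. iso_class x \<in> U} = Sex \<inter> T" unfolding openin_X_top by (auto simp: openin_open)
  have "(\<chi> i. h2_i) \<in> T" using T(2) sS U unfolding s by blast
  have "\<exists>g. g \<bullet>\<^sub>H (y n $ 1) = h2_i" for n by (rule psl_act_transitive)
  then obtain g where g: "\<And>n. g n \<bullet>\<^sub>H (y n $ 1) = h2_i" by metis
  define z where "z n = transport (g n) (y n)" for n
  have "(\<lambda>n. z n $ j) \<longlonglongrightarrow> h2_i" for j
  proof (rule ch_tendsto_1)
    have c: "ch h2_i (z n $ j) = cosh (hdist (y n $ 1) (y n $ j))" for n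
      unfolding z_def transport_nth g[symmetric, of n] by simp
    have "(\<lambda>n. hdist (y n $ 1) (y n $ j)) \<longlonglongrightarrow> 0"
    proof (rule Lim_null_comparison)
      show "\<forall>\<^sub>F n in sequentially. norm (hdist (y n $ 1) (y n $ j)) \<le> 5 * e n"
        using links_from_first[OF y(2)] by (auto intro!: always_eventually)
      show "(\<lambda>n. 5 * e n) \<longlonglongrightarrow> 0" using tendsto_mult_left[OF e, of 5] by simp
    qed
    then have "(\<lambda>n. cosh (hdist (y n $ 1) (y n $ j))) \<longlonglongrightarrow> cosh 0" by (rule tendsto_cosh)
    then show "(\<lambda>n. ch h2_i (z n $ j)) \<longlonglongrightarrow> 1" unfolding c by simp
  qed
  then have "z \<longlonglongrightarrow> (\<chi> i. h2_i)" by (intro vec_tendstoI) simp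
  from topological_tendstoD[OF this T(1) \<open>(\<chi> i. h2_i) \<in> T\<close>]
  show "\<forall>\<^sub>F n in sequentially. iso_class (y n) \<in> U"
  proof eventually_elim
    case (elim n)
    then have "iso_class (z n) \<in> U" using T(2) Sex_transport[OF y(1)] unfolding z_def by blast
    moreover have "z n \<in> iso_class (y n)" unfolding z_def iso_class_transport by blast
    ultimately show ?case using iso_class_eq by metis
  qed
qed

section \<open>Counter arithmetic\<close>

definition shift :: "nat \<Rightarrow> nat \<Rightarrow> procedure"
  where "shift a b = While (Neg (IsZero a)) (Seq (Decr a) (Incr b))"

definition double :: "nat \<Rightarrow> nat \<Rightarrow> procedure"
  where "double a b = While (Neg (IsZero a)) (Seq (Decr a) (Seq (Incr b) (Incr b)))"

definition halve :: "nat \<Rightarrow> nat \<Rightarrow> nat \<Rightarrow> procedure"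
  where "halve a q e = While (Neg (IsZero a))
     (Seq (Decr a) (Cond (IsZero a) (Incr e) (Seq (Decr a) (Incr q))))"

lemma run_shift:
  assumes "a \<noteq> b" shows "run d (shift a b) (\<delta>, r, k) (\<delta>, r, k(a := 0, b := k b + k a))"
proof (induction "k a" arbitrary: k)
  case 0
  then have e: "k(a := 0, b := k b + k a) = k" by auto
  show ?case unfolding e unfolding shift_def by (rule WhileFalse) (use 0 in simp)
next
  case (Suc n)
  let ?k = "k(a := k a - 1, b := k b + 1)"
  have 1: "run d (Seq (Decr a) (Incr b)) (\<delta>, r, k) (\<delta>, r, ?k)"
    using run.Incr[of d b \<delta> r "k(a := k a - 1)"] assms by (intro run.Seq[OF run.Decr]) simp
  have "n = ?k a" using Suc(2) assms by simp
  from Suc(1)[of ?k, OF this] have 2: "run d (shift a b) (\<delta>, r, ?k) (\<delta>, r, ?k(a := 0, b := ?k b + ?k a))" .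
  have e: "?k(a := 0, b := ?k b + ?k a) = k(a := 0, b := k b + k a)" using assms Suc(2) by (auto simp: fun_eq_iff)
  show ?case using 2 Suc(2) unfolding e unfolding shift_def by (intro WhileTrue[OF _ 1]) auto
qed

lemma run_double:
  assumes "a \<noteq> b" shows "run d (double a b) (\<delta>, r, k) (\<delta>, r, k(a := 0, b := k b + 2 * k a))"
proof (induction "k a" arbitrary: k)
  case 0
  then have e: "k(a := 0, b := k b + 2 * k a) = k" by auto
  show ?case unfolding e unfolding double_def by (rule WhileFalse) (use 0 in simp)
next
  case (Suc n)
  let ?k = "k(a := k a - 1, b := k b + 2)"
  have 1: "run d (Seq (Decr a) (Seq (Incr b) (Incr b))) (\<delta>, r, k) (\<delta>, r, ?k)"
    using run.Incr[of d b \<delta> r "k(a := k a - 1, b := k b + 1)"] run.Incr[of d b \<delta> r "k(a := k a - 1)"] assms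
    by (intro run.Seq[OF run.Decr] run.Seq) simp_all
  have "n = ?k a" using Suc(2) assms by simp
  from Suc(1)[of ?k, OF this] have 2: "run d (double a b) (\<delta>, r, ?k) (\<delta>, r, ?k(a := 0, b := ?k b + 2 * ?k a))" .
  have e: "?k(a := 0, b := ?k b + 2 * ?k a) = k(a := 0, b := k b + 2 * k a)" using assms Suc(2) by (auto simp: fun_eq_iff)
  show ?case using 2 Suc(2) unfolding e unfolding double_def by (intro WhileTrue[OF _ 1]) auto
qed

lemma run_halve:
  assumes "a \<noteq> q" "a \<noteq> e" "q \<noteq> e"
  shows "run d (halve a q e) (\<delta>, r, k) (\<delta>, r, k(a := 0, q := k q + k a div 2, e := k e + k a mod 2))"
proof (induction "k a" arbitrary: k rule: less_induct)
  case less
  consider "k a = 0" | "k a = 1" | n where "k a = Suc (Suc n)" by (metis One_nat_def not0_implies_Suc)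
  then show ?case
  proof cases
    case 1
    then have e: "k(a := 0, q := k q + k a div 2, e := k e + k a mod 2) = k" by auto
    show ?thesis unfolding e unfolding halve_def by (rule WhileFalse) (use 1 in simp)
  next
    case 2
    let ?k = "k(a := 0, e := k e + 1)"
    have r: "run d (Seq (Decr a) (Cond (IsZero a) (Incr e) (Seq (Decr a) (Incr q)))) (\<delta>, r, k) (\<delta>, r, ?k)"
      using run.Incr[of d e \<delta> r "k(a := k a - 1)"] assms 2
      by (intro run.Seq[OF run.Decr] run.CondTrue) simp_all
    have e: "k(a := 0, q := k q + k a div 2, e := k e + k a mod 2) = ?k" using assms 2 by (auto simp: fun_eq_iff)
    have "run d (halve a q e) (\<delta>, r, ?k) (\<delta>, r, ?k)"
      unfolding halve_def using assms by (intro WhileFalse) simp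
    then show ?thesis using 2 unfolding e unfolding halve_def by (intro WhileTrue[OF _ r]) auto
  next
    case 3
    let ?k = "k(a := n, q := k q + 1)"
    have r: "run d (Seq (Decr a) (Cond (IsZero a) (Incr e) (Seq (Decr a) (Incr q)))) (\<delta>, r, k) (\<delta>, r, ?k)"
      using run.Decr[of d a \<delta> r "k(a := k a - 1)"] run.Incr[of d q \<delta> r "k(a := k a - 1 - 1)"] assms 3
      by (intro run.Seq[OF run.Decr] run.CondFalse run.Seq) simp_all
    have "?k a < k a" using 3 assms by simp
    from less[of ?k, OF this] have r2: "run d (halve a q e) (\<delta>, r, ?k) (\<delta>, r, ?k(a := 0, q := ?k q + ?k a div 2, e := ?k e + ?k a mod 2))" .
    have e: "?k(a := 0, q := ?k q + ?k a div 2, e := ?k e + ?k a mod 2) = k(a := 0, q := k q + k a div 2, e := k e + k a mod 2)"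
      using assms 3 by (auto simp: fun_eq_iff)
    show ?thesis using r2 3 unfolding e unfolding halve_def by (intro WhileTrue[OF _ r]) auto
  qed
qed

section \<open>Words of moves\<close>

text \<open>Bijective base 2: the digits are 1 and 2 and the empty word has code 0, so every natural number is the
  code of exactly one word.\<close>

fun code :: "bool list \<Rightarrow> nat" where
  "code [] = 0"
| "code (b # w) = 2 * code w + (if b then 2 else 1)"

lemma code_surj: "\<exists>w. code w = n"
proof (induction n rule: less_induct)
  case (less n)
  show ?case
  proof (cases "n = 0")
    case True
    then show ?thesis by (intro exI[of _ "[]"]) simp
  next
    case False
    then have "(n - 1) div 2 < n" by simp
    then obtain w where w: "code w = (n - 1) div 2" using less by blast
    have "code ((odd (n - 1)) # w) = n" using False w by (auto elim!: evenE oddE)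
    then show ?thesis by blast
  qed
qed

lemma code_inject: "code v = code w \<Longrightarrow> v = w"
proof (induction v arbitrary: w)
  case Nil
  then show ?case by (cases w) (auto split: if_splits)
next
  case (Cons b v)
  from Cons.prems obtain c w' where w: "w = c # w'" by (cases w) (auto split: if_splits)
  have "2 * code v + (if b then 2 else 1) = 2 * code w' + (if c then 2 else 1)" using Cons.prems w by simp
  then have "code v = code w' \<and> b = c" by (cases b; cases c; simp; presburger)
  then show ?case using Cons.IH w by blast
qed

text \<open>The letter \<open>True\<close> is the first move, and \<open>False\<close> acts as the rotation of the indices by
  \<open>rot_leapfrogs\<close>.\<close>

definition apply_letter :: "bool \<Rightarrow> (config \<Rightarrow> config) \<Rightarrow> config \<Rightarrow> config"
  where "apply_letter b \<delta> = (if b then leapfrog_elt 1 \<otimes>\<^bsub>SexGroup\<^esub> \<delta>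
    else leapfrog_elt 5 \<otimes>\<^bsub>SexGroup\<^esub> (leapfrog_elt 4 \<otimes>\<^bsub>SexGroup\<^esub> (leapfrog_elt 3 \<otimes>\<^bsub>SexGroup\<^esub>
      (leapfrog_elt 2 \<otimes>\<^bsub>SexGroup\<^esub> (leapfrog_elt 1 \<otimes>\<^bsub>SexGroup\<^esub> \<delta>)))))"

abbreviation unleapfrog_elt :: "6 \<Rightarrow> config \<Rightarrow> config"
  where "unleapfrog_elt i \<equiv> inv\<^bsub>SexGroup\<^esub> (leapfrog_elt i)"

definition undo_letter :: "bool \<Rightarrow> (config \<Rightarrow> config) \<Rightarrow> config \<Rightarrow> config"
  where "undo_letter b \<delta> = (if b then unleapfrog_elt 1 \<otimes>\<^bsub>SexGroup\<^esub> \<delta>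
    else unleapfrog_elt 1 \<otimes>\<^bsub>SexGroup\<^esub> (unleapfrog_elt 2 \<otimes>\<^bsub>SexGroup\<^esub> (unleapfrog_elt 3 \<otimes>\<^bsub>SexGroup\<^esub>
      (unleapfrog_elt 4 \<otimes>\<^bsub>SexGroup\<^esub> (unleapfrog_elt 5 \<otimes>\<^bsub>SexGroup\<^esub> \<delta>)))))"

lemma unleap_cancel: "\<delta> \<in> carrier SexGroup \<Longrightarrow> unleapfrog_elt i \<otimes>\<^bsub>SexGroup\<^esub> (leapfrog_elt i \<otimes>\<^bsub>SexGroup\<^esub> \<delta>) = \<delta>"
  by (simp add: leapfrog_elt_carrier SexG.l_inv flip: SexG.m_assoc)

lemma apply_letter_carrier: "\<delta> \<in> carrier SexGroup \<Longrightarrow> apply_letter b \<delta> \<in> carrier SexGroup"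
  by (simp add: apply_letter_def leapfrog_elt_carrier)

lemma undo_apply_letter: "\<delta> \<in> carrier SexGroup \<Longrightarrow> undo_letter b (apply_letter b \<delta>) = \<delta>"
  by (simp add: apply_letter_def undo_letter_def leapfrog_elt_carrier unleap_cancel)

lemma apply_letter_Mod_So: "\<delta> \<in> Mod_So \<Longrightarrow> apply_letter b \<delta> \<in> Mod_So"
  by (simp add: apply_letter_def Mod_So_mult Mod_So_leapfrog)

lemma fold_apply_letter_Mod_So: "\<delta> \<in> Mod_So \<Longrightarrow> fold apply_letter w \<delta> \<in> Mod_So"
  by (induction w arbitrary: \<delta>) (simp_all add: apply_letter_Mod_So)

lemma fold_undo_letter: "\<delta> \<in> carrier SexGroup \<Longrightarrow> fold undo_letter (rev w) (fold apply_letter w \<delta>) = \<delta>"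
  by (induction w arbitrary: \<delta>) (simp_all add: apply_letter_carrier undo_apply_letter)

definition step :: "bool \<Rightarrow> config \<Rightarrow> config"
  where "step b = (if b then leapfrog 1 else rot)"

lemma apply_letter_at: "\<delta> \<in> carrier SexGroup \<Longrightarrow> y \<in> Sex \<Longrightarrow> apply_letter b \<delta> y = step b (\<delta> y)"
  by (simp add: apply_letter_def step_def mult_apply leapfrog_elt_carrier leapfrog_elt_apply carrier_apply leapfrog_in_Sex rot_leapfrogs)

lemma fold_apply_letter_at: "\<delta> \<in> carrier SexGroup \<Longrightarrow> y \<in> Sex \<Longrightarrow> fold apply_letter w \<delta> y = fold step w (\<delta> y)"
  by (induction w arbitrary: \<delta>) (simp_all add: apply_letter_carrier apply_letter_at)

lemma step_Sex: "y \<in> Sex \<Longrightarrow> step b y \<in> Sex"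
  by (simp add: step_def leapfrog_in_Sex rot_leapfrogs)

lemma fold_step_Sex: "y \<in> Sex \<Longrightarrow> fold step w y \<in> Sex"
  by (induction w arbitrary: y) (simp_all add: step_Sex)

lemma fold_step_transport: "fold step w (transport g y) = transport g (fold step w y)"
  by (induction w arbitrary: y) (simp_all add: step_def leapfrog_transport rot_transport)

text \<open>The rotation has order 6 and conjugates the moves into one another; the inverse of the first move is the
  product of five rotations with the moves 2 to 5.  So inverses are not needed as letters.\<close>

lemma Mod_So_word:
  assumes "\<gamma> \<in> Mod_So" "c \<in> Sex" shows "\<exists>w. \<gamma> c = fold step w c"
proof -
  define S where "S = {fold step w c |w. True}"
  have st: "step b y \<in> S" if y: "y \<in> S" for b y
  proof -
    obtain w where "y = fold step w c" using y by (auto simp: S_def)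
    then have "step b y = fold step (w @ [b]) c" by simp
    then show ?thesis unfolding S_def by blast
  qed
  have r: "rot y \<in> S" and l1: "leapfrog 1 y \<in> S" if "y \<in> S" for y
    using st[OF that, of False] st[OF that, of True] by (simp_all add: step_def)
  have r5: "y \<in> S" if "rot y \<in> S" for y
    using r[OF r[OF r[OF r[OF r[OF that]]]]] unfolding rot6 .
  have ls: "leapfrog (i + 1) y \<in> S" if "\<And>y. y \<in> S \<Longrightarrow> leapfrog i y \<in> S" "y \<in> S" for i y
    by (rule r5) (use that(1)[OF r[OF that(2)]] in \<open>simp only: leapfrog_rot\<close>)
  have l2: "leapfrog 2 y \<in> S" if "y \<in> S" for y using ls[OF l1 that] by simp
  have l3: "leapfrog 3 y \<in> S" if "y \<in> S" for y using ls[OF l2 that] by simp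
  have l4: "leapfrog 4 y \<in> S" if "y \<in> S" for y using ls[OF l3 that] by simp
  have l5: "leapfrog 5 y \<in> S" if "y \<in> S" for y using ls[OF l4 that] by simp
  have six: "(5 + 1 :: 6) = 6" by simp
  have l6: "leapfrog 6 y \<in> S" if "y \<in> S" for y using ls[OF l5 that] unfolding six .
  have l: "leapfrog i y \<in> S" if "y \<in> S" for i y
    using exhaust_6[of i] by (elim disjE; hypsubst) (rule l1 l2 l3 l4 l5 l6, rule that)+
  have Sex: "S \<subseteq> Sex" using fold_step_Sex[OF assms(2)] by (auto simp: S_def)
  have u1: "unleap 1 y \<in> S" if "y \<in> S" for y
  proof (rule r5)
    have "unleap 1 y \<in> Sex" using that Sex by (auto intro: Sex_unleap)
    from rot_leapfrogs[OF this] have "rot (unleap 1 y) = leapfrog 5 (leapfrog 4 (leapfrog 3 (leapfrog 2 y)))" by simp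
    then show "rot (unleap 1 y) \<in> S" using that l by simp
  qed
  have us: "unleap (i + 1) y \<in> S" if "\<And>y. y \<in> S \<Longrightarrow> unleap i y \<in> S" "y \<in> S" for i y
  proof (rule r5)
    have "leapfrog i (rot (unleap (i + 1) y)) = rot y" unfolding leapfrog_rot by simp
    then have "rot (unleap (i + 1) y) = unleap i (rot y)" by (metis unleap_leapfrog)
    then show "rot (unleap (i + 1) y) \<in> S" using that(1)[OF r[OF that(2)]] by simp
  qed
  have u2: "unleap 2 y \<in> S" if "y \<in> S" for y using us[OF u1 that] by simp
  have u3: "unleap 3 y \<in> S" if "y \<in> S" for y using us[OF u2 that] by simp
  have u4: "unleap 4 y \<in> S" if "y \<in> S" for y using us[OF u3 that] by simp
  have u5: "unleap 5 y \<in> S" if "y \<in> S" for y using us[OF u4 that] by simp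
  have u6: "unleap 6 y \<in> S" if "y \<in> S" for y using us[OF u5 that] unfolding six .
  have u: "unleap i y \<in> S" if "y \<in> S" for i y
    using exhaust_6[of i] by (elim disjE; hypsubst) (rule u1 u2 u3 u4 u5 u6, rule that)+
  have "fold step [] c \<in> S" unfolding S_def by blast
  then have "\<gamma> c \<in> S" by (intro Mod_So_closed[OF assms(1) Sex]) (simp_all add: l u)
  then show ?thesis by (auto simp: S_def)
qed

section \<open>Reading a word from a counter\<close>

definition letter_proc :: "bool \<Rightarrow> procedure"
  where "letter_proc b = (if b then Leap 1 else Seq (Leap 1) (Seq (Leap 2) (Seq (Leap 3) (Seq (Leap 4) (Leap 5)))))"

definition unletter_proc :: "bool \<Rightarrow> procedure"
  where "unletter_proc b = (if b then Unleap 1 else Seq (Unleap 5) (Seq (Unleap 4) (Seq (Unleap 3) (Seq (Unleap 2) (Unleap 1)))))"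

lemma run_letter_proc: "run d (letter_proc b) (\<delta>, r, k) (apply_letter b \<delta>, r, k)"
  unfolding letter_proc_def apply_letter_def by (auto intro!: run.Seq run.Leap intro: run.Leap)

lemma run_unletter_proc: "run d (unletter_proc b) (\<delta>, r, k) (undo_letter b \<delta>, r, k)"
  unfolding unletter_proc_def undo_letter_def by (auto intro!: run.Seq run.Unleap intro: run.Unleap)

text \<open>One letter is taken from the counter \<open>a\<close>, executed, and pushed onto the counter \<open>b\<close>.  The counters 3 and
  4 are 0 before and after.\<close>

definition read_letter :: "(bool \<Rightarrow> procedure) \<Rightarrow> nat \<Rightarrow> nat \<Rightarrow> procedure"
  where "read_letter A a b = Seq (Decr a) (Seq (halve a 3 4) (Seq (shift 3 a) (Seq (double b 3) (Seq (shift 3 b)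
    (Seq (Incr b) (Cond (IsZero 4) (A False) (Seq (Decr 4) (Seq (Incr b) (A True)))))))))"

lemma run_read_letter:
  assumes A: "\<And>x \<delta> r k. run d (A x) (\<delta>, r, k) (m x \<delta>, r, k)"
    and ab: "a \<noteq> b" "a \<notin> {3, 4}" "b \<notin> {3, 4}" and k: "k 3 = 0" "k 4 = 0" "k a = code (x # w)" "k b = code v"
  shows "run d (read_letter A a b) (\<delta>, r, k) (m x \<delta>, r, k(a := code w, b := code (x # v)))"
proof -
  let ?n = "k a - 1"
  have n: "?n div 2 = code w" "?n mod 2 = (if x then 1 else 0)" using k(3) by auto
  define k1 where "k1 = k(a := k a - 1)"
  define k2 where "k2 = k1(a := 0, 3 := k1 3 + k1 a div 2, 4 := k1 4 + k1 a mod 2)"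
  define k3 where "k3 = k2(3 := 0, a := k2 a + k2 3)"
  define k4 where "k4 = k3(b := 0, 3 := k3 3 + 2 * k3 b)"
  define k5 where "k5 = k4(3 := 0, b := k4 b + k4 3)"
  define k6 where "k6 = k5(b := k5 b + 1)"
  have k6: "k6 = k(a := code w, b := 2 * code v + 1, 4 := if x then 1 else 0)"
    unfolding k6_def k5_def k4_def k3_def k2_def k1_def using ab k(1,2,4) n by (auto simp: fun_eq_iff)
  have r: "run d (Decr a) (\<delta>, r, k) (\<delta>, r, k1)" "run d (halve a 3 4) (\<delta>, r, k1) (\<delta>, r, k2)"
    "run d (shift 3 a) (\<delta>, r, k2) (\<delta>, r, k3)" "run d (double b 3) (\<delta>, r, k3) (\<delta>, r, k4)"
    "run d (shift 3 b) (\<delta>, r, k4) (\<delta>, r, k5)" "run d (Incr b) (\<delta>, r, k5) (\<delta>, r, k6)"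
    unfolding k6_def k5_def k4_def k3_def k2_def k1_def using ab
    by (intro run.Decr run_halve run_shift run_double run.Incr; auto)+
  have "run d (Cond (IsZero 4) (A False) (Seq (Decr 4) (Seq (Incr b) (A True)))) (\<delta>, r, k6) (m x \<delta>, r, k(a := code w, b := code (x # v)))"
  proof (cases x)
    case False
    have "k6 = k(a := code w, b := code (x # v))" unfolding k6 using False ab k(2) by (auto simp: fun_eq_iff)
    moreover have "k6 4 = 0" unfolding k6 using False by simp
    ultimately show ?thesis using A[of False \<delta> r k6] False by (intro CondTrue) auto
  next
    case True
    let ?k7 = "k6(4 := k6 4 - 1)"
    let ?k8 = "?k7(b := ?k7 b + 1)"
    have "?k8 = k(a := code w, b := code (x # v))" unfolding k6 using True ab k(2) by (auto simp: fun_eq_iff)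
    moreover have "k6 4 \<noteq> 0" unfolding k6 using True by simp
    moreover have "run d (Seq (Decr 4) (Seq (Incr b) (A True))) (\<delta>, r, k6) (m True \<delta>, r, ?k8)"
      by (rule run.Seq[OF run.Decr run.Seq[OF run.Incr A]])
    ultimately show ?thesis using True by (intro CondFalse) auto
  qed
  with r show ?thesis unfolding read_letter_def by (intro run.Seq)
qed

text \<open>Reading a word from \<open>a\<close> leaves the reversed word in \<open>b\<close>.  Reading this back with inverse moves undoes
  the moves and restores \<open>a\<close>.\<close>

definition read_word :: "(bool \<Rightarrow> procedure) \<Rightarrow> nat \<Rightarrow> nat \<Rightarrow> procedure"
  where "read_word A a b = While (Neg (IsZero a)) (read_letter A a b)"

lemma run_read_word:
  assumes A: "\<And>x \<delta> r k. run d (A x) (\<delta>, r, k) (m x \<delta>, r, k)"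
    and ab: "a \<noteq> b" "a \<notin> {3, 4}" "b \<notin> {3, 4}" and k: "k 3 = 0" "k 4 = 0" "k a = code w" "k b = code v"
  shows "run d (read_word A a b) (\<delta>, r, k) (fold m w \<delta>, r, k(a := 0, b := code (rev w @ v)))"
  using k
proof (induction w arbitrary: v \<delta> k)
  case Nil
  then have e: "k(a := 0, b := code (rev [] @ v)) = k" by auto
  show ?case unfolding e fold_Nil id_apply unfolding read_word_def by (rule WhileFalse) (use Nil in simp)
next
  case (Cons x w)
  let ?k = "k(a := code w, b := code (x # v))"
  have 1: "run d (read_letter A a b) (\<delta>, r, k) (m x \<delta>, r, ?k)"
    by (rule run_read_letter[OF A ab Cons.prems])
  have "?k 3 = 0" "?k 4 = 0" "?k a = code w" "?k b = code (x # v)" using ab Cons.prems by auto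
  from Cons.IH[OF this] have 2: "run d (read_word A a b) (m x \<delta>, r, ?k) (fold m (x # w) \<delta>, r, ?k(a := 0, b := code (rev (x # w) @ v)))"
    by (simp only: fold_Cons o_apply rev.simps append_assoc append_Cons append_Nil)
  have e: "?k(a := 0, b := code (rev (x # w) @ v)) = k(a := 0, b := code (rev (x # w) @ v))" using ab(1) by (auto simp: fun_eq_iff)
  have "holds d (\<delta>, r, k) (Neg (IsZero a))" using Cons.prems(3) by simp
  from WhileTrue[OF this 1 2[unfolded e read_word_def]] show ?case unfolding read_word_def .
qed

section \<open>Testing whether a chain is halved\<close>

text \<open>Equivalently, the longest link of \<open>z\<close> is less than half the longest link of \<open>y\<close>; this form is a Boolean
  combination of comparisons of two lengths.\<close>

definition shorter :: "config \<Rightarrow> config \<Rightarrow> bool"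
  where "shorter y z \<longleftrightarrow> (\<forall>i\<in>{1, 2, 3, 4, 5}. \<exists>j\<in>{1, 2, 3, 4, 5}. 2 * hdist (z $ i) (z $ (i + 1)) < hdist (y $ j) (y $ (j + 1)))"

lemma shorter_links:
  assumes "shorter y z" "links e y" shows "links (e / 2) z"
proof -
  have e: "hdist (y $ j) (y $ (j + 1)) \<le> e" if "j \<in> {1, 2, 3, 4, 5}" for j using that assms(2) by (auto simp: links_def)
  have "hdist (z $ i) (z $ (i + 1)) \<le> e / 2" if i: "i \<in> {1, 2, 3, 4, 5}" for i
  proof -
    obtain j where "j \<in> {1, 2, 3, 4, 5}" "2 * hdist (z $ i) (z $ (i + 1)) < hdist (y $ j) (y $ (j + 1))"
      using assms(1) i unfolding shorter_def by blast
    then show ?thesis using e[of j] by linarith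
  qed
  from this[of 1] this[of 2] this[of 3] this[of 4] this[of 5] show ?thesis by (simp add: links_def)
qed

lemma shorter_transport: "shorter (transport g y) (transport h z) \<longleftrightarrow> shorter y z"
  by (simp add: shorter_def hdist_eq)

text \<open>A configuration that is not pinched has a link of positive length, and \<open>small_links\<close> goes below a third
  of it.\<close>

lemma shorter_exists:
  assumes c: "negative c" "\<not> pinched c"
  shows "\<exists>w. shorter c (fold step w c)"
proof -
  have cS: "c \<in> Sex" using c Sex_iff by blast
  have "transport 1 (\<one>\<^bsub>SexGroup\<^esub> c) \<in> orbit c" unfolding orbit_def using Mod_So_one by blast
  then have "c \<in> orbit c" using one_apply[OF cS] by simp
  then have "\<not> collapsed c" by (rule orbit_not_collapsed[OF cS c(2)])
  then obtain j where j: "j \<in> {1, 2, 3, 4, 5}" "c $ j \<noteq> c $ (j + 1)"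
  proof -
    have "c $ 1 \<noteq> c $ 2 \<or> c $ 3 \<noteq> c $ 4 \<or> c $ 5 \<noteq> c $ 6" using \<open>\<not> collapsed c\<close> by (simp add: collapsed_def)
    then show ?thesis using that[of 1] that[of 3] that[of 5] by auto
  qed
  have "hdist (c $ j) (c $ (j + 1)) \<noteq> 0" using j(2) cosh_hdist[of "c $ j" "c $ (j + 1)"] by (metis ch_eq_1 cosh_0)
  then have p: "0 < hdist (c $ j) (c $ (j + 1))" using hdist_nonneg[of "c $ j" "c $ (j + 1)"] by linarith
  let ?e = "hdist (c $ j) (c $ (j + 1)) / 3"
  obtain \<gamma> where \<gamma>: "\<gamma> \<in> Mod_So" "links ?e (\<gamma> c)" using small_links[OF c, of ?e] p by auto
  obtain w where w: "\<gamma> c = fold step w c" using Mod_So_word[OF \<gamma>(1) cS] by blast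
  have "2 * hdist (\<gamma> c $ i) (\<gamma> c $ (i + 1)) < hdist (c $ j) (c $ (j + 1))" if "i \<in> {1, 2, 3, 4, 5}" for i
  proof -
    have "hdist (\<gamma> c $ i) (\<gamma> c $ (i + 1)) \<le> ?e" using that \<gamma>(2) by (auto simp: links_def)
    then show ?thesis using p by linarith
  qed
  then show ?thesis using j(1) unfolding shorter_def w by blast
qed

lemma hdist_half_turn: "hdist p (half_turn q \<bullet>\<^sub>H p) = 2 * hdist p q"
proof -
  have "ch p (half_turn q \<bullet>\<^sub>H p) = 2 * (ch p q)\<^sup>2 - 1"
    unfolding ch_trace[of p "half_turn q \<bullet>\<^sub>H p"] J_half_turn matrix_mult_uminus trace_minus matrix_mul_assoc trace4
    by (simp add: ch_sym[of q p] power2_eq_square)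
  then have "cosh (hdist p (half_turn q \<bullet>\<^sub>H p)) = cosh (2 * hdist p q)" by (simp add: cosh_double_cosh)
  then show ?thesis
    using cosh_real_nonneg_le_iff[of "hdist p (half_turn q \<bullet>\<^sub>H p)" "2 * hdist p q"] cosh_real_nonneg_le_iff[of "2 * hdist p q" "hdist p (half_turn q \<bullet>\<^sub>H p)"]
    by simp
qed

text \<open>The move \<open>i\<close> replaces \<open>x\<^bsub>i+1\<^esub>\<close> by a point at twice the distance from the old \<open>x\<^bsub>i\<^esub>\<close>; the two points are
  kept for comparison and the move is taken back.\<close>

definition probe :: "nat \<Rightarrow> 6 \<Rightarrow> procedure"
  where "probe n i = Seq (Copy (10 + n) (Vertex i)) (Seq (Leap i) (Seq (Copy (20 + n) (Vertex (i + 1))) (Unleap i)))"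

lemma run_probe:
  assumes "\<delta> \<in> carrier SexGroup" "d \<in> Sex"
  shows "run d (probe n i) (\<delta>, r, k) (\<delta>, r(10 + n := \<delta> d $ i, 20 + n := half_turn (\<delta> d $ (i + 1)) \<bullet>\<^sub>H \<delta> d $ i), k)"
proof -
  let ?l = "leapfrog_elt i \<otimes>\<^bsub>SexGroup\<^esub> \<delta>"
  have e: "?l d $ (i + 1) = half_turn (\<delta> d $ (i + 1)) \<bullet>\<^sub>H \<delta> d $ i"
    using assms by (simp add: mult_apply leapfrog_elt_carrier leapfrog_elt_apply carrier_apply) (simp add: leapfrog_def)
  have 1: "run d (Copy (10 + n) (Vertex i)) (\<delta>, r, k) (\<delta>, r(10 + n := \<delta> d $ i), k)"
    using run.Copy[of d "10 + n" "Vertex i" \<delta> r k] by simp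
  have 2: "run d (Copy (20 + n) (Vertex (i + 1))) (?l, r', k) (?l, r'(20 + n := half_turn (\<delta> d $ (i + 1)) \<bullet>\<^sub>H \<delta> d $ i), k)" for r'
    using run.Copy[of d "20 + n" "Vertex (i + 1)" ?l r' k] unfolding pt.simps e .
  have 3: "run d (Unleap i) (?l, r', k) (\<delta>, r', k)" for r'
    using run.Unleap[of d i ?l r' k] unfolding unleap_cancel[OF assms(1)] .
  show ?thesis unfolding probe_def
    by (rule run.Seq[OF 1 run.Seq[OF run.Leap run.Seq[OF 2 3]]])
qed

text \<open>The empty conjunction is a test that always succeeds.\<close>

fun all_of :: "test list \<Rightarrow> test" where
  "all_of [] = Same (Aux 0) (Aux 0)"
| "all_of (t # ts) = Both t (all_of ts)"

lemma holds_all_of: "holds d s (all_of ts) \<longleftrightarrow> (\<forall>t\<in>set ts. holds d s t)"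
  by (induction ts) simp_all

definition any_of :: "test list \<Rightarrow> test"
  where "any_of ts = Neg (all_of (map Neg ts))"

lemma holds_any_of: "holds d s (any_of ts) \<longleftrightarrow> (\<exists>t\<in>set ts. holds d s t)"
  by (auto simp: any_of_def holds_all_of)

definition probes :: procedure
  where "probes = Seq (probe 1 1) (Seq (probe 2 2) (Seq (probe 3 3) (Seq (probe 4 4) (probe 5 5))))"

definition shorter_test :: test
  where "shorter_test = all_of (map (\<lambda>n. any_of (map (\<lambda>m. Closer (Aux (10 + n)) (Aux (20 + n)) (Aux m) (Aux (m + 1))) [1, 2, 3, 4, 5])) [1, 2, 3, 4, 5])"

definition saved :: "config \<Rightarrow> (nat \<Rightarrow> h2) \<Rightarrow> bool"
  where "saved y r \<longleftrightarrow> r 1 = y$1 \<and> r 2 = y$2 \<and> r 3 = y$3 \<and> r 4 = y$4 \<and> r 5 = y$5 \<and> r 6 = y$6"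

lemma run_probes:
  assumes "\<delta> \<in> carrier SexGroup" "d \<in> Sex" "saved y r"
  obtains r' where "run d probes (\<delta>, r, k) (\<delta>, r', k)" "saved y r'" "holds d (\<delta>, r', k) shorter_test \<longleftrightarrow> shorter y (\<delta> d)"
proof -
  let ?z = "\<delta> d"
  let ?u = "\<lambda>(n::nat) (i::6) r. r(10 + n := ?z $ i, 20 + n := half_turn (?z $ (i + 1)) \<bullet>\<^sub>H ?z $ i)"
  define r' where "r' = ?u 5 5 (?u 4 4 (?u 3 3 (?u 2 2 (?u 1 1 r))))"
  have 1: "run d probes (\<delta>, r, k) (\<delta>, r', k)"
    unfolding probes_def r'_def
    by (rule run.Seq[OF run_probe[OF assms(1,2)] run.Seq[OF run_probe[OF assms(1,2)] run.Seq[OF run_probe[OF assms(1,2)]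
      run.Seq[OF run_probe[OF assms(1,2)] run_probe[OF assms(1,2)]]]]])
  have 2: "saved y r'" using assms(3) unfolding saved_def r'_def by simp
  have v: "r' 11 = ?z$1" "r' 12 = ?z$2" "r' 13 = ?z$3" "r' 14 = ?z$4" "r' 15 = ?z$5"
    "r' 21 = half_turn (?z$2) \<bullet>\<^sub>H ?z$1" "r' 22 = half_turn (?z$3) \<bullet>\<^sub>H ?z$2" "r' 23 = half_turn (?z$4) \<bullet>\<^sub>H ?z$3"
    "r' 24 = half_turn (?z$5) \<bullet>\<^sub>H ?z$4" "r' 25 = half_turn (?z$6) \<bullet>\<^sub>H ?z$5"
    unfolding r'_def by simp_all
  have 3: "holds d (\<delta>, r', k) shorter_test \<longleftrightarrow> shorter y (\<delta> d)"
    using 2 unfolding shorter_test_def holds_all_of holds_any_of shorter_def saved_def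
    by (simp add: holds_any_of v hdist_half_turn flip: numeral_2_eq_2)
  show ?thesis by (rule that[OF 1 2 3])
qed

definition save :: procedure
  where "save = Seq (Copy 1 (Vertex 1)) (Seq (Copy 2 (Vertex 2)) (Seq (Copy 3 (Vertex 3)) (Seq (Copy 4 (Vertex 4))
    (Seq (Copy 5 (Vertex 5)) (Copy 6 (Vertex 6))))))"

lemma run_save: obtains r' where "run d save (\<delta>, r, k) (\<delta>, r', k)" "saved (\<delta> d) r'"
proof -
  have c: "run d (Copy n (Vertex i)) (\<delta>, r, k) (\<delta>, r(n := \<delta> d $ i), k)" for n i r
    using run.Copy[of d n "Vertex i" \<delta> r k] by simp
  show ?thesis
    by (rule that[of "r(1 := \<delta> d $ 1, 2 := \<delta> d $ 2, 3 := \<delta> d $ 3, 4 := \<delta> d $ 4, 5 := \<delta> d $ 5, 6 := \<delta> d $ 6)"])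
      (simp_all add: save_def saved_def run.Seq[OF c run.Seq[OF c run.Seq[OF c run.Seq[OF c run.Seq[OF c c]]]]])
qed

section \<open>The search procedure\<close>

definition attempt :: procedure
  where "attempt = Seq (read_word letter_proc 1 2) probes"

text \<open>Counter 1 holds the code of the word to be tried; counter 2 is the reversed word for taking it back.\<close>

definition search :: procedure
  where "search = Seq save (Seq attempt (While (Neg shorter_test)
    (Seq (read_word unletter_proc 2 1) (Seq (Incr 1) attempt))))"

definition the_word :: "nat \<Rightarrow> bool list"
  where "the_word n = (SOME w. code w = n)"

lemma code_the_word: "code (the_word n) = n"
  unfolding the_word_def using someI_ex[OF code_surj] .

lemma the_word_code: "the_word (code w) = w"
  by (rule code_inject) (rule code_the_word)

abbreviation "word_elt n \<equiv> fold apply_letter (the_word n) \<one>\<^bsub>SexGroup\<^esub>"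

lemma run_attempt:
  assumes d: "d \<in> Sex" and r: "saved d r" and k: "k 1 = n" "\<And>j. j \<noteq> 1 \<Longrightarrow> k j = 0"
  obtains r' where "run d attempt (\<one>\<^bsub>SexGroup\<^esub>, r, k) (word_elt n, r', (\<lambda>_. 0)(2 := code (rev (the_word n))))"
    "saved d r'" "\<And>k. holds d (word_elt n, r', k) shorter_test \<longleftrightarrow> shorter d (fold step (the_word n) d)"
proof -
  have k0: "k 3 = 0" "k 4 = 0" "k 1 = code (the_word n)" "k 2 = code []" using k by (simp_all add: code_the_word)
  have "run d (read_word letter_proc 1 2) (\<one>\<^bsub>SexGroup\<^esub>, r, k) (word_elt n, r, k(1 := 0, 2 := code (rev (the_word n) @ [])))"
    by (rule run_read_word[OF run_letter_proc _ _ _ k0]) simp_all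
  moreover have "k(1 := 0, 2 := code (rev (the_word n) @ [])) = (\<lambda>_. 0)(2 := code (rev (the_word n)))"
    using k by (auto simp: fun_eq_iff)
  ultimately have 1: "run d (read_word letter_proc 1 2) (\<one>\<^bsub>SexGroup\<^esub>, r, k) (word_elt n, r, (\<lambda>_. 0)(2 := code (rev (the_word n))))" by simp
  have c: "word_elt n \<in> carrier SexGroup" using fold_apply_letter_Mod_So[OF Mod_So_one] by (rule Mod_So_carrier)
  have e: "word_elt n d = fold step (the_word n) d" using fold_apply_letter_at[OF SexG.one_closed d] d by (simp add: one_apply)
  obtain r' where r': "run d probes (word_elt n, r, (\<lambda>_. 0)(2 := code (rev (the_word n)))) (word_elt n, r', (\<lambda>_. 0)(2 := code (rev (the_word n))))"
    "saved d r'" "holds d (word_elt n, r', (\<lambda>_. 0)(2 := code (rev (the_word n)))) shorter_test \<longleftrightarrow> shorter d (word_elt n d)"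
    using run_probes[OF c d r] by blast
  have indep: "holds d (word_elt n, r', k) shorter_test \<longleftrightarrow> holds d (word_elt n, r', k') shorter_test" for k k'
    unfolding shorter_test_def holds_all_of by (simp add: holds_any_of)
  show ?thesis
  proof (rule that)
    show "run d attempt (\<one>\<^bsub>SexGroup\<^esub>, r, k) (word_elt n, r', (\<lambda>_. 0)(2 := code (rev (the_word n))))"
      unfolding attempt_def by (rule run.Seq[OF 1 r'(1)])
    show "saved d r'" by (rule r'(2))
    show "holds d (word_elt n, r', k) shorter_test \<longleftrightarrow> shorter d (fold step (the_word n) d)" for k
      using r'(3) indep unfolding e by blast
  qed
qed

text \<open>At the loop test for \<open>n\<close> the word with code \<open>n\<close> has been applied; by induction on the number of words
  still to be tried.\<close>

lemma run_search_loop: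
  assumes d: "d \<in> Sex" and N: "shorter d (fold step (the_word N) d)" "\<And>n. n < N \<Longrightarrow> \<not> shorter d (fold step (the_word n) d)"
    and n: "n \<le> N" "saved d r" "\<And>k. holds d (word_elt n, r, k) shorter_test \<longleftrightarrow> shorter d (fold step (the_word n) d)"
  shows "\<exists>r' k'. run d (While (Neg shorter_test) (Seq (read_word unletter_proc 2 1) (Seq (Incr 1) attempt)))
     (word_elt n, r, (\<lambda>_. 0)(2 := code (rev (the_word n)))) (word_elt N, r', k')"
  using n
proof (induction "N - n" arbitrary: n r)
  case 0
  then have e: "n = N" by simp
  have "\<not> holds d (word_elt N, r, (\<lambda>_. 0)(2 := code (rev (the_word N)))) (Neg shorter_test)"
    using 0(4) N(1) unfolding e by simp
  from WhileFalse[OF this] show ?case unfolding e by blast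
next
  case (Suc m)
  then have nN: "n < N" by simp
  let ?k = "(\<lambda>_. 0)(2 := code (rev (the_word n))) :: nat \<Rightarrow> nat"
  have h: "holds d (word_elt n, r, ?k) (Neg shorter_test)" using N(2)[OF nN] Suc.prems(3) by simp
  have "?k 3 = 0" "?k 4 = 0" "?k 2 = code (rev (the_word n))" "?k 1 = code []" by simp_all
  then have "run d (read_word unletter_proc 2 1) (word_elt n, r, ?k) (fold undo_letter (rev (the_word n)) (word_elt n), r, ?k(2 := 0, 1 := code (rev (rev (the_word n)) @ [])))"
    by (intro run_read_word[OF run_unletter_proc]) simp_all
  then have 1: "run d (read_word unletter_proc 2 1) (word_elt n, r, ?k) (\<one>\<^bsub>SexGroup\<^esub>, r, ?k(2 := 0, 1 := n))"
    unfolding fold_undo_letter[OF SexG.one_closed] by (simp add: code_the_word)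
  define k2 where "k2 = (?k(2 := 0, 1 := n))(1 := (?k(2 := 0, 1 := n)) 1 + 1)"
  have 2: "run d (Incr 1) (\<one>\<^bsub>SexGroup\<^esub>, r, ?k(2 := 0, 1 := n)) (\<one>\<^bsub>SexGroup\<^esub>, r, k2)" unfolding k2_def by (rule run.Incr)
  have k2: "k2 1 = Suc n" "\<And>j. j \<noteq> 1 \<Longrightarrow> k2 j = 0" by (simp_all add: k2_def)
  obtain r' where r': "run d attempt (\<one>\<^bsub>SexGroup\<^esub>, r, k2) (word_elt (Suc n), r', (\<lambda>_. 0)(2 := code (rev (the_word (Suc n)))))"
    "saved d r'" "\<And>k. holds d (word_elt (Suc n), r', k) shorter_test \<longleftrightarrow> shorter d (fold step (the_word (Suc n)) d)"
    by (rule run_attempt[where k = k2 and n = "Suc n", OF d Suc.prems(2) k2]) (assumption | rule that)+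
  have "m = N - Suc n" "Suc n \<le> N" using Suc.hyps(2) by simp_all
  from Suc.hyps(1)[OF this r'(2,3)] show ?case
    using WhileTrue[OF h run.Seq[OF 1 run.Seq[OF 2 r'(1)]]] by blast
qed

lemma run_search:
  assumes d: "d \<in> Sex" and N: "shorter d (fold step (the_word N) d)" "\<And>n. n < N \<Longrightarrow> \<not> shorter d (fold step (the_word n) d)"
  shows "\<exists>r' k'. run d search (\<one>\<^bsub>SexGroup\<^esub>, r, (\<lambda>_. 0)) (word_elt N, r', k')"
proof -
  obtain r1 where 1: "run d save (\<one>\<^bsub>SexGroup\<^esub>, r, (\<lambda>_. 0)) (\<one>\<^bsub>SexGroup\<^esub>, r1, (\<lambda>_. 0))" "saved (\<one>\<^bsub>SexGroup\<^esub> d) r1" by (rule run_save)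
  obtain r2 where 2: "run d attempt (\<one>\<^bsub>SexGroup\<^esub>, r1, (\<lambda>_. 0)) (word_elt 0, r2, (\<lambda>_. 0)(2 := code (rev (the_word 0))))"
    "saved d r2" "\<And>k. holds d (word_elt 0, r2, k) shorter_test \<longleftrightarrow> shorter d (fold step (the_word 0) d)"
    by (rule run_attempt[OF d 1(2)[unfolded one_apply[OF d]], of "\<lambda>_. 0" 0]) blast+
  from run_search_loop[OF d N _ 2(2,3)] obtain r' k' where
    "run d (While (Neg shorter_test) (Seq (read_word unletter_proc 2 1) (Seq (Incr 1) attempt)))
     (word_elt 0, r2, (\<lambda>_. 0)(2 := code (rev (the_word 0)))) (word_elt N, r', k')" by auto
  then show ?thesis unfolding search_def using run.Seq[OF 1(1) run.Seq[OF 2(1)]] by blast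
qed

section \<open>The descent\<close>

text \<open>The code of the word at which the search stops.\<close>

definition first_shorter :: "config \<Rightarrow> nat"
  where "first_shorter d = (LEAST n. shorter d (fold step (the_word n) d))"

text \<open>The reason why one sequence of group elements serves all configurations of an isometry class.\<close>

lemma first_shorter_transport: "first_shorter (transport g d) = first_shorter d"
  by (simp add: first_shorter_def fold_step_transport shorter_transport)

lemma first_shorter_least:
  assumes "negative c" "\<not> pinched c"
  shows "shorter c (fold step (the_word (first_shorter c)) c)" "n < first_shorter c \<Longrightarrow> \<not> shorter c (fold step (the_word n) c)"
proof -
  obtain w where "shorter c (fold step w c)" using shorter_exists[OF assms] by blast
  then have ex: "\<exists>n. shorter c (fold step (the_word n) c)" using the_word_code[of w] by metis
  from LeastI_ex[OF ex] show "shorter c (fold step (the_word (first_shorter c)) c)" unfolding first_shorter_def .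
  show "n < first_shorter c \<Longrightarrow> \<not> shorter c (fold step (the_word n) c)" unfolding first_shorter_def by (rule not_less_Least)
qed

text \<open>The descent stays within non-pinched configurations, where the search terminates.\<close>

lemma pinched_orbit:
  assumes "\<gamma> \<in> Mod_So" "c \<in> Sex" "pinched (\<gamma> c)" shows "pinched c"
proof -
  obtain \<sigma> y where s: "\<sigma> \<in> Mod_So" "y \<in> Sex" "y$1 = y$2" "y$3 = y$4" "y$5 = y$6" "\<gamma> c = \<sigma> y"
    using assms(3) unfolding pinched_def by blast
  note car = Mod_So_carrier[OF assms(1)] Mod_So_carrier[OF s(1)]
  have "c = (inv\<^bsub>SexGroup\<^esub> \<gamma>) (\<gamma> c)"
    using mult_apply[of "inv\<^bsub>SexGroup\<^esub> \<gamma>" \<gamma> c] assms(2) car by (simp add: SexG.l_inv one_apply)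
  also have "\<dots> = (inv\<^bsub>SexGroup\<^esub> \<gamma> \<otimes>\<^bsub>SexGroup\<^esub> \<sigma>) y" unfolding s(6) using car s(2) by (simp add: mult_apply)
  finally show ?thesis unfolding pinched_def using s Mod_So_mult[OF Mod_So_inv[OF assms(1)] s(1)] by blast
qed

lemma word_elt_Mod_So: "word_elt n \<in> Mod_So"
  by (rule fold_apply_letter_Mod_So[OF Mod_So_one])

fun descent :: "config \<Rightarrow> nat \<Rightarrow> config \<Rightarrow> config" where
  "descent c 0 = \<one>\<^bsub>SexGroup\<^esub>"
| "descent c (Suc n) = word_elt (first_shorter (descent c n c)) \<otimes>\<^bsub>SexGroup\<^esub> descent c n"

lemma descent_Mod_So: "descent c n \<in> Mod_So"
  by (induction n) (simp_all add: Mod_So_one Mod_So_mult word_elt_Mod_So)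

lemma word_elt_apply: "d \<in> Sex \<Longrightarrow> word_elt n d = fold step (the_word n) d"
  using fold_apply_letter_at[OF SexG.one_closed] by (simp add: one_apply)

theorem theorem1p1:
  shows "\<exists>P. \<forall>x\<in>X0. (\<forall>c\<in>x. \<not> pinched c) \<longrightarrow>
    (\<exists>\<gamma> :: nat \<Rightarrow> config \<Rightarrow> config. (\<forall>n. \<gamma> n \<in> Mod_So) \<and>
      (\<forall>c\<in>x. provides P c \<gamma> \<and>
        limitin X_top (\<lambda>n. iso_class (\<gamma> n c)) singular_class sequentially))"
proof (intro exI[of _ search] ballI impI)
  fix x assume x: "x \<in> X0" and np: "\<forall>c\<in>x. \<not> pinched c"
  have "x \<in> topspace X_top" using subsetD[OF connected_component_of_subset_topspace x[unfolded X0_def]] .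
  then obtain c0 where c0: "c0 \<in> x" unfolding topspace_X using self_iso_class by blast
  let ?\<gamma> = "descent c0"
  have c0N: "negative c0" "c0 \<in> Sex" using X0_negative(1)[OF x c0] Sex_iff by blast+
  show "\<exists>\<gamma> :: nat \<Rightarrow> config \<Rightarrow> config. (\<forall>n. \<gamma> n \<in> Mod_So) \<and>
      (\<forall>c\<in>x. provides search c \<gamma> \<and>
        limitin X_top (\<lambda>n. iso_class (\<gamma> n c)) singular_class sequentially)"
  proof (intro exI[of _ ?\<gamma>] conjI allI ballI)
    show "?\<gamma> n \<in> Mod_So" for n by (rule descent_Mod_So)
    fix c assume c: "c \<in> x"
    have N: "negative c" by (rule X0_negative(1)[OF x c])
    then have cS: "c \<in> Sex" using Sex_iff by blast
    have "c \<in> iso_class c0" using X0_negative(2)[OF x c0] c by blast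
    then obtain g where g: "c = transport g c0" by (auto simp: iso_class_transport)
    let ?y = "\<lambda>n. ?\<gamma> n c"
    have y0: "?y n = transport g (?\<gamma> n c0)" for n unfolding g by (rule Mod_So_transport[OF descent_Mod_So c0N(2)])
    have yN: "negative (?y n)" for n by (rule negative_orbit[OF descent_Mod_So N])
    have yS: "?y n \<in> Sex" for n using yN Sex_iff by blast
    have yp: "\<not> pinched (?y n)" for n using pinched_orbit[OF descent_Mod_So cS] np c by blast
    have fs: "first_shorter (?y n) = first_shorter (?\<gamma> n c0)" for n unfolding y0 by (rule first_shorter_transport)
    have suc: "?y (Suc n) = fold step (the_word (first_shorter (?y n))) (?y n)" for n
      unfolding fs using mult_apply[OF Mod_So_carrier[OF word_elt_Mod_So] Mod_So_carrier[OF descent_Mod_So] cS] word_elt_apply[OF yS] by simp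
    show "provides search c ?\<gamma>" unfolding provides_def
    proof (intro conjI allI)
      fix n
      obtain r k where "run (?y n) search (\<one>\<^bsub>SexGroup\<^esub>, (\<lambda>_. ?y n $ 1), (\<lambda>_. 0)) (word_elt (first_shorter (?y n)), r, k)"
        using run_search[OF yS first_shorter_least[OF yN yp]] by blast
      then show "\<exists>\<delta> r k. run (?y n) search (\<one>\<^bsub>SexGroup\<^esub>, (\<lambda>_. ?y n $ 1), (\<lambda>_. 0)) (\<delta>, r, k) \<and> ?\<gamma> (Suc n) = \<delta> \<otimes>\<^bsub>SexGroup\<^esub> ?\<gamma> n"
        unfolding descent.simps fs by blast
    qed simp
    have "\<exists>e. links e c"
      by (rule exI[of _ "hdist (c$1) (c$2) + hdist (c$2) (c$3) + hdist (c$3) (c$4) + hdist (c$4) (c$5) + hdist (c$5) (c$6)"])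
        (simp add: links_def add_nonneg_nonneg add_increasing add_increasing2)
    then obtain e where e: "links e c" by blast
    have l: "links (e / 2 ^ n) (?y n)" for n
    proof (induction n)
      case 0
      then show ?case using e by (simp add: one_apply cS)
    next
      case (Suc n)
      have "shorter (?y n) (?y (Suc n))" unfolding suc by (rule first_shorter_least(1)[OF yN yp])
      from shorter_links[OF this Suc] show ?case by (simp add: mult.commute)
    qed
    show "limitin X_top (\<lambda>n. iso_class (?y n)) singular_class sequentially"
    proof (rule limitin_singular[OF yS l])
      have "(\<lambda>n. e * (1 / 2) ^ n) \<longlonglongrightarrow> e * 0" by (intro tendsto_intros LIMSEQ_power_zero) simp
      then show "(\<lambda>n. e / 2 ^ n) \<longlonglongrightarrow> 0" by (simp add: power_divide)
    qed
  qed
qed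

end
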